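(* Let $u$ be the solution of $u''(t)+\alpha u'(t)+Au(t)=0$ for $t>0$, with $u(0)=u_0\in D(A)$ and $u'(0)=u_1\in D(A^{1/2})$. Define $$\mathcal{E}^{(1)}(u)(t)=\tfrac12\left(\|u'(t)\|^2+\|A^{1/2}u(t)\|^2\right).$$ Then for every $\delta$ with $0<\delta\le \frac13\min\left(\alpha,\frac{\lambda_1}{2\alpha}\right)$, $$\mathcal{E}^{(1)}(u)(t)\le 3\,e^{-2\delta t}\,\mathcal{E}^{(1)}(u)(0),\qquad t\ge 0.$$
   Context: $\Omega\subset\mathbb{R}^d$ is a convex polygonal or polyhedral domain and $\alpha>0$ is a fixed constant. $\mathbf{A}(x)$ is a real symmetric, uniformly positive definite matrix and $a_0(x)\ge 0$, with smooth coefficients. $(\cdot,\cdot)$ and $\|\cdot\|$ are the inner product and norm of $L^2(\Omega)$. $A$ is the self-adjoint positive definite operator on $L^2(\Omega)$ given by $A\phi=-\nabla\cdot(\mathbf{A}(x)\nabla\phi)+a_0(x)\phi$ with domain $D(A)=H^2(\Omega)\cap H^1_0(\Omega)$; $D(A^{1/2})=H^1_0(\Omega)$, and $(A^{1/2}v,A^{1/2}w)=(\mathbf{A}\nabla v,\nabla w)+(a_0v,w)$ for $v,w\in H_0^1(\Omega)$. $\lambda_1>0$ is the principal (smallest) eigenvalue of $A$. Primes denote time derivatives. The solution is the unique strong solution: for every $T>0$, $u\in L^\infty(0,T;D(A))$, $u'\in L^\infty(0,T;D(A^{1/2}))$, $u''\in L^\infty(0,T;L^2(\Omega))$, the equation holds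 for a.e. $t>0$, and $u(0)=u_0$, $u'(0)=u_1$ (time-continuous representatives are used for pointwise values). *)

theory Defs
  imports "HOL-Analysis.Analysis"
begin

section \<open>The Hilbert space of square integrable functions\<close>

text \<open>
  Elements are classes, modulo equality almost everywhere, of real-valued Borel functions with
  integrable square; every Lebesgue measurable function is a.e. equal to a Borel one, so that
  nothing is lost by using \<^const>\<open>lborel\<close>.
\<close>

definition sq_integrable :: "('a::euclidean_space \<Rightarrow> real) \<Rightarrow> bool" where
  "sq_integrable f \<longleftrightarrow> f \<in> borel_measurable lborel \<and> integrable lborel (\<lambda>x. (f x)\<^sup>2)"

definition L2_eq :: "('a::euclidean_space \<Rightarrow> real) \<Rightarrow> ('a \<Rightarrow> real) \<Rightarrow> bool" where
  "L2_eq f g \<longleftrightarrow> sq_integrable f \<and> sq_integrable g \<and> (AE x in lborel. f x = g x)"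

lemma sq_integrable_zero: "sq_integrable (\<lambda>_. 0)"
  by (simp add: sq_integrable_def)

lemma sq_integrable_mult:
  assumes "sq_integrable f" "sq_integrable g"
  shows "integrable lborel (\<lambda>x. f x * g x)"
proof (rule Bochner_Integration.integrable_bound)
  show "integrable lborel (\<lambda>x. (f x)\<^sup>2 + (g x)\<^sup>2)"
    using assms by (simp add: sq_integrable_def)
  show "(\<lambda>x. f x * g x) \<in> borel_measurable lborel"
    using assms by (auto simp: sq_integrable_def)
  have "\<bar>a * b\<bar> \<le> a\<^sup>2 + b\<^sup>2" for a b :: real
  proof -
    have "2 * \<bar>a * b\<bar> \<le> a\<^sup>2 + b\<^sup>2"
      using sum_squares_bound[of "\<bar>a\<bar>" "\<bar>b\<bar>"] by (simp add: abs_mult mult.assoc)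
    moreover have "0 \<le> \<bar>a * b\<bar>" by simp
    ultimately show ?thesis by linarith
  qed
  thus "AE x in lborel. norm (f x * g x) \<le> norm ((f x)\<^sup>2 + (g x)\<^sup>2)"
    by (intro AE_I2) simp
qed

lemma sq_integrable_add:
  assumes "sq_integrable f" "sq_integrable g"
  shows "sq_integrable (\<lambda>x. f x + g x)"
proof -
  have "integrable lborel (\<lambda>x. (f x)\<^sup>2 + (g x)\<^sup>2 + 2 * (f x * g x))"
    using assms sq_integrable_mult[OF assms] by (simp add: sq_integrable_def)
  moreover have "(\<lambda>x. (f x)\<^sup>2 + (g x)\<^sup>2 + 2 * (f x * g x)) = (\<lambda>x. (f x + g x)\<^sup>2)"
    by (simp add: power2_sum algebra_simps)
  ultimately show ?thesis
    using assms by (auto simp: sq_integrable_def)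
qed

lemma sq_integrable_scale:
  assumes "sq_integrable f"
  shows "sq_integrable (\<lambda>x. c * f x)"
  using assms by (auto simp: sq_integrable_def power_mult_distrib)

lemma part_equivp_L2_eq: "part_equivp (L2_eq :: ('a::euclidean_space \<Rightarrow> real) \<Rightarrow> _)"
proof (rule part_equivpI)
  show "\<exists>f::'a \<Rightarrow> real. L2_eq f f"
    by (rule exI[of _ "\<lambda>_. 0"]) (simp add: L2_eq_def sq_integrable_zero)
  show "symp (L2_eq :: ('a \<Rightarrow> real) \<Rightarrow> _)"
    by (rule sympI) (auto simp: L2_eq_def elim: eventually_mono)
  show "transp (L2_eq :: ('a \<Rightarrow> real) \<Rightarrow> _)"
    by (rule transpI) (auto simp: L2_eq_def elim: eventually_elim2)
qed

quotient_type (overloaded) 'a L2 = "'a::euclidean_space \<Rightarrow> real" / partial: L2_eq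
  by (rule part_equivp_L2_eq)

instantiation L2 :: (euclidean_space) real_inner
begin

lift_definition zero_L2 :: "'a L2" is "\<lambda>_. 0"
  by (simp add: L2_eq_def sq_integrable_zero)

lift_definition plus_L2 :: "'a L2 \<Rightarrow> 'a L2 \<Rightarrow> 'a L2" is "\<lambda>f g x. f x + g x"
  by (auto simp: L2_eq_def sq_integrable_add elim: eventually_elim2)

lift_definition scaleR_L2 :: "real \<Rightarrow> 'a L2 \<Rightarrow> 'a L2" is "\<lambda>c f x. c * f x"
  by (auto simp: L2_eq_def sq_integrable_scale elim: eventually_mono)

lift_definition inner_L2 :: "'a L2 \<Rightarrow> 'a L2 \<Rightarrow> real" is "\<lambda>f g. \<integral>x. f x * g x \<partial>lborel"
proof -
  fix f f' g g' :: "'a \<Rightarrow> real"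
  assume "L2_eq f f'" "L2_eq g g'"
  then show "(\<integral>x. f x * g x \<partial>lborel) = (\<integral>x. f' x * g' x \<partial>lborel)"
    by (intro integral_cong_AE) (auto simp: L2_eq_def sq_integrable_def elim: eventually_elim2)
qed

definition uminus_L2 :: "'a L2 \<Rightarrow> 'a L2" where
  "uminus_L2 f = (-1) *\<^sub>R f"

definition minus_L2 :: "'a L2 \<Rightarrow> 'a L2 \<Rightarrow> 'a L2" where
  "minus_L2 f g = f + - g"

definition norm_L2 :: "'a L2 \<Rightarrow> real" where
  "norm_L2 f = sqrt (inner f f)"

definition sgn_L2 :: "'a L2 \<Rightarrow> 'a L2" where
  "sgn_L2 f = inverse (norm f) *\<^sub>R f"

definition dist_L2 :: "'a L2 \<Rightarrow> 'a L2 \<Rightarrow> real" where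
  "dist_L2 f g = norm (f - g)"

definition uniformity_L2 :: "('a L2 \<times> 'a L2) filter" where
  "uniformity_L2 = (INF e\<in>{0<..}. principal {(f, g). dist f g < e})"

definition open_L2 :: "'a L2 set \<Rightarrow> bool" where
  "open_L2 U \<longleftrightarrow> (\<forall>f\<in>U. eventually (\<lambda>(f', g). f' = f \<longrightarrow> g \<in> U) uniformity)"

instance
proof
  fix f g h :: "'a L2" and a b :: real
  show "f + g + h = f + (g + h)"
    by transfer (simp add: L2_eq_def sq_integrable_add add.assoc)
  show "f + g = g + f"
    by transfer (simp add: L2_eq_def sq_integrable_add add.commute)
  show "0 + f = f"
    by transfer (auto simp: L2_eq_def)
  show "- f + f = 0"
    unfolding uminus_L2_def
    by transfer (auto simp: L2_eq_def sq_integrable_zero)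
  show "f - g = f + - g"
    by (simp add: minus_L2_def)
  show "a *\<^sub>R (f + g) = a *\<^sub>R f + a *\<^sub>R g"
    by transfer (simp add: L2_eq_def sq_integrable_add sq_integrable_scale flip: distrib_left)
  show "(a + b) *\<^sub>R f = a *\<^sub>R f + b *\<^sub>R f"
    by transfer (simp add: L2_eq_def sq_integrable_scale flip: distrib_right)
  show "a *\<^sub>R b *\<^sub>R f = (a * b) *\<^sub>R f"
    by transfer (simp add: L2_eq_def sq_integrable_scale flip: mult.assoc)
  show "1 *\<^sub>R f = f"
    by transfer (auto simp: L2_eq_def)
  show "sgn f = inverse (norm f) *\<^sub>R f"
    by (simp add: sgn_L2_def)
  show "dist f g = norm (f - g)"
    by (simp add: dist_L2_def)
  show "(uniformity :: ('a L2 \<times> 'a L2) filter) = (INF e\<in>{0<..}. principal {(f, g). dist f g < e})"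
    by (simp add: uniformity_L2_def)
  show "open U \<longleftrightarrow> (\<forall>f\<in>U. eventually (\<lambda>(f', g). f' = f \<longrightarrow> g \<in> U) uniformity)" for U :: "'a L2 set"
    by (simp add: open_L2_def)
  show "inner f g = inner g f"
    by transfer (simp add: mult.commute)
  show "inner (f + g) h = inner f h + inner g h"
    by transfer (simp add: L2_eq_def distrib_right sq_integrable_mult)
  show "inner (a *\<^sub>R f) g = a * inner f g"
    by transfer (simp add: L2_eq_def mult.assoc)
  show "0 \<le> inner f f"
    by transfer simp
  show "inner f f = 0 \<longleftrightarrow> f = 0"
  proof transfer
    fix f :: "'a \<Rightarrow> real"
    assume "L2_eq f f"
    then have "sq_integrable f" by (simp add: L2_eq_def)
    moreover from this have "(\<integral>x. f x * f x \<partial>lborel) = 0 \<longleftrightarrow> (AE x in lborel. f x * f x = 0)"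
      by (intro integral_nonneg_eq_0_iff_AE sq_integrable_mult) auto
    ultimately show "(\<integral>x. f x * f x \<partial>lborel) = 0 \<longleftrightarrow> L2_eq f (\<lambda>_. 0)"
      by (simp add: L2_eq_def sq_integrable_zero)
  qed
  show "norm f = sqrt (inner f f)"
    by (simp add: norm_L2_def)
qed

end

text \<open>$L^2(\Omega)$, embedded isometrically into $L^2(\mathbf{R}^d)$ by extension by zero.\<close>

definition L2_on :: "'a::euclidean_space set \<Rightarrow> 'a L2 set" where
  "L2_on \<Omega> = {f. AE x in lborel. x \<notin> \<Omega> \<longrightarrow> rep_L2 f x = 0}"

text \<open>The indicator makes the values of the coefficient outside \<^term>\<open>\<Omega>\<close> irrelevant.\<close>

definition L2_mult :: "'a::euclidean_space set \<Rightarrow> ('a \<Rightarrow> real) \<Rightarrow> 'a L2 \<Rightarrow> 'a L2" where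
  "L2_mult \<Omega> c f = abs_L2 (\<lambda>x. indicator \<Omega> x * c x * rep_L2 f x)"


section \<open>Smooth functions, weak derivatives and Sobolev spaces\<close>

definition dir_deriv :: "'a::euclidean_space \<Rightarrow> ('a \<Rightarrow> real) \<Rightarrow> 'a \<Rightarrow> real" where
  "dir_deriv b f x = frechet_derivative f (at x) b"

text \<open>Only meant for open sets \<^term>\<open>U\<close>.\<close>

fun k_smooth_on :: "nat \<Rightarrow> 'a::euclidean_space set \<Rightarrow> ('a \<Rightarrow> real) \<Rightarrow> bool" where
  "k_smooth_on 0 U f \<longleftrightarrow> continuous_on U f"
| "k_smooth_on (Suc k) U f \<longleftrightarrow>
     (\<forall>x\<in>U. f differentiable (at x)) \<and> (\<forall>b\<in>Basis. k_smooth_on k U (dir_deriv b f))"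

definition smooth_on :: "'a::euclidean_space set \<Rightarrow> ('a \<Rightarrow> real) \<Rightarrow> bool" where
  "smooth_on U f \<longleftrightarrow> (\<forall>k. k_smooth_on k U f)"

definition test_functions :: "'a::euclidean_space set \<Rightarrow> ('a \<Rightarrow> real) set" where
  "test_functions \<Omega> = {\<phi>. smooth_on UNIV \<phi> \<and>
     compact (closure {x. \<phi> x \<noteq> 0}) \<and> closure {x. \<phi> x \<noteq> 0} \<subseteq> \<Omega>}"

definition has_weak_deriv ::
  "'a::euclidean_space set \<Rightarrow> 'a \<Rightarrow> 'a L2 \<Rightarrow> 'a L2 \<Rightarrow> bool" where
  "has_weak_deriv \<Omega> b f g \<longleftrightarrow> f \<in> L2_on \<Omega> \<and> g \<in> L2_on \<Omega> \<and>
     (\<forall>\<phi>\<in>test_functions \<Omega>. inner f (abs_L2 (dir_deriv b \<phi>)) = - inner g (abs_L2 \<phi>))"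

definition weak_deriv :: "'a::euclidean_space set \<Rightarrow> 'a \<Rightarrow> 'a L2 \<Rightarrow> 'a L2" where
  "weak_deriv \<Omega> b f = (THE g. has_weak_deriv \<Omega> b f g)"

definition H1 :: "'a::euclidean_space set \<Rightarrow> 'a L2 set" where
  "H1 \<Omega> = {f \<in> L2_on \<Omega>. \<forall>b\<in>Basis. \<exists>g. has_weak_deriv \<Omega> b f g}"

definition H1_norm :: "'a::euclidean_space set \<Rightarrow> 'a L2 \<Rightarrow> real" where
  "H1_norm \<Omega> f = sqrt ((norm f)\<^sup>2 + (\<Sum>b\<in>Basis. (norm (weak_deriv \<Omega> b f))\<^sup>2))"

definition H10 :: "'a::euclidean_space set \<Rightarrow> 'a L2 set" where
  "H10 \<Omega> = {f \<in> H1 \<Omega>. \<forall>e>0. \<exists>\<phi>\<in>test_functions \<Omega>. H1_norm \<Omega> (f - abs_L2 \<phi>) < e}"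

definition H2 :: "'a::euclidean_space set \<Rightarrow> 'a L2 set" where
  "H2 \<Omega> = {f \<in> H1 \<Omega>. \<forall>b\<in>Basis. weak_deriv \<Omega> b f \<in> H1 \<Omega>}"


section \<open>The elliptic operator\<close>

definition convex_polytopal_domain :: "'a::euclidean_space set \<Rightarrow> bool" where
  "convex_polytopal_domain \<Omega> \<longleftrightarrow> \<Omega> \<noteq> {} \<and> (\<exists>P. polytope P \<and> \<Omega> = interior P)"

text \<open>Smoothness of the coefficients is understood up to the boundary.\<close>

definition elliptic_coeffs ::
  "(real^'n) set \<Rightarrow> (real^'n \<Rightarrow> real^'n^'n) \<Rightarrow> (real^'n \<Rightarrow> real) \<Rightarrow> bool" where
  "elliptic_coeffs \<Omega> M a\<^sub>0 \<longleftrightarrow>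
     (\<exists>U. open U \<and> closure \<Omega> \<subseteq> U \<and> smooth_on U a\<^sub>0 \<and>
          (\<forall>i j. smooth_on U (\<lambda>x. M x $ i $ j))) \<and>
     (\<forall>x\<in>\<Omega>. transpose (M x) = M x) \<and>
     (\<exists>c>0. \<forall>x\<in>\<Omega>. \<forall>\<xi>. c * (norm \<xi>)\<^sup>2 \<le> inner \<xi> (M x *v \<xi>)) \<and>
     (\<forall>x\<in>\<Omega>. 0 \<le> a\<^sub>0 x)"

definition ell_dom :: "(real^'n) set \<Rightarrow> (real^'n) L2 set" where
  "ell_dom \<Omega> = H2 \<Omega> \<inter> H10 \<Omega>"

definition ell_op ::
  "(real^'n) set \<Rightarrow> (real^'n \<Rightarrow> real^'n^'n) \<Rightarrow> (real^'n \<Rightarrow> real) \<Rightarrow> (real^'n) L2 \<Rightarrow> (real^'n) L2" where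
  "ell_op \<Omega> M a\<^sub>0 v =
     - (\<Sum>i\<in>UNIV. weak_deriv \<Omega> (axis i 1)
          (\<Sum>j\<in>UNIV. L2_mult \<Omega> (\<lambda>x. M x $ i $ j) (weak_deriv \<Omega> (axis j 1) v)))
     + L2_mult \<Omega> a\<^sub>0 v"


section \<open>Unbounded operators\<close>

text \<open>
  An unbounded operator in the Hilbert space carried by a subspace \<^term>\<open>H\<close> is a domain
  \<^term>\<open>D\<close> together with a total function \<^term>\<open>A\<close>, of which only the values on \<^term>\<open>D\<close>
  count. The last clause of the next definition says that the domain of the adjoint is
  contained in \<^term>\<open>D\<close>.
\<close>

definition selfadjoint_op :: "'h::real_inner set \<Rightarrow> 'h set \<Rightarrow> ('h \<Rightarrow> 'h) \<Rightarrow> bool" where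
  "selfadjoint_op H D A \<longleftrightarrow>
     subspace D \<and> D \<subseteq> H \<and> H \<subseteq> closure D \<and> A ` D \<subseteq> H \<and>
     (\<forall>v\<in>D. \<forall>w\<in>D. A (v + w) = A v + A w) \<and> (\<forall>c. \<forall>v\<in>D. A (c *\<^sub>R v) = c *\<^sub>R A v) \<and>
     (\<forall>v\<in>D. \<forall>w\<in>D. inner (A v) w = inner v (A w)) \<and>
     (\<forall>y\<in>H. \<forall>z\<in>H. (\<forall>v\<in>D. inner (A v) y = inner v z) \<longrightarrow> y \<in> D)"

definition selfadjoint_posdef_op :: "'h::real_inner set \<Rightarrow> 'h set \<Rightarrow> ('h \<Rightarrow> 'h) \<Rightarrow> bool" where
  "selfadjoint_posdef_op H D A \<longleftrightarrow>
     selfadjoint_op H D A \<and> (\<forall>v\<in>D. v \<noteq> 0 \<longrightarrow> 0 < inner (A v) v)"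

text \<open>
  The operator \<^term>\<open>B\<close> with domain \<^term>\<open>D\<^sub>B\<close> is the (unique) nonnegative self-adjoint
  square root of \<^term>\<open>A\<close> with domain \<^term>\<open>D\<close>.
\<close>

definition is_sqrt_op ::
  "'h::real_inner set \<Rightarrow> 'h set \<Rightarrow> ('h \<Rightarrow> 'h) \<Rightarrow> 'h set \<Rightarrow> ('h \<Rightarrow> 'h) \<Rightarrow> bool" where
  "is_sqrt_op H D A D\<^sub>B B \<longleftrightarrow>
     selfadjoint_op H D\<^sub>B B \<and> (\<forall>v\<in>D\<^sub>B. 0 \<le> inner (B v) v) \<and>
     D = {v \<in> D\<^sub>B. B v \<in> D\<^sub>B} \<and> (\<forall>v\<in>D. A v = B (B v))"

definition eigenvalue_op :: "'h::real_inner set \<Rightarrow> ('h \<Rightarrow> 'h) \<Rightarrow> real \<Rightarrow> bool" where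
  "eigenvalue_op D A \<mu> \<longleftrightarrow> (\<exists>v\<in>D. v \<noteq> 0 \<and> A v = \<mu> *\<^sub>R v)"

definition principal_eigenvalue :: "'h::real_inner set \<Rightarrow> ('h \<Rightarrow> 'h) \<Rightarrow> real \<Rightarrow> bool" where
  "principal_eigenvalue D A \<mu> \<longleftrightarrow> eigenvalue_op D A \<mu> \<and> (\<forall>\<nu>. eigenvalue_op D A \<nu> \<longrightarrow> \<mu> \<le> \<nu>)"


section \<open>Strong solutions of the damped wave equation\<close>

text \<open>
  $f \in L^\infty(0,T;D)$, where the domain \<^term>\<open>D\<close> of \<^term>\<open>B\<close> carries the graph norm.
  The space \<^typ>\<open>'a L2\<close> is separable, so Borel measurability is strong measurability.
\<close>

definition Linfty :: "real \<Rightarrow> 'h::real_inner set \<Rightarrow> ('h \<Rightarrow> 'h) \<Rightarrow> (real \<Rightarrow> 'h) \<Rightarrow> bool" where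
  "Linfty T D B f \<longleftrightarrow>
     f \<in> borel_measurable (lebesgue_on {0<..<T}) \<and>
     (\<lambda>t. B (f t)) \<in> borel_measurable (lebesgue_on {0<..<T}) \<and>
     (\<exists>C. AE t in lebesgue_on {0<..<T}. f t \<in> D \<and> norm (f t) + norm (B (f t)) \<le> C)"

text \<open>
  The distributional derivative on $(0,T)$. It is used only for strongly measurable, essentially
  bounded functions, for which the gauge integral is the Bochner integral.
\<close>

definition has_weak_time_deriv ::
  "real \<Rightarrow> (real \<Rightarrow> 'h::real_inner) \<Rightarrow> (real \<Rightarrow> 'h) \<Rightarrow> bool" where
  "has_weak_time_deriv T f g \<longleftrightarrow>
     (\<forall>\<phi>\<in>test_functions {0<..<T}. \<exists>I.
        ((\<lambda>t. deriv \<phi> t *\<^sub>R f t) has_integral I) {0..T} \<and>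
        ((\<lambda>t. \<phi> t *\<^sub>R g t) has_integral - I) {0..T})"

text \<open>
  Here \<^term>\<open>u\<close> and \<^term>\<open>u'\<close> are the time-continuous representatives of the solution and of
  its time derivative, and the operators \<^term>\<open>A\<close> and \<^term>\<open>B\<close> have domains \<^term>\<open>D\<close> and
  \<^term>\<open>D\<^sub>B\<close>.
\<close>

definition strong_solution ::
  "'h::real_inner set \<Rightarrow> 'h set \<Rightarrow> ('h \<Rightarrow> 'h) \<Rightarrow> 'h set \<Rightarrow> ('h \<Rightarrow> 'h) \<Rightarrow> real \<Rightarrow>
   'h \<Rightarrow> 'h \<Rightarrow> (real \<Rightarrow> 'h) \<Rightarrow> (real \<Rightarrow> 'h) \<Rightarrow> bool" where
  "strong_solution H D A D\<^sub>B B \<alpha> u\<^sub>0 u\<^sub>1 u u' \<longleftrightarrow>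
     continuous_on {0..} u \<and> continuous_on {0..} u' \<and> u 0 = u\<^sub>0 \<and> u' 0 = u\<^sub>1 \<and>
     (\<exists>u''.
        (\<forall>T>0. Linfty T D A u \<and> Linfty T D\<^sub>B B u' \<and> Linfty T H id u'' \<and>
               has_weak_time_deriv T u u' \<and> has_weak_time_deriv T u' u'') \<and>
        (AE t in lebesgue_on {0<..}. u'' t + \<alpha> *\<^sub>R u' t + A (u t) = 0))"

definition energy :: "('h::real_inner \<Rightarrow> 'h) \<Rightarrow> (real \<Rightarrow> 'h) \<Rightarrow> (real \<Rightarrow> 'h) \<Rightarrow> real \<Rightarrow> real" where
  "energy B u u' t = 1 / 2 * ((norm (u' t))\<^sup>2 + (norm (B (u t)))\<^sup>2)"

end

theory Submission
  imports Defs
begin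

text \<open>
  Write $E = \frac12(\|u'\|^2 + \|A^{1/2}u\|^2)$. The decay comes from the Lyapunov functional
  $F = E + \frac32\delta (u',u) + \frac34\delta\alpha\|u\|^2$, whose last summand is chosen so that
  $\alpha(u',u)$ cancels in the derivative:
  $F' = -\alpha\|u'\|^2 + \frac32\delta(\|u'\|^2 - (Au,u))$ along a classical solution. The condition on
  $\delta$ says that $3\delta\le\alpha$ and $6\delta\alpha\le\lambda_1$; with $(Av,v)\ge\lambda_1\|v\|^2$ it
  makes $F' + 2\delta F\le 0$ (\<open>lyapunov_decay\<close>) and $\frac12E\le F\le\frac32E$
  (\<open>lyapunov_equivalent\<close>). The quotient of the two constants is the factor 3.

  Two ingredients of this computation have to be supplied.

  The inequality $(Av,v)\ge\lambda_1\|v\|^2$ concerns the bottom of the spectrum, whereas $\lambda_1$ is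
  only the least eigenvalue; they agree because the infimum of the Rayleigh quotient is attained
  (\<open>rayleigh_quotient_ge_principal_eigenvalue\<close>), which is a matter of compactness. The compact
  embedding of $H^1_0(\Omega)$ is used in the form of Friedrichs' inequality (\<open>friedrichs\<close>):
  up to an arbitrarily small multiple of the Dirichlet integral, $\|v\|^2$ is bounded by finitely
  many squares of linear functionals, namely the means over the cells of a fine grid. The error is
  the mean oscillation on the cells, which is controlled by
  $\|\phi(\cdot+h)-\phi\|\le|h|\,\|\nabla\phi\|$ (\<open>translation_estimate\<close>). Integration by parts
  against approximating test functions bounds the Dirichlet integral by $(Av,v)$
  (\<open>ell_op_coercive\<close>). Weak derivatives are unique because test functions are dense in
  $L^2(\Omega)$; this is inherited from the density of the domain of $A$, each element of which is a
  limit of test functions by the definition of $H^1_0(\Omega)$.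

  The second ingredient is regularity, since a strong solution satisfies the equation only almost
  everywhere. For $w\in D(A)$ the equation and the lemma of du Bois-Reymond
  (\<open>has_derivative_of_weak_deriv\<close>) show that $(u',w)$ is continuously differentiable with
  derivative $-\alpha(u',w)-(u,Aw)$. After integration in time, self-adjointness puts the Steklov
  averages $\frac1h\int_t^{t+h}u$ into $D(A)$, and they solve the equation in the classical sense
  (\<open>avg_equation\<close>). The decay estimate for the averages passes to the limit $h\to0$: as $u'$ is
  Lipschitz continuous, $A$ is bounded along the averages, and
  $\|A^{1/2}x\|^2 = (Ax,x)\le\|Ax\|\,\|x\|$ then turns convergence in $L^2$ into convergence of
  $A^{1/2}$ of the averages (\<open>B_tendsto\<close>).
\<close>

section \<open>Representatives and completeness of $L^2$\<close>

lemma sq_integrable_rep_L2: "sq_integrable (rep_L2 f)"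
  using Quotient3_rep_reflp[OF Quotient3_L2, of f] by (simp add: L2_eq_def)

lemma L2_eq_refl: "sq_integrable f \<Longrightarrow> L2_eq f f"
  by (simp add: L2_eq_def)

lemma abs_rep_L2: "abs_L2 (rep_L2 f) = f"
  by (rule Quotient3_abs_rep[OF Quotient3_L2])

lemma rep_abs_L2:
  assumes "sq_integrable f"
  shows "AE x in lborel. rep_L2 (abs_L2 f) x = f x"
  using Quotient3_rel_rep[OF Quotient3_L2, of "abs_L2 f" "abs_L2 f"] rep_abs_rsp_left[OF Quotient3_L2, of f f] L2_eq_refl[OF assms] by (simp add: L2_eq_def)

lemma inner_abs_L2:
  assumes "sq_integrable f" "sq_integrable g"
  shows "inner (abs_L2 f) (abs_L2 g) = (\<integral>x. f x * g x \<partial>lborel)"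
  using assms by (simp add: inner_L2.abs_eq L2_eq_refl)

lemma norm_abs_L2:
  assumes "sq_integrable f"
  shows "(norm (abs_L2 f))\<^sup>2 = (\<integral>x. (f x)\<^sup>2 \<partial>lborel)"
  using inner_abs_L2[OF assms assms] by (simp add: power2_norm_eq_inner flip: power2_eq_square)

lemma norm_rep_L2: "(norm f)\<^sup>2 = (\<integral>x. (rep_L2 f x)\<^sup>2 \<partial>lborel)"
  using norm_abs_L2[OF sq_integrable_rep_L2, of f] by (simp add: abs_rep_L2)

lemma abs_L2_add:
  "sq_integrable f \<Longrightarrow> sq_integrable g \<Longrightarrow> abs_L2 (\<lambda>x. f x + g x) = abs_L2 f + abs_L2 g"
  by (simp add: plus_L2.abs_eq L2_eq_refl)

lemma abs_L2_scale:
  "sq_integrable f \<Longrightarrow> abs_L2 (\<lambda>x. c * f x) = c *\<^sub>R abs_L2 f"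
  by (simp add: scaleR_L2.abs_eq L2_eq_refl)

lemma sq_integrable_diff:
  assumes "sq_integrable f" "sq_integrable g"
  shows "sq_integrable (\<lambda>x. f x - g x)"
  using sq_integrable_add[OF assms(1) sq_integrable_scale[OF assms(2), of "-1"]] by simp

lemma abs_L2_diff:
  assumes "sq_integrable f" "sq_integrable g"
  shows "abs_L2 (\<lambda>x. f x - g x) = abs_L2 f - abs_L2 g"
  using abs_L2_add[OF assms(1) sq_integrable_scale[OF assms(2), of "-1"]]
    abs_L2_scale[OF assms(2), of "-1"] by simp

lemma sq_integrableI_bounded:
  assumes "sq_integrable f" "g \<in> borel_measurable lborel" "AE x in lborel. \<bar>g x\<bar> \<le> C * \<bar>f x\<bar>"
  shows "sq_integrable g"
  unfolding sq_integrable_def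
proof
  show "integrable lborel (\<lambda>x. (g x)\<^sup>2)"
  proof (rule Bochner_Integration.integrable_bound)
    show "integrable lborel (\<lambda>x. C\<^sup>2 * (f x)\<^sup>2)"
      using assms(1) by (simp add: sq_integrable_def)
    show "(\<lambda>x. (g x)\<^sup>2) \<in> borel_measurable lborel" using assms(2) by simp
    show "AE x in lborel. norm ((g x)\<^sup>2) \<le> norm (C\<^sup>2 * (f x)\<^sup>2)"
      using assms(3)
    proof eventually_elim
      case (elim x)
      have "\<bar>g x\<bar>\<^sup>2 \<le> (C * \<bar>f x\<bar>)\<^sup>2"
        using elim by (intro power_mono) auto
      thus ?case by (simp add: power_mult_distrib)
    qed
  qed
qed (use assms in auto)

lemma nn_integral_rep_L2:
  "(\<integral>\<^sup>+x. ennreal ((rep_L2 f x - rep_L2 g x)\<^sup>2) \<partial>lborel) = ennreal ((norm (f - g))\<^sup>2)"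
proof -
  note s = sq_integrable_diff[OF sq_integrable_rep_L2 sq_integrable_rep_L2, of f g]
  have "(\<integral>\<^sup>+x. ennreal ((rep_L2 f x - rep_L2 g x)\<^sup>2) \<partial>lborel) =
     ennreal (\<integral>x. (rep_L2 f x - rep_L2 g x)\<^sup>2 \<partial>lborel)"
    using s by (intro nn_integral_eq_integral) (auto simp: sq_integrable_def)
  thus ?thesis
    using norm_abs_L2[OF s] by (simp add: abs_L2_diff sq_integrable_rep_L2 abs_rep_L2)
qed

lemma rep_L2_measurable[measurable]: "rep_L2 f \<in> borel_measurable lborel"
  using sq_integrable_rep_L2[of f] by (simp add: sq_integrable_def)

text \<open>The weights $2^n$ leave $\sum_n 2^n\|d_n\|^2\le\sum_n 2^{-n}$ finite for the increments $d_n$, so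
  $\sum_n 2^n d_n(x)^2$ is finite for almost every $x$, and then $\sum_n |d_n(x)|$ converges because
  $|d|\le 2^{-n} + 2^n d^2$.\<close>

lemma AE_convergent_of_geometric_steps:
  fixes f :: "nat \<Rightarrow> 'a::euclidean_space L2"
  assumes "\<And>n. norm (f (Suc n) - f n) \<le> (1/2)^n"
  shows "AE x in lborel. convergent (\<lambda>n. rep_L2 (f n) x)"
proof -
  let ?d = "\<lambda>n x. rep_L2 (f (Suc n)) x - rep_L2 (f n) x"
  have "(\<integral>\<^sup>+x. (\<Sum>n. ennreal (2^n * (?d n x)\<^sup>2)) \<partial>lborel) =
        (\<Sum>n. \<integral>\<^sup>+x. ennreal (2^n * (?d n x)\<^sup>2) \<partial>lborel)"
    by (intro nn_integral_suminf) auto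
  also have "\<dots> = (\<Sum>n. ennreal (2^n * (norm (f (Suc n) - f n))\<^sup>2))"
    by (subst ennreal_mult, simp, simp, subst nn_integral_cmult)
       (simp_all add: nn_integral_rep_L2 ennreal_mult)
  also have "\<dots> \<le> (\<Sum>n. ennreal ((1/2)^n))"
  proof (intro suminf_le ennreal_leI)
    fix n :: nat
    have "(norm (f (Suc n) - f n))\<^sup>2 \<le> ((1/2)^n)\<^sup>2"
      using assms[of n] by (intro power_mono) auto
    hence "2^n * (norm (f (Suc n) - f n))\<^sup>2 \<le> 2^n * ((1/2)^n)\<^sup>2"
      by (intro mult_left_mono) auto
    also have "\<dots> = (1/2::real)^n"
      by (simp add: power2_eq_square power_one_over)
    finally show "2^n * (norm (f (Suc n) - f n))\<^sup>2 \<le> (1/2::real)^n" .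
  qed auto
  also have "\<dots> < \<infinity>"
    by (subst suminf_ennreal2) (auto simp: summable_geometric)
  finally have fin: "(\<integral>\<^sup>+x. (\<Sum>n. ennreal (2^n * (?d n x)\<^sup>2)) \<partial>lborel) \<noteq> \<infinity>" by simp
  have "AE x in lborel. (\<Sum>n. ennreal (2^n * (?d n x)\<^sup>2)) \<noteq> \<infinity>"
    by (rule nn_integral_PInf_AE) (use fin in auto)
  thus ?thesis
  proof eventually_elim
    case (elim x)
    have s: "summable (\<lambda>n. 2^n * (?d n x)\<^sup>2)"
      using elim by (intro summable_suminf_not_top) auto
    have "summable (\<lambda>n. ?d n x)"
    proof (rule summable_comparison_test')
      show "summable (\<lambda>n. (1/2)^n + 2^n * (?d n x)\<^sup>2)"
        by (intro summable_add s) (simp add: summable_geometric)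
      fix n :: nat
      let ?y = "\<bar>?d n x\<bar>"
      have half: "a \<le> s" if "2 * a \<le> s" "0 \<le> a" for a s :: real using that by simp
      have f1: "2 * ((1/2)^n * (2^n * ?y)) \<le> ((1/2)^n)\<^sup>2 * 2^n + (2^n * ?y)\<^sup>2 * (1/2)^n"
      proof -
        \<comment> \<open>This is $2|d|\le 2^{-n}+2^n d^2$, written with powers that the simplifier can cancel.\<close>
        have "0 \<le> ((1/2)^n - 2^n * ?y * (1/2)^n)\<^sup>2 * (2::real)^n" by simp
        also have "\<dots> = ((1/2)^n)\<^sup>2 * 2^n + (2^n * ?y)\<^sup>2 * (1/2)^n * ((1/2)^n * 2^n)
            - 2 * ((1/2)^n * (2^n * ?y)) * ((1/2)^n * 2^n)"
          by (simp add: power2_eq_square algebra_simps)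
        also have "(1/2)^n * (2::real)^n = 1" by (simp add: power_one_over)
        finally show ?thesis by simp
      qed
      have f2: "(1/2)^n * ((2::real)^n * ?y) = ?y" by (simp add: power_one_over)
      have f3: "((1/2)^n)\<^sup>2 * (2::real)^n = (1/2)^n"
        by (simp add: power_one_over power2_eq_square)
      have f4: "((2::real)^n * ?y)\<^sup>2 * (1/2)^n = 2^n * (?d n x)\<^sup>2"
        by (simp add: power_one_over power2_eq_square)
      show "norm (?d n x) \<le> (1/2)^n + 2^n * (?d n x)\<^sup>2"
        unfolding real_norm_def using half[OF f1[unfolded f2 f3 f4] abs_ge_zero] .
    qed
    hence "convergent (\<lambda>n. \<Sum>i<n. ?d i x)"
      by (simp add: summable_iff_convergent)
    hence "convergent (\<lambda>n. rep_L2 (f n) x - rep_L2 (f 0) x)"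
      unfolding sum_lessThan_telescope[of "\<lambda>n. rep_L2 (f n) x"] .
    from convergent_add[OF this convergent_const[of "rep_L2 (f 0) x"]]
    show ?case by simp
  qed
qed

instance L2 :: (euclidean_space) banach
proof
  fix X :: "nat \<Rightarrow> 'a L2"
  assume C: "Cauchy X"
  have "\<exists>k. \<forall>m\<ge>k. \<forall>n\<ge>k. dist (X m) (X n) < (1/2)^i" for i
    using C unfolding Cauchy_def by (meson half_gt_zero zero_less_one zero_less_power)
  then obtain k where k: "\<And>i m n. m \<ge> k i \<Longrightarrow> n \<ge> k i \<Longrightarrow> dist (X m) (X n) < (1/2)^i"
    by metis
  \<comment> \<open>The sum dominates every earlier \<open>k i\<close>; the summand \<open>n\<close> makes \<open>r\<close> strictly increasing.\<close>
  define r where "r n = (\<Sum>i\<le>n. k i) + n" for n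
  have r: "strict_mono r"
    by (intro strict_monoI_Suc) (simp add: r_def)
  have rk: "k i \<le> r n" if "i \<le> n" for i n
  proof -
    have "k i \<le> (\<Sum>i\<le>n. k i)" using that by (intro member_le_sum) auto
    thus ?thesis by (simp add: r_def)
  qed
  define f where "f n = X (r n)" for n
  have step: "norm (f m - f n) \<le> (1/2)^i" if "m \<ge> i" "n \<ge> i" for i m n
    using k[of i "r m" "r n"] rk that by (simp add: f_def dist_norm less_imp_le)
  have conv: "AE x in lborel. convergent (\<lambda>n. rep_L2 (f n) x)"
    by (intro AE_convergent_of_geometric_steps step) auto
  define g where "g x = lim (\<lambda>n. rep_L2 (f n) x)" for x
  have gm[measurable]: "g \<in> borel_measurable lborel"
    unfolding g_def by measurable
  have lim: "AE x in lborel. (\<lambda>n. rep_L2 (f n) x) \<longlonglongrightarrow> g x"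
    using conv by eventually_elim (simp add: g_def convergent_LIMSEQ_iff)
  have bd: "(\<integral>\<^sup>+x. ennreal ((g x - rep_L2 (f n) x)\<^sup>2) \<partial>lborel) \<le> ennreal (((1/2)^n)\<^sup>2)" for n
  proof -
    have "(\<integral>\<^sup>+x. ennreal ((g x - rep_L2 (f n) x)\<^sup>2) \<partial>lborel) =
      (\<integral>\<^sup>+x. liminf (\<lambda>m. ennreal ((rep_L2 (f m) x - rep_L2 (f n) x)\<^sup>2)) \<partial>lborel)"
    proof (rule nn_integral_cong_AE, use lim in eventually_elim)
      case (elim x)
      have "(\<lambda>m. ennreal ((rep_L2 (f m) x - rep_L2 (f n) x)\<^sup>2)) \<longlonglongrightarrow> ennreal ((g x - rep_L2 (f n) x)\<^sup>2)"
        by (intro tendsto_ennrealI tendsto_power tendsto_diff elim tendsto_const)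
      from lim_imp_Liminf[OF sequentially_bot this] show ?case by simp
    qed
    also have "\<dots> \<le> liminf (\<lambda>m. \<integral>\<^sup>+x. ennreal ((rep_L2 (f m) x - rep_L2 (f n) x)\<^sup>2) \<partial>lborel)"
      by (intro nn_integral_liminf) auto
    also have "\<dots> = liminf (\<lambda>m. ennreal ((norm (f m - f n))\<^sup>2))"
      by (simp add: nn_integral_rep_L2)
    also have "\<dots> \<le> liminf (\<lambda>m. ennreal (((1/2)^n)\<^sup>2))"
    proof (intro Liminf_mono eventually_sequentiallyI[of n] ennreal_leI power_mono step)
    qed auto
    finally show ?thesis by (simp add: Liminf_const)
  qed
  have sq: "sq_integrable (\<lambda>x. g x - rep_L2 (f n) x)" for n
    unfolding sq_integrable_def
  proof
    show "integrable lborel (\<lambda>x. (g x - rep_L2 (f n) x)\<^sup>2)"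
    proof (rule integrableI_bounded)
      show "(\<integral>\<^sup>+x. ennreal (norm ((g x - rep_L2 (f n) x)\<^sup>2)) \<partial>lborel) < \<infinity>"
        using bd[of n] by (auto intro: le_less_trans)
    qed simp
  qed simp
  have sg: "sq_integrable g"
    using sq_integrable_add[OF sq[of 0] sq_integrable_rep_L2[of "f 0"]] by simp
  define G where "G = abs_L2 g"
  have "norm (f n - G) \<le> (1/2)^n" for n
  proof -
    have "G - f n = abs_L2 (\<lambda>x. g x - rep_L2 (f n) x)"
      by (simp add: G_def abs_L2_diff sg sq_integrable_rep_L2 abs_rep_L2)
    hence "ennreal ((norm (G - f n))\<^sup>2) = ennreal (\<integral>x. (g x - rep_L2 (f n) x)\<^sup>2 \<partial>lborel)"
      by (simp add: norm_abs_L2 sq)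
    also have "\<dots> \<le> ennreal (((1/2)^n)\<^sup>2)"
      using bd[of n] sq[of n] by (subst (asm) nn_integral_eq_integral) (auto simp: sq_integrable_def)
    finally have "(norm (G - f n))\<^sup>2 \<le> ((1/2)^n)\<^sup>2" by (subst (asm) ennreal_le_iff) auto
    hence "norm (G - f n) \<le> (1/2)^n" by (rule power2_le_imp_le) simp
    thus ?thesis by (simp add: norm_minus_commute)
  qed
  hence "f \<longlonglongrightarrow> G"
  proof (intro LIM_zero_cancel[of f] Lim_null_comparison[of "\<lambda>n. f n - G" "\<lambda>n. (1/2)^n"] always_eventually allI)
    show "(\<lambda>n. (1/2::real)^n) \<longlonglongrightarrow> 0" by (rule LIMSEQ_power_zero) simp
  qed auto
  moreover have "f = X \<circ> r" by (auto simp: f_def)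
  ultimately have "(X \<circ> r) \<longlonglongrightarrow> G" by simp
  with C r show "convergent X"
    by (metis Cauchy_converges_subseq convergent_def)
qed

text \<open>As an orthogonal complement, the subspace is closed, and membership can be tested by scalar
  equations that survive integration in time.\<close>

lemma L2_on_iff_orthogonal:
  fixes \<Omega> :: "'a::euclidean_space set"
  assumes "open \<Omega>"
  shows "f \<in> L2_on \<Omega> \<longleftrightarrow> (\<forall>g. inner f (abs_L2 (\<lambda>x. indicator (- \<Omega>) x * rep_L2 g x)) = 0)"
proof -
  have [measurable]: "\<Omega> \<in> sets borel" using assms by simp
  have s: "sq_integrable (\<lambda>x. indicator (- \<Omega>) x * rep_L2 g x :: real)" for g :: "'a L2"
    by (rule sq_integrableI_bounded[where C = 1, OF sq_integrable_rep_L2])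
       (auto simp: indicator_def intro!: AE_I2)
  have i: "inner f (abs_L2 (\<lambda>x. indicator (- \<Omega>) x * rep_L2 g x)) =
     (\<integral>x. indicator (- \<Omega>) x * rep_L2 f x * rep_L2 g x \<partial>lborel)" for g
    using inner_abs_L2[OF sq_integrable_rep_L2 s, of f g]
    by (simp add: abs_rep_L2 mult_ac)
  show ?thesis
  proof
    assume "f \<in> L2_on \<Omega>"
    hence *: "AE x in lborel. x \<notin> \<Omega> \<longrightarrow> rep_L2 f x = 0" by (simp add: L2_on_def)
    have "(\<integral>x. indicator (- \<Omega>) x * rep_L2 f x * rep_L2 g x \<partial>lborel) = 0" for g
      by (rule integral_eq_zero_AE) (use * in \<open>auto simp: indicator_def elim: eventually_mono\<close>)
    thus "\<forall>g. inner f (abs_L2 (\<lambda>x. indicator (- \<Omega>) x * rep_L2 g x)) = 0"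
      by (simp add: i)
  next
    assume "\<forall>g. inner f (abs_L2 (\<lambda>x. indicator (- \<Omega>) x * rep_L2 g x)) = 0"
    hence "(\<integral>x. (indicator (- \<Omega>) x * rep_L2 f x)\<^sup>2 \<partial>lborel) = 0"
      using i[of f] by (simp add: power2_eq_square mult_ac indicator_inter_arith[symmetric])
    moreover have "integrable lborel (\<lambda>x. (indicator (- \<Omega>) x * rep_L2 f x)\<^sup>2)"
      using s[of f] by (simp add: sq_integrable_def)
    ultimately have "AE x in lborel. (indicator (- \<Omega>) x * rep_L2 f x)\<^sup>2 = 0"
      by (subst (asm) integral_nonneg_eq_0_iff_AE) auto
    thus "f \<in> L2_on \<Omega>"
      unfolding L2_on_def by (auto simp: indicator_def elim: eventually_mono)
  qed
qed

lemma subspace_L2_on: "open \<Omega> \<Longrightarrow> subspace (L2_on \<Omega>)"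
  by (auto simp: subspace_def L2_on_iff_orthogonal inner_add_left)

lemma closed_L2_on:
  assumes "open \<Omega>"
  shows "closed (L2_on \<Omega>)"
proof -
  have "L2_on \<Omega> = (\<Inter>g. {f. inner f (abs_L2 (\<lambda>x. indicator (- \<Omega>) x * rep_L2 g x)) = 0})"
    using L2_on_iff_orthogonal[OF assms] by auto
  moreover have "closed \<dots>"
    by (intro closed_INT ballI closed_Collect_eq continuous_intros)
  ultimately show ?thesis by simp
qed

section \<open>Smooth functions and bumps\<close>

lemma dir_deriv_eqI: "(f has_derivative f') (at x) \<Longrightarrow> dir_deriv b f x = f' b"
  by (simp add: dir_deriv_def frechet_derivative_at[symmetric])

lemma has_derivative_dir_deriv:
  "f differentiable (at x) \<Longrightarrow> (f has_derivative (\<lambda>b. dir_deriv b f x)) (at x)"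
  by (simp add: dir_deriv_def frechet_derivative_works)

lemma k_smooth_on_cong:
  assumes "open U" "\<And>x. x \<in> U \<Longrightarrow> f x = g x" "k_smooth_on k U f"
  shows "k_smooth_on k U g"
  using assms(2,3)
proof (induction k arbitrary: f g)
  case 0
  thus ?case using continuous_on_cong[OF refl, of U f g] by simp
next
  case (Suc k)
  have d: "(g has_derivative (\<lambda>b. dir_deriv b f x)) (at x)" if "x \<in> U" for x
    using has_derivative_transform_within_open[OF has_derivative_dir_deriv assms(1) that, of f g] Suc.prems that
    by simp
  have "k_smooth_on k U (dir_deriv b g)" if "b \<in> Basis" for b
    by (rule Suc.IH[of "dir_deriv b f"]) (use Suc.prems(2) that dir_deriv_eqI[OF d] in auto)
  thus ?case using d by (auto simp: differentiable_def)
qed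

lemma k_smooth_on_mono: "k_smooth_on k U f \<Longrightarrow> V \<subseteq> U \<Longrightarrow> k_smooth_on k V f"
  by (induction k arbitrary: f) (auto intro: continuous_on_subset)

text \<open>With this locality, the product of a test function and a function that is smooth only near the
  support is smooth on the whole space.\<close>

lemma k_smooth_on_Un:
  assumes "open U" "open V" "k_smooth_on k U f" "k_smooth_on k V f"
  shows "k_smooth_on k (U \<union> V) f"
  using assms(3,4) by (induction k arbitrary: f) (auto intro: continuous_on_open_Un assms(1,2))

lemma k_smooth_on_SucD: "open U \<Longrightarrow> k_smooth_on (Suc k) U f \<Longrightarrow> k_smooth_on k U f"
proof (induction k arbitrary: f)
  case 0
  thus ?case by (auto intro!: continuous_at_imp_continuous_on differentiable_imp_continuous_within)
qed auto

lemma k_smooth_on_const: "k_smooth_on k U (\<lambda>_. c)"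
proof (induction k arbitrary: c)
  case (Suc k)
  have "dir_deriv b (\<lambda>_. c) = (\<lambda>_. 0)" for b :: 'a
    by (simp add: dir_deriv_def fun_eq_iff)
  with Suc show ?case by simp
qed auto

lemma k_smooth_on_add:
  assumes "open U" "k_smooth_on k U f" "k_smooth_on k U g"
  shows "k_smooth_on k U (\<lambda>x. f x + g x)"
  using assms(2,3)
proof (induction k arbitrary: f g)
  case 0
  thus ?case by (auto intro: continuous_on_add)
next
  case (Suc k)
  have d: "dir_deriv b (\<lambda>x. f x + g x) x = dir_deriv b f x + dir_deriv b g x" if "x \<in> U" for b x
    using Suc.prems that by (intro dir_deriv_eqI has_derivative_add has_derivative_dir_deriv) auto
  have "k_smooth_on k U (dir_deriv b (\<lambda>x. f x + g x))" if "b \<in> Basis" for b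
    using Suc.prems that
    by (intro k_smooth_on_cong[OF assms(1) d[symmetric] Suc.IH]) auto
  thus ?case using Suc.prems by auto
qed

lemma k_smooth_on_mult:
  assumes "open U" "k_smooth_on k U f" "k_smooth_on k U g"
  shows "k_smooth_on k U (\<lambda>x. f x * g x)"
  using assms(2,3)
proof (induction k arbitrary: f g)
  case 0
  thus ?case by (auto intro: continuous_on_mult)
next
  case (Suc k)
  have d: "dir_deriv b (\<lambda>x. f x * g x) x = f x * dir_deriv b g x + dir_deriv b f x * g x"
    if "x \<in> U" for b x
    using Suc.prems that by (intro dir_deriv_eqI has_derivative_mult has_derivative_dir_deriv) auto
  have "k_smooth_on k U f" "k_smooth_on k U g"
    using Suc.prems k_smooth_on_SucD[OF assms(1)] by blast+
  hence "k_smooth_on k U (dir_deriv b (\<lambda>x. f x * g x))" if "b \<in> Basis" for b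
    using Suc.prems that
    by (intro k_smooth_on_cong[OF assms(1) d[symmetric] k_smooth_on_add[OF assms(1)]] Suc.IH) auto
  thus ?case using Suc.prems by auto
qed

lemma deriv_eq_dir_deriv: "deriv f = dir_deriv (1::real) f" if "\<And>x. f differentiable (at x)"
proof
  fix x
  have "(f has_field_derivative deriv f x) (at x)"
    using that[of x] by (simp add: DERIV_deriv_iff_real_differentiable)
  from dir_deriv_eqI[OF this[unfolded has_field_derivative_def], of 1]
  show "deriv f x = dir_deriv 1 f x" by simp
qed

lemma k_smooth_on_SucI_real:
  assumes "open U" "\<And>x. x \<in> U \<Longrightarrow> (f has_real_derivative f' x) (at x)" "k_smooth_on k U f'"
  shows "k_smooth_on (Suc k) U f"
proof -
  have "dir_deriv 1 f x = f' x" if "x \<in> U" for x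
    using dir_deriv_eqI[OF assms(2)[OF that, unfolded has_field_derivative_def], of 1] by simp
  thus ?thesis
    using assms k_smooth_on_cong[OF assms(1) _ assms(3), of "dir_deriv 1 f"]
    by (auto simp: real_differentiable_def)
qed

lemma k_smooth_on_affine_real:
  assumes "k_smooth_on k UNIV (f :: real \<Rightarrow> real)"
  shows "k_smooth_on k UNIV (\<lambda>x. f (c * x + d))"
  using assms
proof (induction k arbitrary: f)
  case 0
  thus ?case by (auto intro!: continuous_on_compose2[of UNIV f] continuous_intros)
next
  case (Suc k)
  have "((\<lambda>x. f (c * x + d)) has_real_derivative (dir_deriv 1 f (c * x + d) * c)) (at x)" for x
  proof (rule DERIV_chain2[where f = f and g = "\<lambda>x. c * x + d"])
    have "f differentiable (at (c * x + d))" using Suc.prems by simp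
    hence "(f has_field_derivative deriv f (c * x + d)) (at (c * x + d))"
      by (simp add: DERIV_deriv_iff_real_differentiable)
    moreover have "deriv f = dir_deriv 1 f"
      using Suc.prems by (intro deriv_eq_dir_deriv) auto
    ultimately show "(f has_real_derivative dir_deriv 1 f (c * x + d)) (at (c * x + d))" by simp
    show "((\<lambda>x. c * x + d) has_real_derivative c) (at x)"
      by (auto intro!: derivative_eq_intros)
  qed
  moreover have "k_smooth_on k UNIV (\<lambda>x. dir_deriv 1 f (c * x + d) * c)"
    using Suc.prems by (intro k_smooth_on_mult k_smooth_on_const Suc.IH) auto
  ultimately show ?case by (intro k_smooth_on_SucI_real) auto
qed

text \<open>The powers are included so that the family is closed under differentiation up to linear
  combinations, which makes smoothness of $e^{-1/x}$ an easy induction.\<close>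

definition flat_exp :: "nat \<Rightarrow> real \<Rightarrow> real" where
  "flat_exp n x = (if x > 0 then exp (- 1 / x) / x ^ n else 0)"

lemma flat_exp_tendsto_0: "(flat_exp n \<longlongrightarrow> 0) (at 0)"
proof -
  have "((\<lambda>x. inverse x ^ n / exp (inverse x)) \<longlongrightarrow> (0::real)) (at_right 0)"
    by (rule filterlim_compose[OF tendsto_power_div_exp_0 filterlim_inverse_at_top_right])
  moreover have "eventually (\<lambda>x. inverse x ^ n / exp (inverse x) = flat_exp n x) (at_right 0)"
    unfolding eventually_at_right_field
    by (auto simp: flat_exp_def exp_minus power_inverse field_simps intro!: exI[of _ 1])
  ultimately have "(flat_exp n \<longlongrightarrow> 0) (at_right 0)"
    by (rule Lim_transform_eventually)
  moreover have "eventually (\<lambda>x. 0 = flat_exp n x) (at_left 0)"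
    unfolding eventually_at_left_field by (auto simp: flat_exp_def intro!: exI[of _ "-1"])
  hence "(flat_exp n \<longlongrightarrow> 0) (at_left 0)"
    by (rule Lim_transform_eventually[OF tendsto_const])
  ultimately show ?thesis by (simp add: filterlim_split_at)
qed

text \<open>At the origin the difference quotient of \<open>flat_exp n\<close> is \<open>flat_exp (n + 1)\<close> itself, which tends to 0.\<close>

lemma flat_exp_has_derivative:
  "(flat_exp n has_real_derivative (flat_exp (n + 2) x - n * flat_exp (n + 1) x)) (at x)"
proof (cases x "0::real" rule: linorder_cases)
  case less
  have "((\<lambda>_. 0) has_real_derivative 0) (at x)" by simp
  hence "(flat_exp n has_real_derivative 0) (at x)"
    by (rule has_field_derivative_transform_within_open[of _ _ _ "{..<0}"]) (use less in \<open>auto simp: flat_exp_def\<close>)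
  thus ?thesis using less by (simp add: flat_exp_def)
next
  case equal
  have "(\<lambda>h. (flat_exp n (0 + h) - flat_exp n 0) / h) = flat_exp (n + 1)"
    by (auto simp: flat_exp_def fun_eq_iff)
  hence "(flat_exp n has_real_derivative 0) (at 0)"
    using flat_exp_tendsto_0[of "n + 1"] unfolding DERIV_def by simp
  thus ?thesis using equal by (simp add: flat_exp_def)
next
  case greater
  have "((\<lambda>y. exp (- 1 / y) / y ^ n) has_real_derivative
     (exp (- 1 / x) * (1 / x\<^sup>2) * x ^ n - exp (- 1 / x) * (n * x ^ (n - 1))) / (x ^ n)\<^sup>2) (at x)"
    using greater by (auto intro!: derivative_eq_intros simp: power2_eq_square)
  also have "(exp (- 1 / x) * (1 / x\<^sup>2) * x ^ n - exp (- 1 / x) * (n * x ^ (n - 1))) / (x ^ n)\<^sup>2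
     = flat_exp (n + 2) x - n * flat_exp (n + 1) x"
    using greater by (cases n) (auto simp: flat_exp_def field_simps power2_eq_square)
  finally show ?thesis
    by (rule has_field_derivative_transform_within_open[of _ _ _ "{0<..}"]) (use greater in \<open>auto simp: flat_exp_def\<close>)
qed

lemma k_smooth_on_flat_exp: "k_smooth_on k UNIV (flat_exp n)"
proof (induction k arbitrary: n)
  case 0
  show ?case using flat_exp_has_derivative
    by (auto intro!: continuous_at_imp_continuous_on DERIV_isCont)
next
  case (Suc k)
  have "k_smooth_on k UNIV (\<lambda>x. flat_exp (n + 2) x + (- real n) * flat_exp (n + 1) x)"
    by (intro k_smooth_on_add k_smooth_on_mult k_smooth_on_const Suc.IH) auto
  thus ?case
    using flat_exp_has_derivative[of n] by (intro k_smooth_on_SucI_real) auto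
qed

definition bump :: "real \<Rightarrow> real \<Rightarrow> real" where
  "bump d x = flat_exp 0 (d + x) * flat_exp 0 (d - x)"

lemma k_smooth_on_bump: "k_smooth_on k UNIV (bump d)"
proof -
  have "k_smooth_on k UNIV (\<lambda>x. flat_exp 0 (1 * x + d) * flat_exp 0 ((- 1) * x + d))"
    by (intro k_smooth_on_mult k_smooth_on_affine_real[OF k_smooth_on_flat_exp]) auto
  thus ?thesis by (simp add: bump_def[abs_def] add.commute)
qed

lemma bump_nonneg: "bump d x \<ge> 0"
  by (simp add: bump_def flat_exp_def)

lemma bump_pos: "\<bar>x\<bar> < d \<Longrightarrow> bump d x > 0"
  by (simp add: bump_def flat_exp_def)

lemma bump_eq_0: "d \<le> \<bar>x\<bar> \<Longrightarrow> bump d x = 0"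
  by (auto simp: bump_def flat_exp_def)

lemma continuous_on_bump: "continuous_on UNIV (bump d)"
  using k_smooth_on_bump[of 0] by simp

text \<open>Differences of two translates of such a step are test functions whose derivative is a difference
  of two bumps.\<close>

lemma smooth_step_exists:
  assumes "d > 0"
  obtains N where "\<And>x. (N has_real_derivative bump d x) (at x)"
    "\<And>x. x \<le> - d \<Longrightarrow> N x = N (- d)" "\<And>x. d \<le> x \<Longrightarrow> N x = N d" "N (- d) < N d"
proof -
  obtain N where N: "\<And>x. (N has_real_derivative bump d x) (at x)"
    using einterval_antiderivative[of "-\<infinity>" "\<infinity>" "bump d"] continuous_on_bump[of d]
    by (auto simp: has_real_derivative_iff_has_vector_derivative continuous_on_eq_continuous_at)
  have N0: "(N has_field_derivative 0) (at x within S)" if "d \<le> \<bar>x\<bar>" for x S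
    using has_field_derivative_at_within[OF N[of x]] that by (simp add: bump_eq_0)
  have "\<exists>c. \<forall>x\<in>{..-d}. N x = c"
    by (rule has_field_derivative_zero_constant[OF _ N0]) (use assms in auto)
  then obtain c1 where c1: "\<And>x. x \<le> - d \<Longrightarrow> N x = c1" by auto
  have "\<exists>c. \<forall>x\<in>{d..}. N x = c"
    by (rule has_field_derivative_zero_constant[OF _ N0]) (use assms in auto)
  then obtain c2 where c2: "\<And>x. d \<le> x \<Longrightarrow> N x = c2" by auto
  have "N (- d) < N d"
  proof (rule DERIV_pos_imp_increasing_open[where f = N and a = "- d" and b = d])
    show "- d < d" using assms by simp
    show "\<exists>y. (N has_real_derivative y) (at x) \<and> 0 < y" if "- d < x" "x < d" for x
      using N[of x] bump_pos[of x d] that by (intro exI[of _ "bump d x"]) auto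
    show "continuous_on {- d..d} N"
      by (intro continuous_at_imp_continuous_on ballI DERIV_isCont[OF N])
  qed
  with N c1 c2 show ?thesis by (intro that[of N]) simp_all
qed

section \<open>Weak derivatives on an interval\<close>

text \<open>Testing against the difference of two smooth steps at \<open>s\<close> and \<open>t\<close> equates two averages of \<open>r\<close>, one
  near each point, with equal weights; they are close to the point values by continuity.\<close>

lemma const_of_weak_deriv_0:
  fixes r :: "real \<Rightarrow> real"
  assumes weak: "\<And>\<phi>. \<phi> \<in> test_functions {a<..<b} \<Longrightarrow> ((\<lambda>t. deriv \<phi> t * r t) has_integral 0) {a..b}"
    and s: "s \<in> {a<..<b}" "isCont r s" and t: "t \<in> {a<..<b}" "isCont r t"
  shows "r s = r t"
proof -
  have "\<bar>r s - r t\<bar> \<le> 2 * e" if e: "e > 0" for e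
  proof -
    obtain d1 where d1: "d1 > 0" "\<And>x. \<bar>x - s\<bar> < d1 \<Longrightarrow> \<bar>r x - r s\<bar> < e"
      using s(2) e unfolding continuous_at_eps_delta dist_real_def by metis
    obtain d2 where d2: "d2 > 0" "\<And>x. \<bar>x - t\<bar> < d2 \<Longrightarrow> \<bar>r x - r t\<bar> < e"
      using t(2) e unfolding continuous_at_eps_delta dist_real_def by metis
    define S where "S = {d1, d2, (s - a) / 2, (b - s) / 2, (t - a) / 2, (b - t) / 2}"
    define d where "d = Min S"
    have "\<forall>y\<in>S. 0 < y" using d1(1) d2(1) s(1) t(1) by (simp add: S_def)
    moreover have S: "finite S" "S \<noteq> {}" by (simp_all add: S_def)
    ultimately have d0: "d > 0" unfolding d_def using Min_gr_iff[OF S] by blast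
    have dS: "d \<le> y" if "y \<in> S" for y
      unfolding d_def by (rule Min_le[OF S(1) that])
    have d: "d > 0" "d \<le> d1" "d \<le> d2" "d \<le> (s - a) / 2" "d \<le> (b - s) / 2"
      "d \<le> (t - a) / 2" "d \<le> (b - t) / 2"
      by (rule d0) (rule dS, simp add: S_def)+
    obtain N where N: "\<And>x. (N has_real_derivative bump d x) (at x)"
      and Nl: "\<And>x. x \<le> - d \<Longrightarrow> N x = N (- d)" and Nr: "\<And>x. d \<le> x \<Longrightarrow> N x = N d"
      and Npos: "N (- d) < N d"
      using smooth_step_exists[OF d(1)] by metis
    define \<phi> where "\<phi> x = N (x - s) - N (x - t)" for x
    have D: "(\<phi> has_real_derivative (bump d (x - s) - bump d (x - t))) (at x)" for x
      unfolding \<phi>_def by (auto intro!: derivative_eq_intros DERIV_chain2[OF N])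
    have "k_smooth_on k UNIV \<phi>" for k
    proof (cases k)
      case 0
      thus ?thesis using D by (auto intro!: continuous_at_imp_continuous_on DERIV_isCont)
    next
      case (Suc j)
      have "k_smooth_on j UNIV (\<lambda>x. bump d (1 * x + (- s)) + (- 1) * bump d (1 * x + (- t)))"
        by (intro k_smooth_on_add k_smooth_on_mult k_smooth_on_affine_real[OF k_smooth_on_bump] k_smooth_on_const) auto
      thus ?thesis unfolding Suc by (intro k_smooth_on_SucI_real[OF open_UNIV D]) simp
    qed
    moreover have "{x. \<phi> x \<noteq> 0} \<subseteq> {min s t - d..max s t + d}"
    proof (clarsimp, intro conjI; rule ccontr)
      fix x assume nz: "\<phi> x \<noteq> 0"
      { assume "\<not> min s t - d \<le> x"
        hence "N (x - s) = N (- d)" "N (x - t) = N (- d)" by (intro Nl; linarith)+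
        thus False using nz by (simp add: \<phi>_def) }
      { assume "\<not> x \<le> max s t + d"
        hence "N (x - s) = N d" "N (x - t) = N d" by (intro Nr; linarith)+
        thus False using nz by (simp add: \<phi>_def) }
    qed
    hence "closure {x. \<phi> x \<noteq> 0} \<subseteq> {min s t - d..max s t + d}"
      by (rule closure_minimal) simp
    moreover have "{min s t - d..max s t + d} \<subseteq> {a<..<b}"
      using s(1) t(1) d by (auto simp: min_def max_def)
    ultimately have "\<phi> \<in> test_functions {a<..<b}"
      unfolding test_functions_def smooth_on_def
      by (auto simp: compact_eq_bounded_closed intro: bounded_subset[OF bounded_closed_interval])
    from weak[OF this] have w: "((\<lambda>x. (bump d (x - s) - bump d (x - t)) * r x) has_integral 0) {a..b}"
      unfolding DERIV_imp_deriv[OF D] .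
    have ab: "a \<le> b" using s by auto
    have mass: "((\<lambda>x. bump d (x - c)) has_integral (N d - N (- d))) {a..b}" if "d \<le> (c - a) / 2" "d \<le> (b - c) / 2" for c
    proof -
      have "((\<lambda>x. bump d (x - c)) has_integral (N (b - c) - N (a - c))) {a..b}"
      proof (rule fundamental_theorem_of_calculus[OF ab])
        fix x
        have "((\<lambda>x. N (x - c)) has_real_derivative bump d (x - c)) (at x within {a..b})"
          using DERIV_chain2[where f = N and g = "\<lambda>x. x - c", OF N DERIV_diff[OF DERIV_ident DERIV_const]] by simp
        thus "((\<lambda>x. N (x - c)) has_vector_derivative bump d (x - c)) (at x within {a..b})"
          by (simp add: has_real_derivative_iff_has_vector_derivative)
      qed
      moreover have "N (b - c) = N d" by (rule Nr) (use that d(1) in argo)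
      moreover have "N (a - c) = N (- d)" by (rule Nl) (use that d(1) in argo)
      ultimately show ?thesis by simp
    qed
    note ms = mass[OF d(4,5)] and mt = mass[OF d(6,7)]
    let ?M = "N d - N (- d)"
    have 1: "((\<lambda>x. (r s * bump d (x - s) - r t * bump d (x - t)) - (bump d (x - s) - bump d (x - t)) * r x)
        has_integral ((r s * ?M - r t * ?M) - 0)) {a..b}"
      by (intro has_integral_diff has_integral_mult_right ms mt w)
    have 2: "((\<lambda>x. e * bump d (x - s) + e * bump d (x - t)) has_integral (e * ?M + e * ?M)) {a..b}"
      by (intro has_integral_add has_integral_mult_right ms mt)
    have est: "\<bar>bump d (x - c) * (r c - r x)\<bar> \<le> e * bump d (x - c)"
      if "\<And>x. \<bar>x - c\<bar> < d \<Longrightarrow> \<bar>r x - r c\<bar> < e" for x c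
    proof (cases "\<bar>x - c\<bar> < d")
      case True
      have "bump d (x - c) * \<bar>r c - r x\<bar> \<le> bump d (x - c) * e"
        using that[OF True] by (intro mult_left_mono bump_nonneg) (simp add: abs_minus_commute)
      thus ?thesis using bump_nonneg[of d "x - c"] by (simp add: abs_mult mult.commute)
    qed (simp add: bump_eq_0)
    have "norm (integral {a..b} (\<lambda>x. (r s * bump d (x - s) - r t * bump d (x - t)) - (bump d (x - s) - bump d (x - t)) * r x))
      \<le> integral {a..b} (\<lambda>x. e * bump d (x - s) + e * bump d (x - t))"
    proof (rule integral_norm_bound_integral[OF has_integral_integrable[OF 1] has_integral_integrable[OF 2]])
      fix x
      have "norm ((r s * bump d (x - s) - r t * bump d (x - t)) - (bump d (x - s) - bump d (x - t)) * r x)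
        = \<bar>bump d (x - s) * (r s - r x) - bump d (x - t) * (r t - r x)\<bar>"
        by (simp add: algebra_simps)
      also have "\<dots> \<le> e * bump d (x - s) + e * bump d (x - t)"
      proof (rule order_trans[OF abs_triangle_ineq4 add_mono])
        show "\<bar>bump d (x - s) * (r s - r x)\<bar> \<le> e * bump d (x - s)"
          by (rule est) (use d1(2) d(2) in auto)
        show "\<bar>bump d (x - t) * (r t - r x)\<bar> \<le> e * bump d (x - t)"
          by (rule est) (use d2(2) d(3) in auto)
      qed
      finally show "norm ((r s * bump d (x - s) - r t * bump d (x - t)) - (bump d (x - s) - bump d (x - t)) * r x)
        \<le> e * bump d (x - s) + e * bump d (x - t)" .
    qed
    hence "\<bar>(r s - r t) * ?M\<bar> \<le> 2 * e * ?M"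
      unfolding integral_unique[OF 1] integral_unique[OF 2] by (simp add: algebra_simps)
    thus ?thesis using Npos by (simp add: abs_mult)
  qed
  from this[of "\<bar>r s - r t\<bar> / 4"] show ?thesis by auto
qed

text \<open>The lemma of du Bois-Reymond for continuous functions: subtracting a primitive of \<open>q\<close> from \<open>p\<close>
  leaves a function with vanishing weak derivative.\<close>

lemma has_derivative_of_weak_deriv:
  fixes p q :: "real \<Rightarrow> real"
  assumes p: "continuous_on {0..T} p" and q: "continuous_on {0..T} q" and T: "0 < T"
    and weak: "\<And>\<phi>. \<phi> \<in> test_functions {0<..<T} \<Longrightarrow>
      \<exists>I. ((\<lambda>t. deriv \<phi> t * p t) has_integral I) {0..T} \<and> ((\<lambda>t. \<phi> t * q t) has_integral - I) {0..T}"
    and t: "t \<in> {0..T}"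
  shows "(p has_real_derivative q t) (at t within {0..T})"
proof -
  define Q where "Q x = integral {0..x} q" for x
  have Q: "(Q has_real_derivative q x) (at x within {0..T})" if "x \<in> {0..T}" for x
    unfolding Q_def using integral_has_real_derivative[OF q that] .
  have Qc: "continuous_on {0..T} Q"
    using Q by (rule DERIV_continuous_on)
  define r where "r x = p x - Q x" for x
  have rc: "continuous_on {0..T} r" unfolding r_def by (intro continuous_intros p Qc)
  have r0: "((\<lambda>t. deriv \<phi> t * r t) has_integral 0) {0..T}" if ph: "\<phi> \<in> test_functions {0<..<T}" for \<phi>
  proof -
    have diff: "\<phi> differentiable (at x)" for x
    proof -
      have "k_smooth_on (Suc 0) UNIV \<phi>" using ph by (simp add: test_functions_def smooth_on_def del: k_smooth_on.simps)
      thus ?thesis by simp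
    qed
    have z: "\<phi> x = 0" if "x \<notin> {0<..<T}" for x
      using ph that closure_subset[of "{x. \<phi> x \<noteq> 0}"] by (auto simp: test_functions_def)
    obtain I where I: "((\<lambda>t. deriv \<phi> t * p t) has_integral I) {0..T}" "((\<lambda>t. \<phi> t * q t) has_integral - I) {0..T}"
      using weak[OF ph] by blast
    have "((\<lambda>x. \<phi> x * q x + deriv \<phi> x * Q x) has_integral (\<phi> T * Q T - \<phi> 0 * Q 0)) {0..T}"
    proof (rule fundamental_theorem_of_calculus)
      fix x assume x: "x \<in> {0..T}"
      have "(\<phi> has_real_derivative deriv \<phi> x) (at x within {0..T})"
        using diff[of x] by (auto simp: DERIV_deriv_iff_real_differentiable[symmetric] intro: has_field_derivative_at_within)
      from DERIV_mult'[OF this Q[OF x]]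
      show "((\<lambda>x. \<phi> x * Q x) has_vector_derivative (\<phi> x * q x + deriv \<phi> x * Q x)) (at x within {0..T})"
        by (simp add: has_real_derivative_iff_has_vector_derivative)
    qed (use T in simp)
    from has_integral_diff[OF this I(2)] have "((\<lambda>x. deriv \<phi> x * Q x) has_integral I) {0..T}"
      by (simp add: z)
    from has_integral_diff[OF I(1) this] show ?thesis by (simp add: r_def right_diff_distrib)
  qed
  have const: "r x = r (T / 2)" if x: "x \<in> {0<..<T}" for x
  proof (rule const_of_weak_deriv_0[OF r0])
    have "isCont r y" if "y \<in> {0<..<T}" for y
      using rc that by (metis at_within_Icc_at continuous_on_eq_continuous_within greaterThanLessThan_iff less_imp_le atLeastAtMost_iff)
    thus "isCont r x" "isCont r (T / 2)" using x T by auto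
  qed (use x T in auto)
  have r_const: "r x = r (T / 2)" if "x \<in> {0..T}" for x
  proof (rule continuous_constant_on_closure[of "{0<..<T}" r])
    show "continuous_on (closure {0<..<T}) r" using rc T by simp
    show "x \<in> closure {0<..<T}" using that T by simp
  qed (rule const)
  have eq: "Q x + r (T / 2) = p x" if "x \<in> {0..T}" for x
    unfolding r_const[OF that, symmetric] by (simp add: r_def)
  have "((\<lambda>x. Q x + r (T / 2)) has_real_derivative q t) (at t within {0..T})"
    using DERIV_add[OF Q[OF t] DERIV_const] by simp
  thus ?thesis
    by (rule has_field_derivative_transform_within[OF _ zero_less_one t]) (rule eq)
qed

section \<open>Translations and integration by parts for test functions\<close>

lemma test_functionD:
  assumes "\<phi> \<in> test_functions \<Omega>"
  shows "k_smooth_on k UNIV \<phi>" "\<phi> differentiable (at x)" "continuous_on UNIV \<phi>"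
    "compact (closure {x. \<phi> x \<noteq> 0})" "x \<notin> \<Omega> \<Longrightarrow> \<phi> x = 0"
proof -
  show k: "k_smooth_on k UNIV \<phi>" for k using assms by (simp add: test_functions_def smooth_on_def)
  show "\<phi> differentiable (at x)" using k[of "Suc 0"] by simp
  show "continuous_on UNIV \<phi>" using k[of 0] by simp
  show "compact (closure {x. \<phi> x \<noteq> 0})" using assms by (simp add: test_functions_def)
  show "x \<notin> \<Omega> \<Longrightarrow> \<phi> x = 0"
    using assms closure_subset[of "{x. \<phi> x \<noteq> 0}"] by (auto simp: test_functions_def)
qed

lemma dir_deriv_eq_0:
  assumes "x \<notin> closure {x. \<phi> x \<noteq> 0}"
  shows "dir_deriv b \<phi> x = 0"
proof -
  let ?K = "closure {x. \<phi> x \<noteq> 0}"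
  have z: "0 = \<phi> y" if "y \<in> - ?K" for y
    using that closure_subset[of "{x. \<phi> x \<noteq> 0}"] by auto
  have "(\<phi> has_derivative (\<lambda>_. 0)) (at x)"
    by (rule has_derivative_transform_within_open[OF has_derivative_const open_Compl[OF closed_closure[of "{x. \<phi> x \<noteq> 0}"]] _ z])
       (use assms in auto)
  thus ?thesis by (rule dir_deriv_eqI)
qed

lemma test_functions_dir_deriv:
  assumes "\<phi> \<in> test_functions \<Omega>" "b \<in> Basis"
  shows "dir_deriv b \<phi> \<in> test_functions \<Omega>"
proof -
  have "k_smooth_on k UNIV (dir_deriv b \<phi>)" for k
    using test_functionD(1)[OF assms(1), of "Suc k"] assms(2) by simp
  moreover have sub: "closure {x. dir_deriv b \<phi> x \<noteq> 0} \<subseteq> closure {x. \<phi> x \<noteq> 0}"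
    by (rule closure_minimal) (use dir_deriv_eq_0[of _ \<phi> b] in auto)
  moreover have "compact (closure {x. dir_deriv b \<phi> x \<noteq> 0})"
    using compact_Int_closed[OF test_functionD(4)[OF assms(1)] closed_closure] sub by (metis Int_absorb1)
  ultimately show ?thesis using assms(1) by (auto simp: test_functions_def smooth_on_def)
qed

lemma test_functions_mult:
  assumes "\<phi> \<in> test_functions \<Omega>" "\<psi> \<in> test_functions \<Omega>"
  shows "(\<lambda>x. \<phi> x * \<psi> x) \<in> test_functions \<Omega>"
proof -
  have "k_smooth_on k UNIV (\<lambda>x. \<phi> x * \<psi> x)" for k
    by (intro k_smooth_on_mult test_functionD(1)[OF assms(1)] test_functionD(1)[OF assms(2)]) simp
  moreover have sub: "closure {x. \<phi> x * \<psi> x \<noteq> 0} \<subseteq> closure {x. \<phi> x \<noteq> 0}"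
    by (rule closure_mono) auto
  moreover have "compact (closure {x. \<phi> x * \<psi> x \<noteq> 0})"
    using compact_Int_closed[OF test_functionD(4)[OF assms(1)] closed_closure] sub by (metis Int_absorb1)
  ultimately show ?thesis using assms(1) unfolding test_functions_def smooth_on_def by blast
qed

lemma test_function_integrable:
  assumes "\<phi> \<in> test_functions \<Omega>"
  shows "integrable lborel \<phi>"
proof -
  have "integrable lborel (\<lambda>x. indicator (closure {x. \<phi> x \<noteq> 0}) x *\<^sub>R \<phi> x)"
    using test_functionD(3,4)[OF assms] by (intro borel_integrable_compact) (auto intro: continuous_on_subset)
  also have "(\<lambda>x. indicator (closure {x. \<phi> x \<noteq> 0}) x *\<^sub>R \<phi> x) = \<phi>"
    using closure_subset[of "{x. \<phi> x \<noteq> 0}"] by (auto simp: fun_eq_iff indicator_def)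
  finally show ?thesis .
qed

lemma test_function_measurable: "\<phi> \<in> test_functions \<Omega> \<Longrightarrow> \<phi> \<in> borel_measurable borel"
  by (intro borel_measurable_continuous_onI test_functionD(3))

lemma sq_integrable_test_function:
  assumes "\<phi> \<in> test_functions \<Omega>"
  shows "sq_integrable \<phi>"
  using test_function_integrable[OF test_functions_mult[OF assms assms]] test_function_measurable[OF assms]
  by (simp add: sq_integrable_def power2_eq_square)

lemma test_function_in_L2_on:
  assumes "\<phi> \<in> test_functions \<Omega>"
  shows "abs_L2 \<phi> \<in> L2_on \<Omega>"
  unfolding L2_on_def
  using rep_abs_L2[OF sq_integrable_test_function[OF assms]] test_functionD(5)[OF assms]
  by (auto elim: eventually_mono)

lemma dir_deriv_sum_Basis:
  assumes "\<phi> differentiable (at x)"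
  shows "dir_deriv h \<phi> x = (\<Sum>b\<in>Basis. (h \<bullet> b) * dir_deriv b \<phi> x)"
proof -
  have lin: "linear (\<lambda>h. dir_deriv h \<phi> x)"
    by (rule has_derivative_linear[OF has_derivative_dir_deriv[OF assms]])
  have "dir_deriv h \<phi> x = dir_deriv (\<Sum>b\<in>Basis. (h \<bullet> b) *\<^sub>R b) \<phi> x"
    by (simp only: euclidean_representation)
  also have "\<dots> = (\<Sum>b\<in>Basis. dir_deriv ((h \<bullet> b) *\<^sub>R b) \<phi> x)"
    by (rule linear_sum[OF lin])
  also have "\<dots> = (\<Sum>b\<in>Basis. (h \<bullet> b) * dir_deriv b \<phi> x)"
    by (intro sum.cong refl) (use linear_scale[OF lin] in simp)
  finally show ?thesis .
qed

lemma dir_deriv_measurable: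
  assumes "\<phi> \<in> test_functions \<Omega>"
  shows "dir_deriv h \<phi> \<in> borel_measurable borel" "continuous_on UNIV (dir_deriv h \<phi>)"
proof -
  have eq: "dir_deriv h \<phi> = (\<lambda>x. \<Sum>b\<in>Basis. (h \<bullet> b) * dir_deriv b \<phi> x)"
    by (rule ext) (rule dir_deriv_sum_Basis[OF test_functionD(2)[OF assms]])
  show "continuous_on UNIV (dir_deriv h \<phi>)"
    unfolding eq by (intro continuous_intros test_functionD(3)[OF test_functions_dir_deriv[OF assms]])
  thus "dir_deriv h \<phi> \<in> borel_measurable borel" by (rule borel_measurable_continuous_onI)
qed

lemma increment_eq_integral:
  assumes "\<phi> \<in> test_functions \<Omega>"
  shows "has_bochner_integral lborel (\<lambda>s. dir_deriv h \<phi> (x + s *\<^sub>R h) * indicator {0..1} s) (\<phi> (x + h) - \<phi> x)"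
proof -
  have "has_bochner_integral lborel (\<lambda>s. dir_deriv h \<phi> (x + s *\<^sub>R h) * indicator {0..1} s) (\<phi> (x + 1 *\<^sub>R h) - \<phi> (x + 0 *\<^sub>R h))"
  proof (rule has_bochner_integral_FTC_Icc_real)
    fix s :: real
    have 1: "((\<lambda>s. x + s *\<^sub>R h) has_derivative (\<lambda>r. r *\<^sub>R h)) (at s)"
      by (auto intro!: derivative_eq_intros)
    have lin: "linear (\<lambda>b. dir_deriv b \<phi> (x + s *\<^sub>R h))"
      using has_derivative_linear[OF has_derivative_dir_deriv[OF test_functionD(2)[OF assms]]] .
    from has_derivative_compose[OF 1 has_derivative_dir_deriv[OF test_functionD(2)[OF assms]]]
    show "((\<lambda>s. \<phi> (x + s *\<^sub>R h)) has_real_derivative dir_deriv h \<phi> (x + s *\<^sub>R h)) (at s)"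
      using linear_scale[OF lin] by (simp add: has_field_derivative_def mult.commute[of _ "dir_deriv h \<phi> (x + s *\<^sub>R h)"] mult_commute_abs)
    have "continuous_on UNIV (\<lambda>s. dir_deriv h \<phi> (x + s *\<^sub>R h))"
      by (rule continuous_on_compose2[OF dir_deriv_measurable(2)[OF assms]]) (auto intro!: continuous_intros)
    thus "isCont (\<lambda>s. dir_deriv h \<phi> (x + s *\<^sub>R h)) s" by (simp add: continuous_on_eq_continuous_at)
  qed simp
  thus ?thesis by simp
qed

lemma dir_deriv_sq_le:
  assumes "\<phi> \<in> test_functions \<Omega>"
  shows "(dir_deriv h \<phi> x)\<^sup>2 \<le> (norm h)\<^sup>2 * (\<Sum>b\<in>Basis. (dir_deriv b \<phi> x)\<^sup>2)"
proof -
  have "(dir_deriv h \<phi> x)\<^sup>2 \<le> (\<Sum>b\<in>Basis. (h \<bullet> b)\<^sup>2) * (\<Sum>b\<in>Basis. (dir_deriv b \<phi> x)\<^sup>2)"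
    unfolding dir_deriv_sum_Basis[OF test_functionD(2)[OF assms], of h] by (rule Cauchy_Schwarz_ineq_sum)
  also have "(\<Sum>b\<in>Basis. (h \<bullet> b)\<^sup>2) = (norm h)\<^sup>2"
    by (simp add: norm_eq_sqrt_inner euclidean_inner[of h h] power2_eq_square sum_nonneg)
  finally show ?thesis .
qed

text \<open>Jensen's inequality on the unit interval, from the nonnegativity of the variance $\int(f-c)^2$.\<close>

lemma square_integral_le_integral_square:
  fixes f :: "real \<Rightarrow> real"
  assumes f: "continuous_on UNIV f" and c: "has_bochner_integral lborel (\<lambda>s. f s * indicator {0..1} s) c"
  shows "integrable lborel (\<lambda>s. (f s)\<^sup>2 * indicator {0..1} s)" "c\<^sup>2 \<le> (\<integral>s. (f s)\<^sup>2 * indicator {0..1} s \<partial>lborel)"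
proof -
  let ?I = "\<integral>s. (f s)\<^sup>2 * indicator {0..1} s \<partial>lborel"
  show i2: "integrable lborel (\<lambda>s. (f s)\<^sup>2 * indicator {0..1} s)"
    by (rule borel_integrable_atLeastAtMost)
       (use f in \<open>auto simp: continuous_on_eq_continuous_at intro!: continuous_intros\<close>)
  have i0: "has_bochner_integral lborel (\<lambda>s. c\<^sup>2 * indicator {0..1::real} s) (c\<^sup>2)"
    using has_bochner_integral_mult_right[OF has_bochner_integral_real_indicator[of "{0..1::real}" lborel], of "c\<^sup>2"] by simp
  have "has_bochner_integral lborel (\<lambda>s. (f s)\<^sup>2 * indicator {0..1} s - 2 * c * (f s * indicator {0..1} s) + c\<^sup>2 * indicator {0..1} s)
     (?I - 2 * c * c + c\<^sup>2)"
    by (intro has_bochner_integral_add has_bochner_integral_diff has_bochner_integral_mult_right has_bochner_integral_integrable i0 c i2)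
  moreover have "(\<lambda>s. (f s)\<^sup>2 * indicator {0..1} s - 2 * c * (f s * indicator {0..1} s) + c\<^sup>2 * indicator {0..1} s)
     = (\<lambda>s. (f s - c)\<^sup>2 * indicator {0..1} s)"
    by (simp add: fun_eq_iff power2_eq_square algebra_simps)
  ultimately have "has_bochner_integral lborel (\<lambda>s. (f s - c)\<^sup>2 * indicator {0..1} s) (?I - 2 * c * c + c\<^sup>2)"
    by (simp only:)
  from has_bochner_integral_integral_eq[OF this, symmetric]
  have "0 \<le> ?I - 2 * c * c + c\<^sup>2" by (simp only:) (rule Bochner_Integration.integral_nonneg, simp)
  thus "c\<^sup>2 \<le> ?I" by (simp add: power2_eq_square)
qed

lemma increment_sq_le:
  assumes "\<phi> \<in> test_functions \<Omega>"
  shows "ennreal ((\<phi> (x + h) - \<phi> x)\<^sup>2) \<le>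
    (\<integral>\<^sup>+s. ennreal ((norm h)\<^sup>2 * (\<Sum>b\<in>Basis. (dir_deriv b \<phi> (x + s *\<^sub>R h))\<^sup>2)) * indicator {0..1} s \<partial>lborel)"
proof -
  let ?f = "\<lambda>s. dir_deriv h \<phi> (x + s *\<^sub>R h)" and ?c = "\<phi> (x + h) - \<phi> x"
  have f: "continuous_on UNIV ?f"
    by (rule continuous_on_compose2[OF dir_deriv_measurable(2)[OF assms]]) (auto intro!: continuous_intros)
  note sq = square_integral_le_integral_square[OF f increment_eq_integral[OF assms]]
  have "ennreal (?c\<^sup>2) \<le> ennreal (\<integral>s. (?f s)\<^sup>2 * indicator {0..1} s \<partial>lborel)"
    by (rule ennreal_leI[OF sq(2)])
  also have "\<dots> = (\<integral>\<^sup>+s. ennreal ((?f s)\<^sup>2 * indicator {0..1} s) \<partial>lborel)"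
    by (rule nn_integral_eq_integral[OF sq(1), symmetric]) auto
  also have "\<dots> \<le> (\<integral>\<^sup>+s. ennreal ((norm h)\<^sup>2 * (\<Sum>b\<in>Basis. (dir_deriv b \<phi> (x + s *\<^sub>R h))\<^sup>2)) * indicator {0..1} s \<partial>lborel)"
    by (intro nn_integral_mono) (auto simp: indicator_def intro!: ennreal_leI dir_deriv_sq_le[OF assms])
  finally show ?thesis .
qed

lemma nn_integral_translate:
  fixes f :: "'a::euclidean_space \<Rightarrow> ennreal"
  assumes [measurable]: "f \<in> borel_measurable borel"
  shows "(\<integral>\<^sup>+x. f (x + c) \<partial>lborel) = (\<integral>\<^sup>+x. f x \<partial>lborel)"
proof -
  have "(\<integral>\<^sup>+x. f x \<partial>lborel) = (\<integral>\<^sup>+x. f x \<partial>distr lborel borel ((+) c))" by (simp add: lborel_distr_plus)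
  also have "\<dots> = (\<integral>\<^sup>+x. f (c + x) \<partial>lborel)" by (rule nn_integral_distr) auto
  finally show ?thesis by (simp add: add.commute)
qed

lemma integral_translate:
  fixes f :: "'a::euclidean_space \<Rightarrow> real"
  assumes [measurable]: "f \<in> borel_measurable borel"
  shows "(\<integral>x. f (x + c) \<partial>lborel) = (\<integral>x. f x \<partial>lborel)"
    "integrable lborel (\<lambda>x. f (x + c)) \<longleftrightarrow> integrable lborel f"
proof -
  have "(\<integral>x. f x \<partial>lborel) = (\<integral>x. f x \<partial>distr lborel borel ((+) c))" by (simp add: lborel_distr_plus)
  also have "\<dots> = (\<integral>x. f (c + x) \<partial>lborel)" by (rule integral_distr) auto
  finally show "(\<integral>x. f (x + c) \<partial>lborel) = (\<integral>x. f x \<partial>lborel)" by (simp add: add.commute)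
  have "integrable lborel f \<longleftrightarrow> integrable (distr lborel borel ((+) c)) f" by (simp add: lborel_distr_plus)
  also have "\<dots> \<longleftrightarrow> integrable lborel (\<lambda>x. f (c + x))" by (rule integrable_distr_eq) auto
  finally show "integrable lborel (\<lambda>x. f (x + c)) \<longleftrightarrow> integrable lborel f" by (simp add: add.commute)
qed

text \<open>The increment is the integral of the derivative along the segment from \<open>x\<close> to \<open>x + h\<close>. After
  Jensen's inequality and Fubini's theorem, every point of the segment contributes the same
  Dirichlet integral by translation invariance.\<close>

lemma translation_estimate:
  fixes \<phi> :: "'a::euclidean_space \<Rightarrow> real"
  assumes "\<phi> \<in> test_functions \<Omega>"
  shows "(\<integral>\<^sup>+x. ennreal ((\<phi> (x + h) - \<phi> x)\<^sup>2) \<partial>lborel) \<le>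
    ennreal ((norm h)\<^sup>2) * (\<integral>\<^sup>+x. ennreal (\<Sum>b\<in>Basis. (dir_deriv b \<phi> x)\<^sup>2) \<partial>lborel)"
proof -
  define g where "g x = ennreal ((norm h)\<^sup>2 * (\<Sum>b\<in>Basis. (dir_deriv b \<phi> x)\<^sup>2))" for x
  have [measurable]: "dir_deriv b \<phi> \<in> borel_measurable borel" for b by (rule dir_deriv_measurable[OF assms])
  have [measurable]: "g \<in> borel_measurable borel" unfolding g_def by measurable
  have "(\<integral>\<^sup>+x. ennreal ((\<phi> (x + h) - \<phi> x)\<^sup>2) \<partial>lborel) \<le> (\<integral>\<^sup>+x. (\<integral>\<^sup>+s. g (x + s *\<^sub>R h) * indicator {0..1::real} s \<partial>lborel) \<partial>lborel)"
    unfolding g_def by (intro nn_integral_mono increment_sq_le[OF assms])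
  also have "\<dots> = (\<integral>\<^sup>+s. (\<integral>\<^sup>+x. g (x + s *\<^sub>R h) * indicator {0..1::real} s \<partial>lborel) \<partial>lborel)"
    by (rule lborel_pair.Fubini'[symmetric]) (measurable)
  also have "\<dots> = (\<integral>\<^sup>+s. (\<integral>\<^sup>+x. g x \<partial>lborel) * indicator {0..1::real} s \<partial>lborel)"
    by (simp add: nn_integral_multc nn_integral_translate)
  also have "\<dots> = (\<integral>\<^sup>+x. g x \<partial>lborel)" by (subst nn_integral_cmult) auto
  also have "\<dots> = ennreal ((norm h)\<^sup>2) * (\<integral>\<^sup>+x. ennreal (\<Sum>b\<in>Basis. (dir_deriv b \<phi> x)\<^sup>2) \<partial>lborel)"
    unfolding g_def by (subst ennreal_mult) (auto simp: sum_nonneg nn_integral_cmult)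
  finally show ?thesis .
qed

text \<open>By translation invariance the integral of $\partial_b\phi$ equals its average over the translates by
  $sb$, $0\le s\le 1$, which Fubini's theorem turns into $\int(\phi(x+b)-\phi(x))\,dx = 0$.\<close>

lemma integral_dir_deriv_eq_0:
  fixes \<phi> :: "'a::euclidean_space \<Rightarrow> real"
  assumes "\<phi> \<in> test_functions \<Omega>" "b \<in> Basis"
  shows "(\<integral>x. dir_deriv b \<phi> x \<partial>lborel) = 0"
proof -
  note t = test_functions_dir_deriv[OF assms]
  have [measurable]: "dir_deriv b \<phi> \<in> borel_measurable borel" "\<phi> \<in> borel_measurable borel"
    by (rule dir_deriv_measurable[OF assms(1)], rule test_function_measurable[OF assms(1)])
  let ?F = "\<lambda>s x. dir_deriv b \<phi> (x + s *\<^sub>R b) * indicator {0..1::real} s"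
  have int: "integrable (lborel \<Otimes>\<^sub>M lborel) (\<lambda>(s, x). ?F s x)"
  proof (rule lborel_pair.Fubini_integrable)
    have eq: "(\<integral>x. norm (case (s, x) of (s, x) \<Rightarrow> ?F s x) \<partial>lborel) = (\<integral>x. \<bar>dir_deriv b \<phi> x\<bar> \<partial>lborel) * indicator {0..1} s" for s
      using integral_translate(1)[of "\<lambda>x. \<bar>dir_deriv b \<phi> x\<bar>" "s *\<^sub>R b"] by (simp add: abs_mult)
    show "integrable lborel (\<lambda>s. \<integral>x. norm (case (s, x) of (s, x) \<Rightarrow> ?F s x) \<partial>lborel)"
      unfolding eq by (intro integrable_mult_right integrable_real_indicator) auto
    show "AE s in lborel. integrable lborel (\<lambda>x. case (s, x) of (s, x) \<Rightarrow> ?F s x)"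
      using test_function_integrable[OF t] integral_translate(2)[of "dir_deriv b \<phi>"] by simp
  qed measurable
  have "0 = (\<integral>x. \<phi> (x + b) - \<phi> x \<partial>lborel)"
    using test_function_integrable[OF assms(1)] integral_translate[of \<phi> b] by simp
  also have "\<dots> = (\<integral>x. (\<integral>s. ?F s x \<partial>lborel) \<partial>lborel)"
    by (simp only: has_bochner_integral_integral_eq[OF increment_eq_integral[OF assms(1)]])
  also have "\<dots> = (\<integral>s. (\<integral>x. ?F s x \<partial>lborel) \<partial>lborel)"
    by (rule lborel_pair.Fubini_integral[OF int])
  also have "\<dots> = (\<integral>s. (\<integral>x. dir_deriv b \<phi> x \<partial>lborel) * indicator {0..1::real} s \<partial>lborel)"
    by (simp add: integral_translate(1))
  also have "\<dots> = (\<integral>x. dir_deriv b \<phi> x \<partial>lborel)" by simp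
  finally show ?thesis by simp
qed

lemma has_weak_deriv_test_function:
  fixes \<phi> :: "'a::euclidean_space \<Rightarrow> real"
  assumes "\<phi> \<in> test_functions \<Omega>" "b \<in> Basis"
  shows "has_weak_deriv \<Omega> b (abs_L2 \<phi>) (abs_L2 (dir_deriv b \<phi>))"
  unfolding has_weak_deriv_def
proof (intro conjI ballI)
  note t = test_functions_dir_deriv[OF assms]
  show "abs_L2 \<phi> \<in> L2_on \<Omega>" "abs_L2 (dir_deriv b \<phi>) \<in> L2_on \<Omega>"
    by (rule test_function_in_L2_on[OF assms(1)], rule test_function_in_L2_on[OF t])
  fix \<psi> assume \<psi>: "\<psi> \<in> test_functions \<Omega>"
  note t' = test_functions_dir_deriv[OF \<psi> assms(2)]
  have "dir_deriv b (\<lambda>x. \<phi> x * \<psi> x) x = \<phi> x * dir_deriv b \<psi> x + dir_deriv b \<phi> x * \<psi> x" for x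
    by (intro dir_deriv_eqI has_derivative_mult has_derivative_dir_deriv test_functionD(2)[OF assms(1)] test_functionD(2)[OF \<psi>])
  with integral_dir_deriv_eq_0[OF test_functions_mult[OF assms(1) \<psi>] assms(2)]
  have "(\<integral>x. \<phi> x * dir_deriv b \<psi> x + dir_deriv b \<phi> x * \<psi> x \<partial>lborel) = 0" by simp
  thus "inner (abs_L2 \<phi>) (abs_L2 (dir_deriv b \<psi>)) = - inner (abs_L2 (dir_deriv b \<phi>)) (abs_L2 \<psi>)"
    using sq_integrable_test_function[OF assms(1)] sq_integrable_test_function[OF \<psi>]
      sq_integrable_test_function[OF t] sq_integrable_test_function[OF t']
    by (simp add: inner_abs_L2 sq_integrable_mult eq_neg_iff_add_eq_0)
qed

section \<open>Friedrichs' inequality on a grid of cubes\<close>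

definition cell_corner :: "real \<Rightarrow> 'a::euclidean_space \<Rightarrow> 'a" where
  "cell_corner \<epsilon> x = (\<Sum>b\<in>Basis. (\<epsilon> * real_of_int \<lfloor>(x \<bullet> b) / \<epsilon>\<rfloor>) *\<^sub>R b)"

text \<open>The half-open cells of the grid of mesh \<open>\<epsilon>\<close> are named by their lower corners, so that every point
  lies in exactly one cell.\<close>

definition cell :: "real \<Rightarrow> 'a::euclidean_space \<Rightarrow> 'a set" where
  "cell \<epsilon> k = {x. cell_corner \<epsilon> x = k}"

lemma cell_corner_inner: "b \<in> Basis \<Longrightarrow> cell_corner \<epsilon> x \<bullet> b = \<epsilon> * real_of_int \<lfloor>(x \<bullet> b) / \<epsilon>\<rfloor>"
  by (simp add: cell_corner_def)

lemma cell_sets [measurable]: "cell \<epsilon> k \<in> sets borel"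
proof -
  have [measurable]: "cell_corner \<epsilon> \<in> borel_measurable borel"
    unfolding cell_corner_def[abs_def] by measurable
  show ?thesis unfolding cell_def by measurable
qed

lemma finite_cells:
  fixes S :: "'a::euclidean_space set"
  assumes "bounded S" "0 < \<epsilon>"
  shows "finite (cell_corner \<epsilon> ` S)"
proof -
  obtain R where R: "\<And>x. x \<in> S \<Longrightarrow> norm x \<le> R" using assms(1) by (auto simp: bounded_iff)
  define N where "N = \<lceil>R / \<epsilon>\<rceil> + 1"
  have "cell_corner \<epsilon> x \<in> (\<lambda>f. \<Sum>b\<in>Basis. (\<epsilon> * real_of_int (f b)) *\<^sub>R b) ` (PiE Basis (\<lambda>_. {-N..N}))" if x: "x \<in> S" for x
  proof (rule image_eqI)
    let ?f = "restrict (\<lambda>b. \<lfloor>(x \<bullet> b) / \<epsilon>\<rfloor>) Basis"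
    show "cell_corner \<epsilon> x = (\<Sum>b\<in>Basis. (\<epsilon> * real_of_int (?f b)) *\<^sub>R b)" by (simp add: cell_corner_def)
    have "\<lfloor>(x \<bullet> b) / \<epsilon>\<rfloor> \<in> {-N..N}" if b: "b \<in> Basis" for b
    proof -
      have "\<bar>x \<bullet> b\<bar> \<le> R" using Basis_le_norm[OF b, of x] R[OF x] by linarith
      hence "\<bar>(x \<bullet> b) / \<epsilon>\<bar> \<le> R / \<epsilon>" using assms(2) by (simp add: divide_right_mono)
      thus ?thesis unfolding N_def atLeastAtMost_iff by linarith
    qed
    thus "?f \<in> PiE Basis (\<lambda>_. {-N..N})" by auto
  qed
  moreover have "finite (PiE (Basis :: 'a set) (\<lambda>_. {-N..N}))" by (intro finite_PiE) auto
  ultimately show ?thesis by (meson finite_imageI finite_subset image_subsetI)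
qed

text \<open>The cell lies between the open and the closed box with the same corners.\<close>

lemma emeasure_cell:
  fixes x :: "'a::euclidean_space"
  assumes "0 < \<epsilon>"
  shows "emeasure lborel (cell \<epsilon> (cell_corner \<epsilon> x)) = ennreal (\<epsilon> ^ DIM('a))"
proof -
  let ?k = "cell_corner \<epsilon> x" let ?u = "?k + \<epsilon> *\<^sub>R One"
  have u: "?u \<bullet> b = ?k \<bullet> b + \<epsilon>" if "b \<in> Basis" for b using that by (simp add: inner_add_left)
  have "cell \<epsilon> ?k \<subseteq> cbox ?k ?u"
  proof
    fix y assume "y \<in> cell \<epsilon> ?k"
    hence y: "cell_corner \<epsilon> y = ?k" by (simp add: cell_def)
    show "y \<in> cbox ?k ?u" unfolding mem_box
    proof
      fix b :: 'a assume b: "b \<in> Basis"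
      have "?k \<bullet> b = \<epsilon> * real_of_int \<lfloor>(y \<bullet> b) / \<epsilon>\<rfloor>" using cell_corner_inner[OF b, of \<epsilon> y] y by simp
      moreover have "\<epsilon> * real_of_int \<lfloor>(y \<bullet> b) / \<epsilon>\<rfloor> \<le> \<epsilon> * ((y \<bullet> b) / \<epsilon>)"
        using assms by (intro mult_left_mono of_int_floor_le) simp
      moreover have "\<epsilon> * ((y \<bullet> b) / \<epsilon>) \<le> \<epsilon> * (real_of_int \<lfloor>(y \<bullet> b) / \<epsilon>\<rfloor> + 1)"
        using assms by (intro mult_left_mono) linarith+
      ultimately show "?k \<bullet> b \<le> y \<bullet> b \<and> y \<bullet> b \<le> ?u \<bullet> b"
        unfolding u[OF b] using assms by (simp add: distrib_left)
    qed
  qed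
  moreover have "box ?k ?u \<subseteq> cell \<epsilon> ?k"
  proof
    fix y assume y: "y \<in> box ?k ?u"
    have "\<lfloor>(y \<bullet> b) / \<epsilon>\<rfloor> = \<lfloor>(x \<bullet> b) / \<epsilon>\<rfloor>" if b: "b \<in> Basis" for b
    proof -
      have "?k \<bullet> b < y \<bullet> b" "y \<bullet> b < ?k \<bullet> b + \<epsilon>" using y b u[OF b] by (auto simp: mem_box)
      hence "real_of_int \<lfloor>(x \<bullet> b) / \<epsilon>\<rfloor> \<le> (y \<bullet> b) / \<epsilon>" "(y \<bullet> b) / \<epsilon> < real_of_int \<lfloor>(x \<bullet> b) / \<epsilon>\<rfloor> + 1"
        unfolding cell_corner_inner[OF b] using assms by (simp_all add: field_simps)
      thus ?thesis by (intro floor_unique)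
    qed
    thus "y \<in> cell \<epsilon> ?k" by (simp add: cell_def cell_corner_def)
  qed
  ultimately have "emeasure lborel (box ?k ?u) \<le> emeasure lborel (cell \<epsilon> ?k)"
    "emeasure lborel (cell \<epsilon> ?k) \<le> emeasure lborel (cbox ?k ?u)"
    by (auto intro!: emeasure_mono)
  moreover have "emeasure lborel (box ?k ?u) = ennreal (\<epsilon> ^ DIM('a))"
    "emeasure lborel (cbox ?k ?u) = ennreal (\<epsilon> ^ DIM('a))"
    using assms by (simp_all add: emeasure_lborel_box_eq emeasure_lborel_cbox_eq inner_add_left)
  ultimately show ?thesis by (intro antisym) simp_all
qed

lemma cell_diff:
  fixes x :: "'a::euclidean_space"
  assumes "0 < \<epsilon>" "x \<in> cell \<epsilon> k" "y \<in> cell \<epsilon> k"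
  shows "y - x \<in> cbox (- (\<epsilon> *\<^sub>R One)) (\<epsilon> *\<^sub>R One)"
  unfolding mem_box
proof
  fix b :: 'a assume b: "b \<in> Basis"
  have "\<epsilon> * real_of_int \<lfloor>(x \<bullet> b) / \<epsilon>\<rfloor> = \<epsilon> * real_of_int \<lfloor>(y \<bullet> b) / \<epsilon>\<rfloor>"
    using assms(2,3) cell_corner_inner[OF b, of \<epsilon> x] cell_corner_inner[OF b, of \<epsilon> y] by (simp add: cell_def)
  hence "\<lfloor>(x \<bullet> b) / \<epsilon>\<rfloor> = \<lfloor>(y \<bullet> b) / \<epsilon>\<rfloor>" using assms(1) by simp
  hence "(y \<bullet> b) / \<epsilon> - (x \<bullet> b) / \<epsilon> \<le> 1" "-1 \<le> (y \<bullet> b) / \<epsilon> - (x \<bullet> b) / \<epsilon>" by linarith+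
  thus "- (\<epsilon> *\<^sub>R One) \<bullet> b \<le> (y - x) \<bullet> b \<and> (y - x) \<bullet> b \<le> (\<epsilon> *\<^sub>R One) \<bullet> b"
    using assms(1) b by (simp add: inner_diff_left field_simps)
qed

lemma norm_le_of_cube:
  fixes h :: "'a::euclidean_space" and \<epsilon> :: real
  assumes "h \<in> cbox (- (\<epsilon> *\<^sub>R One)) (\<epsilon> *\<^sub>R One)"
  shows "norm h \<le> DIM('a) * \<epsilon>"
proof -
  have "\<bar>h \<bullet> b\<bar> \<le> \<epsilon>" if "b \<in> Basis" for b
    using assms that by (force simp: mem_box abs_le_iff)
  hence "(\<Sum>b\<in>Basis. \<bar>h \<bullet> b\<bar>) \<le> of_nat (card (Basis :: 'a set)) * \<epsilon>" by (intro sum_bounded_above)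
  thus ?thesis using norm_le_l1[of h] by simp
qed

text \<open>The variance of $f$ on $Q$ is half the mean of $(f(y)-f(x))^2$ over $Q\times Q$. In this form it can be
  estimated by increments of $f$.\<close>

lemma variance_identity:
  fixes f :: "'a::euclidean_space \<Rightarrow> real"
  assumes [measurable]: "Q \<in> sets borel" and m: "emeasure lborel Q = ennreal m" "0 \<le> m"
    and f: "integrable lborel f" "integrable lborel (\<lambda>x. (f x)\<^sup>2)"
  shows "(\<integral>\<^sup>+x. \<integral>\<^sup>+y. indicator Q x * indicator Q y * ennreal ((f y - f x)\<^sup>2) \<partial>lborel \<partial>lborel) =
    ennreal (2 * m * (\<integral>x. indicator Q x * (f x)\<^sup>2 \<partial>lborel) - 2 * (\<integral>x. indicator Q x * f x \<partial>lborel)\<^sup>2)"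
proof -
  let ?I = "\<integral>x. indicator Q x * (f x)\<^sup>2 \<partial>lborel" and ?S = "\<integral>x. indicator Q x * f x \<partial>lborel"
  have [measurable]: "f \<in> borel_measurable borel" using borel_measurable_integrable[OF f(1)] by simp
  have hI: "has_bochner_integral lborel (\<lambda>x. indicator Q x * (f x)\<^sup>2) ?I"
    using integrable_mult_indicator[OF _ f(2), of Q] by (intro has_bochner_integral_integrable) simp
  have hS: "has_bochner_integral lborel (\<lambda>x. indicator Q x * f x) ?S"
    using integrable_mult_indicator[OF _ f(1), of Q] by (intro has_bochner_integral_integrable) simp
  have hm: "has_bochner_integral lborel (\<lambda>x. indicator Q x :: real) m"
    using has_bochner_integral_real_indicator[of Q lborel] m by (simp add: measure_def)
  have conv: "(\<integral>\<^sup>+x. ennreal (g x) \<partial>lborel) = ennreal c"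
    if "has_bochner_integral lborel g c" "\<And>x. 0 \<le> g x" for g :: "'a \<Rightarrow> real" and c
    using has_bochner_integral_iff[of lborel g c] that by (simp add: nn_integral_eq_integral)
  have inner: "(\<integral>\<^sup>+y. indicator Q x * indicator Q y * ennreal ((f y - f x)\<^sup>2) \<partial>lborel) =
     ennreal (indicator Q x * (?I - 2 * f x * ?S + (f x)\<^sup>2 * m))" for x
  proof -
    have "has_bochner_integral lborel (\<lambda>y. indicator Q x * (indicator Q y * (f y)\<^sup>2 - 2 * f x * (indicator Q y * f y) + (f x)\<^sup>2 * indicator Q y))
       (indicator Q x * (?I - 2 * f x * ?S + (f x)\<^sup>2 * m))"
      by (intro has_bochner_integral_mult_right has_bochner_integral_add has_bochner_integral_diff hI hS hm)
    also have "(\<lambda>y. indicator Q x * (indicator Q y * (f y)\<^sup>2 - 2 * f x * (indicator Q y * f y) + (f x)\<^sup>2 * indicator Q y))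
      = (\<lambda>y. indicator Q x * indicator Q y * (f y - f x)\<^sup>2)"
      by (simp add: fun_eq_iff power2_eq_square algebra_simps)
    finally have "(\<integral>\<^sup>+y. ennreal (indicator Q x * indicator Q y * (f y - f x)\<^sup>2) \<partial>lborel) =
      ennreal (indicator Q x * (?I - 2 * f x * ?S + (f x)\<^sup>2 * m))"
      by (intro conv) auto
    moreover have "ennreal (indicator Q x * indicator Q y * (f y - f x)\<^sup>2) = indicator Q x * indicator Q y * ennreal ((f y - f x)\<^sup>2)" for y
      by (simp add: indicator_def)
    ultimately show ?thesis by simp
  qed
  have nn: "0 \<le> indicator Q x * (?I - 2 * f x * ?S + (f x)\<^sup>2 * m)" for x
  proof -
    have "has_bochner_integral lborel (\<lambda>y. indicator Q y * (f y)\<^sup>2 - 2 * f x * (indicator Q y * f y) + (f x)\<^sup>2 * indicator Q y)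
       (?I - 2 * f x * ?S + (f x)\<^sup>2 * m)"
      by (intro has_bochner_integral_mult_right has_bochner_integral_add has_bochner_integral_diff hI hS hm)
    moreover have "(\<lambda>y. indicator Q y * (f y)\<^sup>2 - 2 * f x * (indicator Q y * f y) + (f x)\<^sup>2 * indicator Q y)
      = (\<lambda>y. indicator Q y * (f y - f x)\<^sup>2)"
      by (simp add: fun_eq_iff power2_eq_square algebra_simps)
    ultimately have "has_bochner_integral lborel (\<lambda>y. indicator Q y * (f y - f x)\<^sup>2) (?I - 2 * f x * ?S + (f x)\<^sup>2 * m)"
      by (simp only:)
    from has_bochner_integral_integral_eq[OF this, symmetric]
    have "0 \<le> ?I - 2 * f x * ?S + (f x)\<^sup>2 * m" by (simp only:) (rule Bochner_Integration.integral_nonneg, simp)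
    thus ?thesis by simp
  qed
  have "has_bochner_integral lborel (\<lambda>x. ?I * indicator Q x - 2 * ?S * (indicator Q x * f x) + m * (indicator Q x * (f x)\<^sup>2))
     (?I * m - 2 * ?S * ?S + m * ?I)"
    by (intro has_bochner_integral_mult_right has_bochner_integral_add has_bochner_integral_diff hI hS hm)
  moreover have "(\<lambda>x. ?I * indicator Q x - 2 * ?S * (indicator Q x * f x) + m * (indicator Q x * (f x)\<^sup>2)) =
    (\<lambda>x. indicator Q x * (?I - 2 * f x * ?S + (f x)\<^sup>2 * m))"
    by (simp add: fun_eq_iff indicator_def)
  ultimately have "has_bochner_integral lborel (\<lambda>x. indicator Q x * (?I - 2 * f x * ?S + (f x)\<^sup>2 * m)) (?I * m - 2 * ?S * ?S + m * ?I)"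
    by (simp only:)
  from conv[OF this nn] show ?thesis unfolding inner by (simp add: power2_eq_square algebra_simps)
qed

text \<open>Two points of one cell differ by a vector \<open>h\<close> of a fixed small cube, so the double integrals over
  the cells are bounded by one integral over all \<open>x\<close> and all such \<open>h\<close>. For fixed \<open>h\<close> the translation
  estimate applies.\<close>

lemma sum_cell_increments_le:
  fixes \<phi> :: "'a::euclidean_space \<Rightarrow> real" and \<epsilon> :: real
  assumes \<phi>: "\<phi> \<in> test_functions \<Omega>" and \<epsilon>: "0 < \<epsilon>" and K: "finite K"
  shows "(\<Sum>k\<in>K. \<integral>\<^sup>+x. \<integral>\<^sup>+y. indicator (cell \<epsilon> k) x * indicator (cell \<epsilon> k) y * ennreal ((\<phi> y - \<phi> x)\<^sup>2) \<partial>lborel \<partial>lborel)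
    \<le> ennreal ((2 * \<epsilon>) ^ DIM('a) * (DIM('a) * \<epsilon>)\<^sup>2) * (\<integral>\<^sup>+x. ennreal (\<Sum>b\<in>Basis. (dir_deriv b \<phi> x)\<^sup>2) \<partial>lborel)"
proof -
  have [measurable]: "\<phi> \<in> borel_measurable borel" by (rule test_function_measurable[OF \<phi>])
  let ?C = "cbox (- (\<epsilon> *\<^sub>R One)) (\<epsilon> *\<^sub>R One) :: 'a set"
  let ?G = "\<integral>\<^sup>+x. ennreal (\<Sum>b\<in>Basis. (dir_deriv b \<phi> x)\<^sup>2) \<partial>lborel"
  have ind: "(\<Sum>k\<in>K. indicator (cell \<epsilon> k) x * indicator (cell \<epsilon> k) y) \<le> (indicator ?C (y - x) :: ennreal)" for x y
  proof -
    have "(\<Sum>k\<in>K. indicator (cell \<epsilon> k) x * indicator (cell \<epsilon> k) y :: ennreal) \<le> (\<Sum>k\<in>K. if k = cell_corner \<epsilon> x then indicator ?C (y - x) else 0)"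
    proof (rule sum_mono)
      fix k
      show "indicator (cell \<epsilon> k) x * indicator (cell \<epsilon> k) y \<le> (if k = cell_corner \<epsilon> x then indicator ?C (y - x) else (0::ennreal))"
        using cell_diff[OF \<epsilon>, of x k y] by (auto simp: indicator_def cell_def)
    qed
    also have "\<dots> \<le> indicator ?C (y - x)" using K by (simp add: sum.delta)
    finally show ?thesis .
  qed
  have "(\<Sum>k\<in>K. \<integral>\<^sup>+x. \<integral>\<^sup>+y. indicator (cell \<epsilon> k) x * indicator (cell \<epsilon> k) y * ennreal ((\<phi> y - \<phi> x)\<^sup>2) \<partial>lborel \<partial>lborel)
    = (\<integral>\<^sup>+x. \<integral>\<^sup>+y. (\<Sum>k\<in>K. indicator (cell \<epsilon> k) x * indicator (cell \<epsilon> k) y) * ennreal ((\<phi> y - \<phi> x)\<^sup>2) \<partial>lborel \<partial>lborel)"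
    by (simp add: nn_integral_sum sum_distrib_right)
  also have "\<dots> \<le> (\<integral>\<^sup>+x. \<integral>\<^sup>+y. indicator ?C (y - x) * ennreal ((\<phi> y - \<phi> x)\<^sup>2) \<partial>lborel \<partial>lborel)"
    by (intro nn_integral_mono mult_right_mono ind) auto
  also have "\<dots> = (\<integral>\<^sup>+x. \<integral>\<^sup>+h. indicator ?C h * ennreal ((\<phi> (x + h) - \<phi> x)\<^sup>2) \<partial>lborel \<partial>lborel)"
  proof (rule nn_integral_cong)
    fix x :: 'a
    have "(\<integral>\<^sup>+y. indicator ?C (y - x) * ennreal ((\<phi> y - \<phi> x)\<^sup>2) \<partial>lborel) =
       (\<integral>\<^sup>+h. indicator ?C (h + x - x) * ennreal ((\<phi> (h + x) - \<phi> x)\<^sup>2) \<partial>lborel)"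
      by (rule nn_integral_translate[symmetric]) measurable
    thus "(\<integral>\<^sup>+y. indicator ?C (y - x) * ennreal ((\<phi> y - \<phi> x)\<^sup>2) \<partial>lborel) =
       (\<integral>\<^sup>+h. indicator ?C h * ennreal ((\<phi> (x + h) - \<phi> x)\<^sup>2) \<partial>lborel)"
      by (simp add: add.commute)
  qed
  also have "\<dots> = (\<integral>\<^sup>+h. \<integral>\<^sup>+x. indicator ?C h * ennreal ((\<phi> (x + h) - \<phi> x)\<^sup>2) \<partial>lborel \<partial>lborel)"
    by (rule lborel_pair.Fubini') measurable
  also have "\<dots> = (\<integral>\<^sup>+h. indicator ?C h * (\<integral>\<^sup>+x. ennreal ((\<phi> (x + h) - \<phi> x)\<^sup>2) \<partial>lborel) \<partial>lborel)"
    by (simp add: nn_integral_cmult)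
  also have "\<dots> \<le> (\<integral>\<^sup>+h. (ennreal ((DIM('a) * \<epsilon>)\<^sup>2) * ?G) * indicator ?C h \<partial>lborel)"
  proof (rule nn_integral_mono)
    fix h :: 'a
    show "indicator ?C h * (\<integral>\<^sup>+x. ennreal ((\<phi> (x + h) - \<phi> x)\<^sup>2) \<partial>lborel) \<le> (ennreal ((DIM('a) * \<epsilon>)\<^sup>2) * ?G) * indicator ?C h"
    proof (cases "h \<in> ?C")
      case True
      have "(\<integral>\<^sup>+x. ennreal ((\<phi> (x + h) - \<phi> x)\<^sup>2) \<partial>lborel) \<le> ennreal ((norm h)\<^sup>2) * ?G"
        by (rule translation_estimate[OF \<phi>])
      also have "\<dots> \<le> ennreal ((DIM('a) * \<epsilon>)\<^sup>2) * ?G"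
        by (intro mult_right_mono ennreal_leI power_mono norm_le_of_cube[OF True]) auto
      finally show ?thesis using True by simp
    qed simp
  qed
  also have "\<dots> = ennreal ((DIM('a) * \<epsilon>)\<^sup>2) * ?G * emeasure lborel ?C"
    by (rule nn_integral_cmult_indicator) simp
  also have "emeasure lborel ?C = ennreal (\<Prod>b\<in>Basis. (\<epsilon> *\<^sub>R One - - (\<epsilon> *\<^sub>R One)) \<bullet> (b :: 'a))"
    using \<epsilon> by (intro emeasure_lborel_cbox) simp
  also have "(\<Prod>b\<in>Basis. (\<epsilon> *\<^sub>R One - - (\<epsilon> *\<^sub>R One)) \<bullet> (b :: 'a)) = (\<Prod>b\<in>(Basis :: 'a set). 2 * \<epsilon>)"
    by (intro prod.cong refl) (simp add: inner_add_left)
  also have "\<dots> = (2 * \<epsilon>) ^ DIM('a)" by simp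
  finally show ?thesis using \<epsilon> by (simp add: ennreal_mult mult_ac)
qed

lemma indicator_square: "(indicator A x)\<^sup>2 = (indicator A x :: real)"
  by (simp add: indicator_def)

lemma ennreal_sum_le: "ennreal (\<Sum>k\<in>K. f k) \<le> (\<Sum>k\<in>K. ennreal (f k))"
proof -
  have "ennreal (\<Sum>k\<in>K. f k) \<le> ennreal (\<Sum>k\<in>K. max 0 (f k))" by (intro ennreal_leI sum_mono) simp
  also have "\<dots> = (\<Sum>k\<in>K. ennreal (max 0 (f k)))" by (rule sum_ennreal[symmetric]) simp
  also have "\<dots> = (\<Sum>k\<in>K. ennreal (f k))" by (intro sum.cong refl) (auto simp: max_def ennreal_neg)
  finally show ?thesis .
qed

text \<open>The functionals are the normalised means over the cells that meet \<open>\<Omega>\<close>; there are finitely many of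
  them because \<open>\<Omega>\<close> is bounded. What they miss of the norm is the variance on the cells.\<close>

lemma friedrichs:
  fixes \<Omega> :: "'a::euclidean_space set"
  assumes "bounded \<Omega>" "0 < \<eta>"
  obtains K :: "'a set" and c :: "'a \<Rightarrow> 'a L2" where "finite K"
    "\<And>\<phi>. \<phi> \<in> test_functions \<Omega> \<Longrightarrow> (norm (abs_L2 \<phi>))\<^sup>2 \<le>
       \<eta> * (\<Sum>b\<in>Basis. (norm (abs_L2 (dir_deriv b \<phi>)))\<^sup>2) + (\<Sum>k\<in>K. (inner (abs_L2 \<phi>) (c k))\<^sup>2)"
proof -
  define d where "d = DIM('a)"
  have d: "0 < d" by (simp add: d_def)
  \<comment> \<open>The mesh for which the constant $2^{d-1}d^2\epsilon^2$ of the oscillation bound equals \<open>\<eta>\<close>.\<close>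
  define \<epsilon> where "\<epsilon> = sqrt (2 * \<eta> / (2 ^ d * (real d)\<^sup>2))"
  have \<epsilon>: "0 < \<epsilon>" using assms(2) d by (simp add: \<epsilon>_def)
  have \<epsilon>2: "2 ^ d * (real d)\<^sup>2 * \<epsilon>\<^sup>2 = 2 * \<eta>" using assms(2) d by (simp add: \<epsilon>_def)
  define m where "m = \<epsilon> ^ d"
  have m: "0 < m" using \<epsilon> by (simp add: m_def)
  define K where "K = cell_corner \<epsilon> ` \<Omega>"
  have K: "finite K" unfolding K_def by (rule finite_cells[OF assms(1) \<epsilon>])
  have em: "emeasure lborel (cell \<epsilon> k) = ennreal m" if "k \<in> K" for k
    using that emeasure_cell[OF \<epsilon>] by (auto simp: K_def m_def d_def)
  define c where "c k = abs_L2 (\<lambda>x. (1 / sqrt m) * indicator (cell \<epsilon> k) x)" for k :: 'a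
  have "(norm (abs_L2 \<phi>))\<^sup>2 \<le> \<eta> * (\<Sum>b\<in>Basis. (norm (abs_L2 (dir_deriv b \<phi>)))\<^sup>2) + (\<Sum>k\<in>K. (inner (abs_L2 \<phi>) (c k))\<^sup>2)"
    if \<phi>: "\<phi> \<in> test_functions \<Omega>" for \<phi>
  proof -
    note sq = sq_integrable_test_function[OF \<phi>]
    have i2: "integrable lborel (\<lambda>x. (\<phi> x)\<^sup>2)" using sq by (simp add: sq_integrable_def)
    let ?I = "\<lambda>k. \<integral>x. indicator (cell \<epsilon> k) x * (\<phi> x)\<^sup>2 \<partial>lborel" and ?S = "\<lambda>k. \<integral>x. indicator (cell \<epsilon> k) x * \<phi> x \<partial>lborel"
    let ?G = "\<Sum>b\<in>Basis. (norm (abs_L2 (dir_deriv b \<phi>)))\<^sup>2"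
    have S: "(inner (abs_L2 \<phi>) (c k))\<^sup>2 = (?S k)\<^sup>2 / m" if k: "k \<in> K" for k
    proof -
      have s: "sq_integrable (\<lambda>x. indicator (cell \<epsilon> k) x :: real)"
        unfolding sq_integrable_def using em[OF k]
        by (auto simp: indicator_square intro!: integrable_real_indicator)
      have "inner (abs_L2 \<phi>) (c k) = (1 / sqrt m) * ?S k"
        unfolding c_def abs_L2_scale[OF s] inner_scaleR_right inner_abs_L2[OF sq s] by (simp add: mult.commute)
      thus ?thesis using m by (simp add: power_mult_distrib power_divide)
    qed
    have "(norm (abs_L2 \<phi>))\<^sup>2 = (\<integral>x. (\<phi> x)\<^sup>2 \<partial>lborel)" by (rule norm_abs_L2[OF sq])
    also have "\<dots> = (\<integral>x. (\<Sum>k\<in>K. indicator (cell \<epsilon> k) x * (\<phi> x)\<^sup>2) \<partial>lborel)"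
    proof (intro Bochner_Integration.integral_cong refl)
      fix x
      show "(\<phi> x)\<^sup>2 = (\<Sum>k\<in>K. indicator (cell \<epsilon> k) x * (\<phi> x)\<^sup>2)"
      proof (cases "x \<in> \<Omega>")
        case True
        have "(\<Sum>k\<in>K. indicator (cell \<epsilon> k) x * (\<phi> x)\<^sup>2) = (\<Sum>k\<in>K. if k = cell_corner \<epsilon> x then (\<phi> x)\<^sup>2 else 0)"
          by (intro sum.cong) (auto simp: cell_def indicator_def)
        also have "\<dots> = (\<phi> x)\<^sup>2" using True K by (simp add: sum.delta K_def)
        finally show ?thesis by simp
      qed (simp add: test_functionD(5)[OF \<phi>])
    qed
    also have "\<dots> = (\<Sum>k\<in>K. ?I k)"
      using integrable_mult_indicator[OF _ i2] by (intro Bochner_Integration.integral_sum) simp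
    finally have norm: "(norm (abs_L2 \<phi>))\<^sup>2 = (\<Sum>k\<in>K. ?I k)" .
    have var: "(\<integral>\<^sup>+x. \<integral>\<^sup>+y. indicator (cell \<epsilon> k) x * indicator (cell \<epsilon> k) y * ennreal ((\<phi> y - \<phi> x)\<^sup>2) \<partial>lborel \<partial>lborel) =
       ennreal (2 * m * ?I k - 2 * (?S k)\<^sup>2)" if "k \<in> K" for k
      by (rule variance_identity[OF cell_sets em[OF that] less_imp_le[OF m] test_function_integrable[OF \<phi>] i2])
    have G: "(\<integral>\<^sup>+x. ennreal (\<Sum>b\<in>Basis. (dir_deriv b \<phi> x)\<^sup>2) \<partial>lborel) = ennreal ?G"
    proof -
      have sb: "sq_integrable (dir_deriv b \<phi>)" if "b \<in> Basis" for b
        by (rule sq_integrable_test_function[OF test_functions_dir_deriv[OF \<phi> that]])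
      have "(\<integral>\<^sup>+x. ennreal (\<Sum>b\<in>Basis. (dir_deriv b \<phi> x)\<^sup>2) \<partial>lborel) = ennreal (\<integral>x. (\<Sum>b\<in>Basis. (dir_deriv b \<phi> x)\<^sup>2) \<partial>lborel)"
        using sb by (intro nn_integral_eq_integral) (auto simp: sq_integrable_def sum_nonneg)
      also have "(\<integral>x. (\<Sum>b\<in>Basis. (dir_deriv b \<phi> x)\<^sup>2) \<partial>lborel) = ?G"
        using sb by (subst Bochner_Integration.integral_sum) (auto simp: sq_integrable_def norm_abs_L2[OF sb])
      finally show ?thesis .
    qed
    have "ennreal (\<Sum>k\<in>K. 2 * m * ?I k - 2 * (?S k)\<^sup>2) \<le> (\<Sum>k\<in>K. ennreal (2 * m * ?I k - 2 * (?S k)\<^sup>2))"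
      by (rule ennreal_sum_le)
    also have "\<dots> \<le> ennreal ((2 * \<epsilon>) ^ DIM('a) * (DIM('a) * \<epsilon>)\<^sup>2) * ennreal ?G"
      using sum_cell_increments_le[OF \<phi> \<epsilon> K] by (simp add: var G cong: sum.cong)
    also have "\<dots> = ennreal ((2 * \<epsilon>) ^ DIM('a) * (DIM('a) * \<epsilon>)\<^sup>2 * ?G)"
      using \<epsilon> by (simp add: ennreal_mult sum_nonneg)
    finally have "(\<Sum>k\<in>K. 2 * m * ?I k - 2 * (?S k)\<^sup>2) \<le> (2 * \<epsilon>) ^ DIM('a) * (DIM('a) * \<epsilon>)\<^sup>2 * ?G"
      using \<epsilon> by (subst (asm) ennreal_le_iff) (auto intro!: mult_nonneg_nonneg sum_nonneg)
    also have "(2 * \<epsilon>) ^ DIM('a) * (DIM('a) * \<epsilon>)\<^sup>2 = m * (2 ^ d * (real d)\<^sup>2 * \<epsilon>\<^sup>2)"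
      by (simp add: d_def m_def power_mult_distrib)
    also have "\<dots> = 2 * m * \<eta>" unfolding \<epsilon>2 by simp
    also have "(\<Sum>k\<in>K. 2 * m * ?I k - 2 * (?S k)\<^sup>2) = 2 * m * ((\<Sum>k\<in>K. ?I k) - (\<Sum>k\<in>K. (?S k)\<^sup>2 / m))"
      using m by (simp add: sum_subtractf[symmetric] sum_distrib_left right_diff_distrib)
    finally have "(\<Sum>k\<in>K. ?I k) - (\<Sum>k\<in>K. (?S k)\<^sup>2 / m) \<le> \<eta> * ?G" using m by (simp add: mult.assoc)
    moreover have "(\<Sum>k\<in>K. (inner (abs_L2 \<phi>) (c k))\<^sup>2) = (\<Sum>k\<in>K. (?S k)\<^sup>2 / m)" by (intro sum.cong refl S)
    ultimately show ?thesis unfolding norm by linarith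
  qed
  with K show ?thesis by (rule that)
qed

section \<open>The Rayleigh quotient and the principal eigenvalue\<close>

text \<open>The first variation vanishes at a minimum.\<close>

lemma linear_coeff_0_of_nonneg:
  fixes a b :: real
  assumes "\<And>s. 0 \<le> 2 * s * a + s\<^sup>2 * b"
  shows "a = 0"
proof (rule ccontr)
  assume a: "a \<noteq> 0"
  define B where "B = \<bar>b\<bar> + 1"
  have B: "0 < B" "b < B" by (auto simp: B_def)
  have "0 \<le> (2 * (- a / B) * a + (- a / B)\<^sup>2 * b) * B\<^sup>2"
    by (intro mult_nonneg_nonneg assms) simp
  also have "\<dots> = a\<^sup>2 * (b - 2 * B)" using B by (simp add: field_simps power2_eq_square)
  also have "\<dots> < 0" using a B by (intro mult_pos_neg) auto
  finally show False by simp
qed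

text \<open>The values of the finitely many functionals on \<open>S\<close> are bounded, so rounding them yields finitely many
  codes. Vectors with the same code are close: the functionals almost agree on them, and the small
  multiple of the form accounts for the rest.\<close>

lemma totally_bounded_of_form_bound:
  fixes S :: "'h::{real_inner,complete_space} set" and E :: "'h \<Rightarrow> real"
  assumes bdd: "\<And>v. v \<in> S \<Longrightarrow> norm v \<le> R"
    and E: "\<And>v w. v \<in> S \<Longrightarrow> w \<in> S \<Longrightarrow> E (v - w) \<le> C"
    and frd: "\<And>\<eta>. 0 < \<eta> \<Longrightarrow> \<exists>(K :: 'k set) c. finite K \<and>
      (\<forall>v\<in>S. \<forall>w\<in>S. (norm (v - w))\<^sup>2 \<le> \<eta> * E (v - w) + (\<Sum>k\<in>K. (inner (v - w) (c k))\<^sup>2))"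
  shows "compact (closure S)"
  unfolding compact_eq_totally_bounded
proof (intro conjI allI impI)
  show "complete (closure S)" by (simp add: complete_eq_closed)
  fix e :: real assume e: "0 < e"
  define B where "B = \<bar>C\<bar> + 1"
  have B: "0 < B" "C \<le> B" by (auto simp: B_def)
  \<comment> \<open>The form and the functionals each contribute at most $e^2/16$ to the squared distance.\<close>
  define \<eta> where "\<eta> = e\<^sup>2 / (16 * B)"
  have \<eta>: "0 < \<eta>" using e B by (simp add: \<eta>_def)
  have "\<eta> * C \<le> \<eta> * B" using \<eta> B by (intro mult_left_mono) auto
  hence \<eta>C: "\<eta> * C \<le> e\<^sup>2 / 16" using B by (simp add: \<eta>_def)
  obtain K :: "'k set" and c where K: "finite K"
    and frd': "\<And>v w. v \<in> S \<Longrightarrow> w \<in> S \<Longrightarrow> (norm (v - w))\<^sup>2 \<le> \<eta> * E (v - w) + (\<Sum>k\<in>K. (inner (v - w) (c k))\<^sup>2)"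
    using frd[OF \<eta>] by blast
  define n where "n = real (card K) + 1"
  have n: "1 \<le> n" "real (card K) \<le> n" by (auto simp: n_def)
  define \<delta> where "\<delta> = e / (4 * sqrt n)"
  have \<delta>: "0 < \<delta>" using e n by (simp add: \<delta>_def)
  have "real (card K) * \<delta>\<^sup>2 \<le> n * \<delta>\<^sup>2" using n by (intro mult_right_mono) auto
  hence \<delta>2: "real (card K) * \<delta>\<^sup>2 \<le> e\<^sup>2 / 16" using n by (simp add: \<delta>_def power_divide power_mult_distrib)
  define code where "code v = restrict (\<lambda>k. \<lfloor>inner v (c k) / \<delta>\<rfloor>) K" for v
  define N where "N k = \<lceil>R * norm (c k) / \<delta>\<rceil> + 1" for k
  have "code v \<in> PiE K (\<lambda>k. {- N k..N k})" if v: "v \<in> S" for v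
  proof -
    have "\<lfloor>inner v (c k) / \<delta>\<rfloor> \<in> {- N k..N k}" for k
    proof -
      have "\<bar>inner v (c k)\<bar> \<le> norm v * norm (c k)" by (rule Cauchy_Schwarz_ineq2)
      also have "\<dots> \<le> R * norm (c k)" by (intro mult_right_mono bdd v) simp
      finally have "\<bar>inner v (c k) / \<delta>\<bar> \<le> R * norm (c k) / \<delta>" using \<delta> by (simp add: divide_right_mono)
      thus ?thesis unfolding N_def atLeastAtMost_iff by linarith
    qed
    thus ?thesis by (auto simp: code_def)
  qed
  hence "code ` S \<subseteq> PiE K (\<lambda>k. {- N k..N k})" by blast
  hence fin: "finite (code ` S)" by (rule finite_subset) (intro finite_PiE K, simp)
  have close: "norm (v - w) < e / 2" if v: "v \<in> S" and w: "w \<in> S" and vw: "code v = code w" for v w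
  proof -
    have "(inner (v - w) (c k))\<^sup>2 \<le> \<delta>\<^sup>2" if k: "k \<in> K" for k
    proof -
      have "\<lfloor>inner v (c k) / \<delta>\<rfloor> = \<lfloor>inner w (c k) / \<delta>\<rfloor>"
        using fun_cong[OF vw, of k] k by (simp add: code_def)
      hence "\<bar>inner v (c k) / \<delta> - inner w (c k) / \<delta>\<bar> \<le> 1" by linarith
      hence "\<bar>inner (v - w) (c k)\<bar> \<le> \<delta>" using \<delta>
        by (simp add: inner_diff_left diff_divide_distrib[symmetric] abs_divide)
      thus ?thesis using \<delta> by (metis abs_ge_zero power2_abs power_mono)
    qed
    hence "(\<Sum>k\<in>K. (inner (v - w) (c k))\<^sup>2) \<le> real (card K) * \<delta>\<^sup>2" by (rule sum_bounded_above)
    moreover have "\<eta> * E (v - w) \<le> \<eta> * C" using E[OF v w] \<eta> by (intro mult_left_mono) auto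
    ultimately have "(norm (v - w))\<^sup>2 \<le> e\<^sup>2 / 8" using frd'[OF v w] \<eta>C \<delta>2 by linarith
    also have "\<dots> < (e / 2)\<^sup>2" using e by (simp add: power2_eq_square)
    finally show ?thesis by (rule power2_less_imp_less) (use e in simp)
  qed
  define rep where "rep z = (SOME v. v \<in> S \<and> code v = z)" for z
  have rep: "rep (code v) \<in> S \<and> code (rep (code v)) = code v" if "v \<in> S" for v
    unfolding rep_def by (rule someI[of _ v]) (use that in simp)
  have "S \<subseteq> (\<Union>x\<in>rep ` code ` S. cball x (e / 2))"
  proof
    fix v assume v: "v \<in> S"
    have "norm (v - rep (code v)) < e / 2" using close[OF v] rep[OF v] by auto
    hence "v \<in> cball (rep (code v)) (e / 2)" by (simp add: dist_norm norm_minus_commute)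
    thus "v \<in> (\<Union>x\<in>rep ` code ` S. cball x (e / 2))" using v by blast
  qed
  hence "closure S \<subseteq> (\<Union>x\<in>rep ` code ` S. cball x (e / 2))"
    by (rule closure_minimal) (intro closed_UN finite_imageI fin ballI closed_cball)
  also have "\<dots> \<subseteq> (\<Union>x\<in>rep ` code ` S. ball x e)" using e by fastforce
  finally show "\<exists>k. finite k \<and> closure S \<subseteq> (\<Union>x\<in>k. ball x e)" using fin by blast
qed

lemma selfadjoint_opD:
  assumes "selfadjoint_op H D A"
  shows "subspace D" "D \<subseteq> H" "H \<subseteq> closure D" "\<And>v. v \<in> D \<Longrightarrow> A v \<in> H"
  "\<And>v w. v \<in> D \<Longrightarrow> w \<in> D \<Longrightarrow> A (v + w) = A v + A w" "\<And>v c. v \<in> D \<Longrightarrow> A (c *\<^sub>R v) = c *\<^sub>R A v"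
  "\<And>v w. v \<in> D \<Longrightarrow> w \<in> D \<Longrightarrow> inner (A v) w = inner v (A w)"
  "\<And>y z. y \<in> H \<Longrightarrow> z \<in> H \<Longrightarrow> (\<And>v. v \<in> D \<Longrightarrow> inner (A v) y = inner v z) \<Longrightarrow> y \<in> D"
  using assms unfolding selfadjoint_op_def by (blast+)

text \<open>A minimizing sequence of unit vectors has a convergent subsequence by total boundedness. The
  first variation at the limit \<open>y\<close> shows that $(y,Aw)=m(y,w)$ for all \<open>w\<close> in the domain, where \<open>m\<close> is the
  infimum. Self-adjointness puts \<open>y\<close> into the domain and makes it an eigenvector for \<open>m\<close>, whence
  $\lambda_1\le m$. Convergence of the sequence in the form norm is avoided by letting $A$ act on \<open>w\<close>.\<close>

lemma rayleigh_quotient_ge_principal_eigenvalue: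
  fixes A :: "'h::{real_inner,complete_space} \<Rightarrow> 'h"
  assumes sa: "selfadjoint_op H D A" and H: "subspace H" "closed H"
    and pos: "\<And>v. v \<in> D \<Longrightarrow> 0 \<le> inner (A v) v"
    and frd: "\<And>\<eta>. 0 < \<eta> \<Longrightarrow> \<exists>(K :: 'k set) c. finite K \<and>
      (\<forall>v\<in>D. (norm v)\<^sup>2 \<le> \<eta> * inner (A v) v + (\<Sum>k\<in>K. (inner v (c k))\<^sup>2))"
    and lam: "principal_eigenvalue D A lam"
    and v: "v \<in> D"
  shows "lam * (norm v)\<^sup>2 \<le> inner (A v) v"
proof -
  note D = selfadjoint_opD[OF sa]
  define Q where "Q v = inner (A v) v" for v
  have Q_scale: "Q (s *\<^sub>R w) = s\<^sup>2 * Q w" if "w \<in> D" for s w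
    using that by (simp add: Q_def D(6) power2_eq_square)
  have Q_add: "Q (v + s *\<^sub>R w) = Q v + 2 * s * inner v (A w) + s\<^sup>2 * Q w" if vw: "v \<in> D" "w \<in> D" for v w s
  proof -
    have "A (v + s *\<^sub>R w) = A v + s *\<^sub>R A w"
      using D(5)[OF vw(1) subspace_scale[OF D(1) vw(2)]] D(6)[OF vw(2)] by simp
    moreover have "inner (A v) w = inner v (A w)" by (rule D(7)[OF vw])
    ultimately show ?thesis
      by (simp add: Q_def inner_add_left inner_add_right inner_commute[of "A w" v] power2_eq_square algebra_simps)
  qed
  define S where "S = {v \<in> D. norm v = 1}"
  define m where "m = Inf (Q ` S)"
  obtain e where "e \<in> D" "e \<noteq> 0" using lam by (auto simp: principal_eigenvalue_def eigenvalue_op_def)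
  hence "(1 / norm e) *\<^sub>R e \<in> S" using subspace_scale[OF D(1)] by (simp add: S_def)
  hence ne: "Q ` S \<noteq> {}" by blast
  have bdd: "bdd_below (Q ` S)" by (rule bdd_belowI[of _ 0]) (auto simp: S_def Q_def pos)
  have m_le: "m * (norm v)\<^sup>2 \<le> Q v" if v: "v \<in> D" for v
  proof (cases "v = 0")
    case True
    thus ?thesis using pos[OF v] by (simp add: Q_def)
  next
    case False
    have "(1 / norm v) *\<^sub>R v \<in> S" using v False subspace_scale[OF D(1)] by (simp add: S_def)
    hence "m \<le> Q ((1 / norm v) *\<^sub>R v)" unfolding m_def using bdd by (intro cInf_lower) auto
    thus ?thesis using False by (simp add: Q_scale[OF v] power_divide field_simps)
  qed
  have "\<exists>v\<in>S. Q v < m + inverse (real (Suc n))" for n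
  proof -
    have "m < m + inverse (real (Suc n))" by simp
    from cInf_lessD[OF ne this[unfolded m_def]] show ?thesis by (auto simp: m_def)
  qed
  then obtain x where x: "\<And>n. x n \<in> S" "\<And>n. Q (x n) < m + inverse (real (Suc n))" by metis
  have xD: "x n \<in> D" "norm (x n) = 1" for n using x(1) by (auto simp: S_def)
  have Qx: "(\<lambda>n. Q (x n)) \<longlonglongrightarrow> m"
  proof (rule tendsto_sandwich)
    show "\<forall>\<^sub>F n in sequentially. m \<le> Q (x n)" using m_le[OF xD(1)] xD(2) by (intro always_eventually) auto
    show "\<forall>\<^sub>F n in sequentially. Q (x n) \<le> m + inverse (real (Suc n))" using x(2) by (intro always_eventually) (auto intro: less_imp_le)
    show "(\<lambda>n. m + inverse (real (Suc n))) \<longlonglongrightarrow> m" using tendsto_add[OF tendsto_const LIMSEQ_inverse_real_of_nat, of m] by simp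
  qed simp
  have cpt: "compact (closure (range x))"
  proof (rule totally_bounded_of_form_bound[where R = 1 and E = Q and C = "4 * (m + 1)"])
    show "norm v \<le> 1" if "v \<in> range x" for v using that xD(2) by auto
    have diffD: "x i - x j \<in> D" for i j using xD(1) by (intro subspace_diff D(1))
    have "Q (x i - x j) \<le> 4 * (m + 1)" for i j
    proof -
      have "Q (x i + (-1) *\<^sub>R x j) + Q (x i + 1 *\<^sub>R x j) = 2 * Q (x i) + 2 * Q (x j)"
        unfolding Q_add[OF xD(1) xD(1)] by simp
      moreover have "0 \<le> Q (x i + 1 *\<^sub>R x j)"
        using pos subspace_add[OF D(1) xD(1) xD(1)] by (simp add: Q_def)
      moreover have "inverse (real (Suc i)) \<le> 1" "inverse (real (Suc j)) \<le> 1" by (simp_all add: inverse_le_1_iff)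
      ultimately show ?thesis using x(2)[of i] x(2)[of j] by simp
    qed
    thus "Q (v - w) \<le> 4 * (m + 1)" if "v \<in> range x" "w \<in> range x" for v w using that by auto
    fix \<eta> :: real assume "0 < \<eta>"
    from frd[OF this] obtain K :: "'k set" and c where K: "finite K"
      "\<And>v. v \<in> D \<Longrightarrow> (norm v)\<^sup>2 \<le> \<eta> * inner (A v) v + (\<Sum>k\<in>K. (inner v (c k))\<^sup>2)" by blast
    have "\<forall>v\<in>range x. \<forall>w\<in>range x. (norm (v - w))\<^sup>2 \<le> \<eta> * Q (v - w) + (\<Sum>k\<in>K. (inner (v - w) (c k))\<^sup>2)"
      using K(2)[OF diffD] unfolding Q_def by blast
    with K(1) show "\<exists>(K :: 'k set) c. finite K \<and> (\<forall>v\<in>range x. \<forall>w\<in>range x.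
       (norm (v - w))\<^sup>2 \<le> \<eta> * Q (v - w) + (\<Sum>k\<in>K. (inner (v - w) (c k))\<^sup>2))" by blast
  qed
  have cl: "\<forall>n. x n \<in> closure (range x)" by (intro allI subsetD[OF closure_subset] rangeI)
  have "\<exists>y\<in>closure (range x). \<exists>r. strict_mono r \<and> (x \<circ> r) \<longlonglongrightarrow> y"
    using cpt cl unfolding compact_def by simp
  then obtain y r where y: "strict_mono (r :: nat \<Rightarrow> nat)" "(x \<circ> r) \<longlonglongrightarrow> y" by blast
  have ny: "norm y = 1"
    using LIMSEQ_unique[OF tendsto_norm[OF y(2)], of 1] xD(2) by simp
  have yH: "y \<in> H" using closed_sequentially[OF H(2) _ y(2)] xD(1) D(2) by auto
  have Qxr: "(\<lambda>n. Q (x (r n))) \<longlonglongrightarrow> m" using LIMSEQ_subseq_LIMSEQ[OF Qx y(1)] by (simp add: o_def)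
  have weak: "inner (A w) y = inner w (m *\<^sub>R y)" if w: "w \<in> D" for w
  proof -
    have "0 \<le> 2 * s * (inner y (A w) - m * inner y w) + s\<^sup>2 * (Q w - m * (norm w)\<^sup>2)" for s
    proof -
      have le: "m * (norm (x (r n) + s *\<^sub>R w))\<^sup>2 \<le> Q (x (r n)) + 2 * s * inner (x (r n)) (A w) + s\<^sup>2 * Q w" for n
        using m_le[OF subspace_add[OF D(1) xD(1) subspace_scale[OF D(1) w]], of "r n" s] Q_add[OF xD(1) w, of "r n" s] by simp
      have "m * (norm (y + s *\<^sub>R w))\<^sup>2 \<le> m + 2 * s * inner y (A w) + s\<^sup>2 * Q w"
      proof (rule LIMSEQ_le)
        show "(\<lambda>n. m * (norm (x (r n) + s *\<^sub>R w))\<^sup>2) \<longlonglongrightarrow> m * (norm (y + s *\<^sub>R w))\<^sup>2"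
          by (intro tendsto_intros y(2)[unfolded o_def])
        show "(\<lambda>n. Q (x (r n)) + 2 * s * inner (x (r n)) (A w) + s\<^sup>2 * Q w) \<longlonglongrightarrow> m + 2 * s * inner y (A w) + s\<^sup>2 * Q w"
          by (intro tendsto_intros y(2)[unfolded o_def] Qxr)
      qed (use le in blast)
      moreover have "(norm (y + s *\<^sub>R w))\<^sup>2 = 1 + 2 * s * inner y w + s\<^sup>2 * (norm w)\<^sup>2"
        unfolding power2_norm_eq_inner using ny[unfolded norm_eq_1]
        by (simp add: inner_add_left inner_add_right inner_commute[of w y] power2_eq_square algebra_simps)
      ultimately show ?thesis by (simp add: algebra_simps)
    qed
    from linear_coeff_0_of_nonneg[OF this] show ?thesis by (simp add: inner_commute)
  qed
  have yD: "y \<in> D" by (rule D(8)[OF yH subspace_scale[OF H(1) yH] weak])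
  have orth: "inner (A y - m *\<^sub>R y) w = 0" if "w \<in> D" for w
    using weak[OF that] D(7)[OF yD that] by (simp add: inner_diff_left inner_diff_right inner_commute)
  have cl_D: "A y - m *\<^sub>R y \<in> closure D"
    by (intro subsetD[OF D(3)] subspace_diff[OF H(1)] subspace_scale[OF H(1)] D(4) yD yH)
  have "inner (A y - m *\<^sub>R y) (A y - m *\<^sub>R y) = 0"
  proof (rule continuous_constant_on_closure[where S = D and f = "inner (A y - m *\<^sub>R y)"])
    show "continuous_on (closure D) (inner (A y - m *\<^sub>R y))" by (intro continuous_intros)
  qed (fact orth cl_D)+
  hence "A y = m *\<^sub>R y" by simp
  moreover have "y \<noteq> 0" using ny by auto
  ultimately have "lam \<le> m" using lam yD by (auto simp: principal_eigenvalue_def eigenvalue_op_def)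
  hence "lam * (norm v)\<^sup>2 \<le> m * (norm v)\<^sup>2" by (intro mult_right_mono) auto
  with m_le[OF v] show ?thesis by (simp add: Q_def)
qed

section \<open>Sobolev functions and coercivity of the elliptic operator\<close>

lemma k_smooth_on_zero: "k_smooth_on k U f" if "open U" "\<And>x. x \<in> U \<Longrightarrow> f x = 0"
  by (rule k_smooth_on_cong[OF that(1) _ k_smooth_on_const[of k U 0]]) (use that in auto)

lemma smooth_on_mult_test_function:
  assumes U: "open U" "\<Omega> \<subseteq> U" and m: "smooth_on U m" and \<phi>: "\<phi> \<in> test_functions \<Omega>"
  shows "(\<lambda>x. m x * \<phi> x) \<in> test_functions \<Omega>"
proof -
  let ?K = "closure {x. \<phi> x \<noteq> 0}"
  have K: "?K \<subseteq> \<Omega>" using \<phi> by (simp add: test_functions_def)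
  have "k_smooth_on k UNIV (\<lambda>x. m x * \<phi> x)" for k
  proof -
    have "k_smooth_on k U m" using m by (simp add: smooth_on_def)
    moreover have "k_smooth_on k U \<phi>" by (rule k_smooth_on_mono[OF test_functionD(1)[OF \<phi>]]) simp
    ultimately have "k_smooth_on k U (\<lambda>x. m x * \<phi> x)" by (rule k_smooth_on_mult[OF U(1)])
    moreover have "k_smooth_on k (- ?K) (\<lambda>x. m x * \<phi> x)"
      by (rule k_smooth_on_zero) (use closure_subset[of "{x. \<phi> x \<noteq> 0}"] in auto)
    ultimately have "k_smooth_on k (U \<union> - ?K) (\<lambda>x. m x * \<phi> x)"
      by (intro k_smooth_on_Un U open_Compl closed_closure)
    moreover have "U \<union> - ?K = UNIV" using K U(2) by auto
    ultimately show ?thesis by simp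
  qed
  moreover have sub: "closure {x. m x * \<phi> x \<noteq> 0} \<subseteq> ?K" by (rule closure_mono) auto
  moreover have "compact (closure {x. m x * \<phi> x \<noteq> 0})"
    using compact_Int_closed[OF test_functionD(4)[OF \<phi>] closed_closure[of "{x. m x * \<phi> x \<noteq> 0}"]]
    unfolding Int_absorb1[OF sub] .
  ultimately show ?thesis using K unfolding test_functions_def smooth_on_def by blast
qed

lemma smooth_on_dir_deriv: "smooth_on U m \<Longrightarrow> b \<in> Basis \<Longrightarrow> smooth_on U (dir_deriv b m)"
  unfolding smooth_on_def using k_smooth_on.simps(2) by blast

lemma smooth_on_continuous: "smooth_on U m \<Longrightarrow> continuous_on U m"
  unfolding smooth_on_def using k_smooth_on.simps(1) by blast

text \<open>The coefficient is bounded on \<open>\<Omega>\<close> since it is continuous on the compact closure.\<close>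

lemma sq_integrable_smooth_mult:
  fixes \<Omega> :: "'a::euclidean_space set"
  assumes \<Omega>: "open \<Omega>" "bounded \<Omega>" "closure \<Omega> \<subseteq> U" and m: "smooth_on U m"
  shows "sq_integrable (\<lambda>x. indicator \<Omega> x * m x * rep_L2 f x)"
proof -
  have "compact (m ` closure \<Omega>)"
    using smooth_on_continuous[OF m] \<Omega> by (intro compact_continuous_image) (auto intro: continuous_on_subset simp: compact_closure)
  then obtain C where C: "\<forall>y\<in>m ` closure \<Omega>. norm y \<le> C" unfolding bounded_iff[symmetric] using compact_imp_bounded bounded_iff by metis
  have [measurable]: "\<Omega> \<in> sets borel" using \<Omega> by simp
  have "continuous_on \<Omega> m" using smooth_on_continuous[OF m] \<Omega>(3) closure_subset[of \<Omega>] by (blast intro: continuous_on_subset)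
  from borel_measurable_continuous_on_indicator[OF _ this]
  have [measurable]: "(\<lambda>x. indicator \<Omega> x * m x) \<in> borel_measurable borel" by simp
  show ?thesis
  proof (rule sq_integrableI_bounded[where C = "\<bar>C\<bar>", OF sq_integrable_rep_L2[of f]])
    show "(\<lambda>x. indicator \<Omega> x * m x * rep_L2 f x) \<in> borel_measurable lborel" by measurable
    show "AE x in lborel. \<bar>indicator \<Omega> x * m x * rep_L2 f x\<bar> \<le> \<bar>C\<bar> * \<bar>rep_L2 f x\<bar>"
    proof (rule AE_I2)
      fix x
      show "\<bar>indicator \<Omega> x * m x * rep_L2 f x\<bar> \<le> \<bar>C\<bar> * \<bar>rep_L2 f x\<bar>"
      proof (cases "x \<in> \<Omega>")
        case True
        hence "\<bar>m x\<bar> \<le> \<bar>C\<bar>" using C closure_subset[of \<Omega>] by force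
        thus ?thesis using True by (simp add: abs_mult mult_right_mono)
      qed simp
    qed
  qed
qed

lemma rep_L2_mult:
  fixes \<Omega> :: "'a::euclidean_space set"
  assumes "open \<Omega>" "bounded \<Omega>" "closure \<Omega> \<subseteq> U" "smooth_on U m"
  shows "AE x in lborel. rep_L2 (L2_mult \<Omega> m f) x = indicator \<Omega> x * m x * rep_L2 f x"
  unfolding L2_mult_def by (rule rep_abs_L2[OF sq_integrable_smooth_mult[OF assms]])

lemma L2_mult_in_L2_on:
  fixes \<Omega> :: "'a::euclidean_space set"
  assumes "open \<Omega>" "bounded \<Omega>" "closure \<Omega> \<subseteq> U" "smooth_on U m"
  shows "L2_mult \<Omega> m f \<in> L2_on \<Omega>"
  unfolding L2_on_def using rep_L2_mult[OF assms, of f] by (auto elim: eventually_mono)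

lemma inner_L2_mult:
  fixes \<Omega> :: "'a::euclidean_space set"
  assumes "open \<Omega>" "bounded \<Omega>" "closure \<Omega> \<subseteq> U" "smooth_on U m"
  shows "inner (L2_mult \<Omega> m f) g = (\<integral>x. indicator \<Omega> x * m x * rep_L2 f x * rep_L2 g x \<partial>lborel)"
    "integrable lborel (\<lambda>x. indicator \<Omega> x * m x * rep_L2 f x * rep_L2 g x)"
  using inner_abs_L2[OF sq_integrable_smooth_mult[OF assms] sq_integrable_rep_L2[of g]]
    sq_integrable_mult[OF sq_integrable_smooth_mult[OF assms] sq_integrable_rep_L2[of g]]
  by (simp_all add: L2_mult_def abs_rep_L2)

lemma inner_L2_mult_test_function:
  fixes \<Omega> :: "'a::euclidean_space set"
  assumes \<Omega>: "open \<Omega>" "bounded \<Omega>" "closure \<Omega> \<subseteq> U" and U: "open U" and m: "smooth_on U m" and \<psi>: "\<psi> \<in> test_functions \<Omega>"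
  shows "inner (L2_mult \<Omega> m f) (abs_L2 \<psi>) = inner f (abs_L2 (\<lambda>x. m x * \<psi> x))"
proof -
  have "\<Omega> \<subseteq> U" using \<Omega>(3) closure_subset by blast
  note t = sq_integrable_test_function[OF smooth_on_mult_test_function[OF U this m \<psi>]]
  have "inner (L2_mult \<Omega> m f) (abs_L2 \<psi>) = (\<integral>x. indicator \<Omega> x * m x * rep_L2 f x * \<psi> x \<partial>lborel)"
    unfolding L2_mult_def by (rule inner_abs_L2[OF sq_integrable_smooth_mult[OF \<Omega> m] sq_integrable_test_function[OF \<psi>]])
  also have "\<dots> = (\<integral>x. rep_L2 f x * (m x * \<psi> x) \<partial>lborel)"
  proof (intro Bochner_Integration.integral_cong refl)
    fix x show "indicator \<Omega> x * m x * rep_L2 f x * \<psi> x = rep_L2 f x * (m x * \<psi> x)"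
      using test_functionD(5)[OF \<psi>, of x] by (cases "x \<in> \<Omega>") auto
  qed
  also have "\<dots> = inner f (abs_L2 (\<lambda>x. m x * \<psi> x))"
    using inner_abs_L2[OF sq_integrable_rep_L2 t, of f] by (simp add: abs_rep_L2)
  finally show ?thesis .
qed

text \<open>The product rule is moved to the test function: $m\phi$ is again a test function, and
  $m\,\partial_b\phi = \partial_b(m\phi) - (\partial_b m)\phi$.\<close>

lemma has_weak_deriv_mult:
  fixes \<Omega> :: "'a::euclidean_space set"
  assumes \<Omega>: "open \<Omega>" "bounded \<Omega>" "closure \<Omega> \<subseteq> U" and U: "open U" and m: "smooth_on U m"
    and b: "b \<in> Basis" and f: "has_weak_deriv \<Omega> b f g"
  shows "has_weak_deriv \<Omega> b (L2_mult \<Omega> m f) (L2_mult \<Omega> (dir_deriv b m) f + L2_mult \<Omega> m g)"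
  unfolding has_weak_deriv_def
proof (intro conjI ballI)
  note m' = smooth_on_dir_deriv[OF m b]
  show "L2_mult \<Omega> m f \<in> L2_on \<Omega>" by (rule L2_mult_in_L2_on[OF \<Omega> m])
  show "L2_mult \<Omega> (dir_deriv b m) f + L2_mult \<Omega> m g \<in> L2_on \<Omega>"
    by (intro subspace_add subspace_L2_on \<Omega>(1) L2_mult_in_L2_on[OF \<Omega> m] L2_mult_in_L2_on[OF \<Omega> m'])
  fix \<phi> assume \<phi>: "\<phi> \<in> test_functions \<Omega>"
  have \<Omega>U: "\<Omega> \<subseteq> U" using \<Omega>(3) closure_subset by blast
  note t1 = smooth_on_mult_test_function[OF U \<Omega>U m \<phi>]
  note t2 = smooth_on_mult_test_function[OF U \<Omega>U m' \<phi>]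
  note t3 = smooth_on_mult_test_function[OF U \<Omega>U m test_functions_dir_deriv[OF \<phi> b]]
  let ?K = "closure {x. \<phi> x \<noteq> 0}"
  have leibniz: "dir_deriv b (\<lambda>x. m x * \<phi> x) x = m x * dir_deriv b \<phi> x + dir_deriv b m x * \<phi> x" for x
  proof (cases "x \<in> U")
    case True
    have "k_smooth_on (Suc 0) U m" using m unfolding smooth_on_def by blast
    hence "m differentiable (at x)" using True by simp
    thus ?thesis
      by (intro dir_deriv_eqI has_derivative_mult has_derivative_dir_deriv test_functionD(2)[OF \<phi>])
  next
    case False
    have "?K \<subseteq> \<Omega>" using \<phi> by (simp add: test_functions_def)
    hence x: "x \<notin> ?K" using False \<Omega>U by blast
    have "closure {x. m x * \<phi> x \<noteq> 0} \<subseteq> ?K" by (rule closure_mono) auto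
    hence "x \<notin> closure {x. m x * \<phi> x \<noteq> 0}" using x by blast
    moreover have "\<phi> x = 0" using x closure_subset[of "{x. \<phi> x \<noteq> 0}"] by auto
    ultimately show ?thesis using dir_deriv_eq_0[OF x] by (simp add: dir_deriv_eq_0)
  qed
  have "inner (L2_mult \<Omega> m f) (abs_L2 (dir_deriv b \<phi>)) = inner f (abs_L2 (\<lambda>x. m x * dir_deriv b \<phi> x))"
    by (rule inner_L2_mult_test_function[OF \<Omega> U m test_functions_dir_deriv[OF \<phi> b]])
  also have "(\<lambda>x. m x * dir_deriv b \<phi> x) = (\<lambda>x. dir_deriv b (\<lambda>x. m x * \<phi> x) x - dir_deriv b m x * \<phi> x)"
    by (simp add: leibniz)
  also have "abs_L2 \<dots> = abs_L2 (dir_deriv b (\<lambda>x. m x * \<phi> x)) - abs_L2 (\<lambda>x. dir_deriv b m x * \<phi> x)"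
    by (rule abs_L2_diff[OF sq_integrable_test_function[OF test_functions_dir_deriv[OF t1 b]] sq_integrable_test_function[OF t2]])
  also have "inner f \<dots> = - inner g (abs_L2 (\<lambda>x. m x * \<phi> x)) - inner f (abs_L2 (\<lambda>x. dir_deriv b m x * \<phi> x))"
    using f t1 unfolding has_weak_deriv_def by (simp add: inner_diff_right)
  also have "\<dots> = - inner (L2_mult \<Omega> (dir_deriv b m) f + L2_mult \<Omega> m g) (abs_L2 \<phi>)"
    by (simp add: inner_add_left inner_L2_mult_test_function[OF \<Omega> U m \<phi>] inner_L2_mult_test_function[OF \<Omega> U m' \<phi>])
  finally show "inner (L2_mult \<Omega> m f) (abs_L2 (dir_deriv b \<phi>)) = - inner (L2_mult \<Omega> (dir_deriv b m) f + L2_mult \<Omega> m g) (abs_L2 \<phi>)" .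
qed

lemma has_weak_deriv_diff:
  "open \<Omega> \<Longrightarrow> has_weak_deriv \<Omega> b f g \<Longrightarrow> has_weak_deriv \<Omega> b f' g' \<Longrightarrow> has_weak_deriv \<Omega> b (f - f') (g - g')"
  unfolding has_weak_deriv_def using subspace_L2_on[of \<Omega>] by (simp add: subspace_diff inner_diff_left)

lemma has_weak_deriv_sum:
  assumes "open \<Omega>" "\<And>i. i \<in> I \<Longrightarrow> has_weak_deriv \<Omega> b (f i) (g i)"
  shows "has_weak_deriv \<Omega> b (\<Sum>i\<in>I. f i) (\<Sum>i\<in>I. g i)"
  unfolding has_weak_deriv_def
proof (intro conjI ballI)
  show "(\<Sum>i\<in>I. f i) \<in> L2_on \<Omega>" "(\<Sum>i\<in>I. g i) \<in> L2_on \<Omega>"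
    using assms by (auto intro!: subspace_sum subspace_L2_on simp: has_weak_deriv_def)
  fix \<phi> assume "\<phi> \<in> test_functions \<Omega>"
  thus "inner (\<Sum>i\<in>I. f i) (abs_L2 (dir_deriv b \<phi>)) = - inner (\<Sum>i\<in>I. g i) (abs_L2 \<phi>)"
    using assms(2) by (simp add: inner_sum_left has_weak_deriv_def sum_negf[symmetric])
qed

text \<open>Density is the fundamental lemma of the calculus of variations in disguise, and it makes
  \<^const>\<open>weak_deriv\<close> well defined.\<close>

locale dense_test_functions =
  fixes \<Omega> :: "'a::euclidean_space set"
  assumes open_domain: "open \<Omega>"
    and dense: "L2_on \<Omega> \<subseteq> closure (abs_L2 ` test_functions \<Omega>)"
begin

lemma eq_0_of_orthogonal_test_functions:
  assumes "f \<in> L2_on \<Omega>" "\<And>\<phi>. \<phi> \<in> test_functions \<Omega> \<Longrightarrow> inner f (abs_L2 \<phi>) = 0"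
  shows "f = 0"
proof -
  have "inner f f = 0"
    by (rule continuous_constant_on_closure[of "abs_L2 ` test_functions \<Omega>" "inner f"])
       (use assms dense in \<open>auto intro!: continuous_intros\<close>)
  thus ?thesis by simp
qed

lemma weak_deriv_eqI:
  assumes "has_weak_deriv \<Omega> b f g"
  shows "weak_deriv \<Omega> b f = g"
  unfolding weak_deriv_def
proof (rule the_equality)
  show "has_weak_deriv \<Omega> b f g" by (rule assms)
  fix g' assume g': "has_weak_deriv \<Omega> b f g'"
  have "g' - g = 0"
  proof (rule eq_0_of_orthogonal_test_functions)
    show "g' - g \<in> L2_on \<Omega>" using assms g' open_domain by (auto intro!: subspace_diff subspace_L2_on simp: has_weak_deriv_def)
    fix \<phi> assume "\<phi> \<in> test_functions \<Omega>"
    thus "inner (g' - g) (abs_L2 \<phi>) = 0" using assms g' by (simp add: has_weak_deriv_def inner_diff_left)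
  qed
  thus "g' = g" by simp
qed

lemma has_weak_deriv_weak_deriv:
  assumes "f \<in> H1 \<Omega>" "b \<in> Basis"
  shows "has_weak_deriv \<Omega> b f (weak_deriv \<Omega> b f)"
  using assms weak_deriv_eqI unfolding H1_def by blast

lemma H10_approximation:
  assumes f: "f \<in> H10 \<Omega>"
  obtains \<phi> where "\<And>n::nat. \<phi> n \<in> test_functions \<Omega>" "(\<lambda>n. abs_L2 (\<phi> n)) \<longlonglongrightarrow> f"
    "\<And>b. b \<in> Basis \<Longrightarrow> (\<lambda>n. abs_L2 (dir_deriv b (\<phi> n))) \<longlonglongrightarrow> weak_deriv \<Omega> b f"
proof -
  have fH1: "f \<in> H1 \<Omega>" using f by (simp add: H10_def)
  have "\<exists>\<phi>\<in>test_functions \<Omega>. H1_norm \<Omega> (f - abs_L2 \<phi>) < inverse (real (Suc n))" for n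
    using f by (simp add: H10_def)
  then obtain \<phi> where \<phi>: "\<And>n. \<phi> n \<in> test_functions \<Omega>" "\<And>n. H1_norm \<Omega> (f - abs_L2 (\<phi> n)) < inverse (real (Suc n))"
    by metis
  have wd: "weak_deriv \<Omega> b (f - abs_L2 (\<phi> n)) = weak_deriv \<Omega> b f - abs_L2 (dir_deriv b (\<phi> n))" if "b \<in> Basis" for b n
    by (intro weak_deriv_eqI has_weak_deriv_diff open_domain has_weak_deriv_weak_deriv[OF fH1 that] has_weak_deriv_test_function[OF \<phi>(1) that])
  have le: "norm (f - abs_L2 (\<phi> n)) \<le> H1_norm \<Omega> (f - abs_L2 (\<phi> n))" for n
    unfolding H1_norm_def by (rule real_le_rsqrt) (simp add: sum_nonneg)
  have le': "norm (weak_deriv \<Omega> b f - abs_L2 (dir_deriv b (\<phi> n))) \<le> H1_norm \<Omega> (f - abs_L2 (\<phi> n))" if b: "b \<in> Basis" for b n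
    unfolding H1_norm_def
  proof (rule real_le_rsqrt)
    have "(norm (weak_deriv \<Omega> b (f - abs_L2 (\<phi> n))))\<^sup>2 \<le> (\<Sum>b\<in>Basis. (norm (weak_deriv \<Omega> b (f - abs_L2 (\<phi> n))))\<^sup>2)"
      using b by (intro member_le_sum) auto
    thus "(norm (weak_deriv \<Omega> b f - abs_L2 (dir_deriv b (\<phi> n))))\<^sup>2 \<le>
      (norm (f - abs_L2 (\<phi> n)))\<^sup>2 + (\<Sum>b\<in>Basis. (norm (weak_deriv \<Omega> b (f - abs_L2 (\<phi> n))))\<^sup>2)"
      unfolding wd[OF b] by (simp add: add_increasing)
  qed
  have conv: "X \<longlonglongrightarrow> x" if "\<And>n. norm (x - X n) \<le> H1_norm \<Omega> (f - abs_L2 (\<phi> n))" for X :: "nat \<Rightarrow> 'a L2" and x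
  proof (rule LIM_zero_cancel, rule Lim_null_comparison[OF _ LIMSEQ_inverse_real_of_nat])
    have "norm (X n - x) \<le> inverse (real (Suc n))" for n
      using that[of n] \<phi>(2)[of n] by (simp add: norm_minus_commute)
    thus "\<forall>\<^sub>F n in sequentially. norm (X n - x) \<le> inverse (real (Suc n))" by (intro always_eventually) blast
  qed
  show ?thesis
    by (rule that[of \<phi>]) (auto intro!: \<phi>(1) conv le le')
qed

text \<open>Both sides are continuous in the $H^1$ norm, so the inequality passes from test functions to their
  limits.\<close>

lemma friedrichs_H10:
  assumes "bounded \<Omega>" "0 < \<eta>"
  shows "\<exists>(K :: 'a set) c. finite K \<and> (\<forall>v\<in>H10 \<Omega>. (norm v)\<^sup>2 \<le>
       \<eta> * (\<Sum>b\<in>Basis. (norm (weak_deriv \<Omega> b v))\<^sup>2) + (\<Sum>k\<in>K. (inner v (c k))\<^sup>2))"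
proof -
  obtain K :: "'a set" and c where K: "finite K" and le: "\<And>\<phi>. \<phi> \<in> test_functions \<Omega> \<Longrightarrow> (norm (abs_L2 \<phi>))\<^sup>2 \<le>
       \<eta> * (\<Sum>b\<in>Basis. (norm (abs_L2 (dir_deriv b \<phi>)))\<^sup>2) + (\<Sum>k\<in>K. (inner (abs_L2 \<phi>) (c k))\<^sup>2)"
    using friedrichs[OF assms] by blast
  have "(norm v)\<^sup>2 \<le> \<eta> * (\<Sum>b\<in>Basis. (norm (weak_deriv \<Omega> b v))\<^sup>2) + (\<Sum>k\<in>K. (inner v (c k))\<^sup>2)" if v: "v \<in> H10 \<Omega>" for v
  proof -
    obtain \<phi> where \<phi>: "\<And>n::nat. \<phi> n \<in> test_functions \<Omega>" "(\<lambda>n. abs_L2 (\<phi> n)) \<longlonglongrightarrow> v"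
      "\<And>b. b \<in> Basis \<Longrightarrow> (\<lambda>n. abs_L2 (dir_deriv b (\<phi> n))) \<longlonglongrightarrow> weak_deriv \<Omega> b v"
      using H10_approximation[OF v] by blast
    show ?thesis
    proof (rule LIMSEQ_le)
      show "(\<lambda>n. (norm (abs_L2 (\<phi> n)))\<^sup>2) \<longlonglongrightarrow> (norm v)\<^sup>2" by (intro tendsto_intros \<phi>)
      show "(\<lambda>n. \<eta> * (\<Sum>b\<in>Basis. (norm (abs_L2 (dir_deriv b (\<phi> n))))\<^sup>2) + (\<Sum>k\<in>K. (inner (abs_L2 (\<phi> n)) (c k))\<^sup>2))
         \<longlonglongrightarrow> \<eta> * (\<Sum>b\<in>Basis. (norm (weak_deriv \<Omega> b v))\<^sup>2) + (\<Sum>k\<in>K. (inner v (c k))\<^sup>2)"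
        by (intro tendsto_intros \<phi>)
    qed (use le[OF \<phi>(1)] in blast)
  qed
  with K show ?thesis by blast
qed

text \<open>A function in $H^1_0$ may be used as a test function, as the pairing is continuous in the $H^1$ norm.\<close>

lemma inner_weak_deriv_H10:
  assumes F: "has_weak_deriv \<Omega> b F G" and v: "v \<in> H10 \<Omega>" and b: "b \<in> Basis"
  shows "inner G v = - inner F (weak_deriv \<Omega> b v)"
proof -
  obtain \<phi> where \<phi>: "\<And>n::nat. \<phi> n \<in> test_functions \<Omega>" "(\<lambda>n. abs_L2 (\<phi> n)) \<longlonglongrightarrow> v"
    "\<And>b. b \<in> Basis \<Longrightarrow> (\<lambda>n. abs_L2 (dir_deriv b (\<phi> n))) \<longlonglongrightarrow> weak_deriv \<Omega> b v"
    using H10_approximation[OF v] by blast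
  have "(\<lambda>n. inner G (abs_L2 (\<phi> n))) \<longlonglongrightarrow> inner G v" by (intro tendsto_intros \<phi>)
  moreover have "(\<lambda>n. - inner F (abs_L2 (dir_deriv b (\<phi> n)))) \<longlonglongrightarrow> - inner F (weak_deriv \<Omega> b v)"
    by (intro tendsto_intros \<phi> b)
  moreover have "- inner F (abs_L2 (dir_deriv b (\<phi> n))) = inner G (abs_L2 (\<phi> n))" for n
    using F \<phi>(1)[of n] by (simp add: has_weak_deriv_def)
  ultimately show ?thesis using LIMSEQ_unique by simp
qed

end

text \<open>Integration by parts turns $(Av,v)$ into $\int(M\nabla v\cdot\nabla v + a_0v^2)$. The weak divergence
  in the definition of the operator exists on its domain by the product rule.\<close>

lemma ell_op_coercive:
  fixes \<Omega> :: "(real^'n) set"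
  assumes "dense_test_functions \<Omega>" and bounded: "bounded \<Omega>" and coeffs: "elliptic_coeffs \<Omega> M a\<^sub>0"
  obtains c where "0 < c" "\<And>v. v \<in> ell_dom \<Omega> \<Longrightarrow>
    c * (\<Sum>b\<in>Basis. (norm (weak_deriv \<Omega> b v))\<^sup>2) \<le> inner (ell_op \<Omega> M a\<^sub>0 v) v"
proof -
  interpret dense_test_functions \<Omega> by fact
  obtain U where U: "open U" "closure \<Omega> \<subseteq> U" and a: "smooth_on U a\<^sub>0" and M: "\<And>i j. smooth_on U (\<lambda>x. M x $ i $ j)"
    using coeffs by (auto simp: elliptic_coeffs_def)
  obtain c where c: "0 < c" "\<And>x \<xi>. x \<in> \<Omega> \<Longrightarrow> c * (norm \<xi>)\<^sup>2 \<le> inner \<xi> (M x *v \<xi>)"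
    using coeffs by (auto simp: elliptic_coeffs_def)
  have a_nonneg: "0 \<le> a\<^sub>0 x" if "x \<in> \<Omega>" for x using coeffs that by (auto simp: elliptic_coeffs_def)
  note \<Omega> = open_domain bounded U(2)
  have "c * (\<Sum>b\<in>Basis. (norm (weak_deriv \<Omega> b v))\<^sup>2) \<le> inner (ell_op \<Omega> M a\<^sub>0 v) v" if v: "v \<in> ell_dom \<Omega>" for v
  proof -
    define D where "D j = weak_deriv \<Omega> (axis j 1) v" for j
    define F where "F i = (\<Sum>j\<in>UNIV. L2_mult \<Omega> (\<lambda>x. M x $ i $ j) (D j))" for i
    have v10: "v \<in> H10 \<Omega>" and v2: "v \<in> H2 \<Omega>" using v by (auto simp: ell_dom_def)
    have ax: "axis i (1::real) \<in> Basis" for i :: 'n by (simp add: axis_in_Basis_iff)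
    have DH1: "D j \<in> H1 \<Omega>" for j using v2 ax by (auto simp: H2_def D_def)
    have "has_weak_deriv \<Omega> (axis i 1) (L2_mult \<Omega> (\<lambda>x. M x $ i $ j) (D j))
      (L2_mult \<Omega> (dir_deriv (axis i 1) (\<lambda>x. M x $ i $ j)) (D j) +
       L2_mult \<Omega> (\<lambda>x. M x $ i $ j) (weak_deriv \<Omega> (axis i 1) (D j)))" for i j
      by (rule has_weak_deriv_mult[OF \<Omega> U(1) M ax has_weak_deriv_weak_deriv[OF DH1 ax]])
    from has_weak_deriv_sum[OF open_domain this]
    have "\<exists>g. has_weak_deriv \<Omega> (axis i 1) (F i) g" for i unfolding F_def by (rule exI)
    hence F: "has_weak_deriv \<Omega> (axis i 1) (F i) (weak_deriv \<Omega> (axis i 1) (F i))" for i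
      using weak_deriv_eqI by metis
    have parts: "inner (weak_deriv \<Omega> (axis i 1) (F i)) v = - inner (F i) (D i)" for i
      unfolding D_def by (rule inner_weak_deriv_H10[OF F v10 ax])
    have av: "0 \<le> inner (L2_mult \<Omega> a\<^sub>0 v) v"
      unfolding inner_L2_mult(1)[OF \<Omega> a]
      by (rule Bochner_Integration.integral_nonneg) (auto simp: indicator_def a_nonneg mult.assoc intro!: mult_nonneg_nonneg)
    have D_on: "D j \<in> L2_on \<Omega>" for j using DH1 by (simp add: H1_def)
    have z: "AE x in lborel. \<forall>j. x \<notin> \<Omega> \<longrightarrow> rep_L2 (D j) x = 0"
      unfolding AE_all_countable using D_on by (simp add: L2_on_def)
    have sq: "integrable lborel (\<lambda>x. (rep_L2 (D i) x)\<^sup>2)" for i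
      using sq_integrable_rep_L2 by (simp add: sq_integrable_def)
    have "c * (\<Sum>i\<in>UNIV. (norm (D i))\<^sup>2) = (\<integral>x. c * (\<Sum>i\<in>UNIV. (rep_L2 (D i) x)\<^sup>2) \<partial>lborel)"
      unfolding norm_rep_L2 Bochner_Integration.integral_sum[OF sq, symmetric] by simp
    also have "\<dots> \<le> (\<integral>x. (\<Sum>i\<in>UNIV. \<Sum>j\<in>UNIV. indicator \<Omega> x * M x $ i $ j * rep_L2 (D j) x * rep_L2 (D i) x) \<partial>lborel)"
    proof (rule integral_mono_AE)
      show "integrable lborel (\<lambda>x. c * (\<Sum>i\<in>UNIV. (rep_L2 (D i) x)\<^sup>2))"
        by (intro integrable_mult_right Bochner_Integration.integrable_sum sq)
      show "integrable lborel (\<lambda>x. \<Sum>i\<in>UNIV. \<Sum>j\<in>UNIV. indicator \<Omega> x * M x $ i $ j * rep_L2 (D j) x * rep_L2 (D i) x)"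
        by (intro Bochner_Integration.integrable_sum inner_L2_mult(2)[OF \<Omega> M])
      show "AE x in lborel. c * (\<Sum>i\<in>UNIV. (rep_L2 (D i) x)\<^sup>2) \<le>
         (\<Sum>i\<in>UNIV. \<Sum>j\<in>UNIV. indicator \<Omega> x * M x $ i $ j * rep_L2 (D j) x * rep_L2 (D i) x)"
        using z
      proof eventually_elim
        case (elim x)
        show ?case
        proof (cases "x \<in> \<Omega>")
          case True
          define \<xi> :: "real^'n" where "\<xi> = (\<chi> i. rep_L2 (D i) x)"
          have "(norm \<xi>)\<^sup>2 = (\<Sum>i\<in>UNIV. (rep_L2 (D i) x)\<^sup>2)"
            unfolding power2_norm_eq_inner inner_vec_def by (simp add: \<xi>_def power2_eq_square)
          moreover have "inner \<xi> (M x *v \<xi>) = (\<Sum>i\<in>UNIV. \<Sum>j\<in>UNIV. indicator \<Omega> x * M x $ i $ j * rep_L2 (D j) x * rep_L2 (D i) x)"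
            using True by (simp add: inner_vec_def matrix_vector_mult_def \<xi>_def sum_distrib_left sum_distrib_right mult_ac)
          ultimately show ?thesis using c(2)[OF True, of \<xi>] by simp
        qed (use elim in simp)
      qed
    qed
    also have "\<dots> = (\<Sum>i\<in>UNIV. inner (F i) (D i))"
      unfolding F_def inner_sum_left inner_L2_mult(1)[OF \<Omega> M]
      by (simp add: Bochner_Integration.integral_sum inner_L2_mult(2)[OF \<Omega> M])
    also have "\<dots> \<le> inner (ell_op \<Omega> M a\<^sub>0 v) v"
      using av parts unfolding ell_op_def F_def[symmetric] D_def[symmetric]
      by (simp add: inner_diff_left inner_add_left inner_sum_left sum_negf)
    also have "(\<Sum>i\<in>UNIV. (norm (D i))\<^sup>2) = (\<Sum>b\<in>Basis. (norm (weak_deriv \<Omega> b v))\<^sup>2)"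
    proof -
      have basis: "(Basis :: (real^'n) set) = range (\<lambda>i. axis i 1)" by (auto simp: Basis_vec_def)
      have inj: "inj (\<lambda>i::'n. axis i (1::real))" by (auto simp: inj_on_def axis_eq_axis)
      show ?thesis unfolding basis sum.reindex[OF inj] by (simp add: D_def)
    qed
    finally show ?thesis .
  qed
  with c(1) show ?thesis by (rule that)
qed

section \<open>The damped wave equation in a Hilbert space\<close>

lemma has_real_derivative_inner:
  fixes f g :: "real \<Rightarrow> 'h::real_inner"
  assumes "(f has_vector_derivative f') (at t within S)" "(g has_vector_derivative g') (at t within S)"
  shows "((\<lambda>t. inner (f t) (g t)) has_real_derivative (inner (f t) g' + inner f' (g t))) (at t within S)"
proof -
  have "(\<lambda>h. inner (f t) (h *\<^sub>R g') + inner (h *\<^sub>R f') (g t)) = (*) (inner (f t) g' + inner f' (g t))"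
    by (auto simp: fun_eq_iff algebra_simps)
  thus ?thesis
    using has_derivative_inner[OF assms[unfolded has_vector_derivative_def]]
    by (simp only: has_field_derivative_def)
qed

lemma has_real_derivative_inner_left:
  fixes f :: "real \<Rightarrow> 'h::real_inner"
  assumes "(f has_vector_derivative f') (at t within S)"
  shows "((\<lambda>t. inner (f t) w) has_real_derivative inner f' w) (at t within S)"
  using has_real_derivative_inner[OF assms has_vector_derivative_const[of w]] by simp

lemma has_vector_derivative_quotient:
  fixes f :: "real \<Rightarrow> 'h::real_normed_vector"
  assumes "(f has_vector_derivative D) (at t within S)"
  shows "((\<lambda>s. (1 / (s - t)) *\<^sub>R (f s - f t)) \<longlongrightarrow> D) (at t within S)"
proof -
  have "((\<lambda>s. norm (f s - f t - (s - t) *\<^sub>R D) / norm (s - t)) \<longlongrightarrow> 0) (at t within S)"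
    using assms unfolding has_vector_derivative_def has_derivative_iff_norm by simp
  moreover have "eventually (\<lambda>s. norm (f s - f t - (s - t) *\<^sub>R D) / norm (s - t)
      = norm ((1 / (s - t)) *\<^sub>R (f s - f t) - D)) (at t within S)"
    using eventually_neq_at_within[of t t S]
  proof eventually_elim
    case (elim s)
    have "(1 / (s - t)) *\<^sub>R (f s - f t) - D = (1 / (s - t)) *\<^sub>R (f s - f t - (s - t) *\<^sub>R D)"
      using elim by (simp add: scaleR_diff_right)
    thus ?case by (simp add: divide_inverse mult.commute)
  qed
  ultimately have "((\<lambda>s. norm ((1 / (s - t)) *\<^sub>R (f s - f t) - D)) \<longlongrightarrow> 0) (at t within S)"
    by (rule Lim_transform_eventually)
  thus ?thesis by (rule LIM_zero_cancel[OF tendsto_norm_zero_cancel])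
qed

lemma AE_lebesgue_on_negligible:
  fixes S :: "'a::euclidean_space set"
  assumes "AE t in lebesgue_on S. P t" "S \<in> sets lebesgue"
  obtains N where "negligible N" "\<And>t. t \<in> S \<Longrightarrow> t \<notin> N \<Longrightarrow> P t"
proof -
  have "AE t in lebesgue. t \<in> S \<longrightarrow> P t"
    using assms by (simp add: AE_restrict_space_iff)
  then obtain N where "N \<in> null_sets lebesgue" "{t \<in> space lebesgue. \<not> (t \<in> S \<longrightarrow> P t)} \<subseteq> N"
    unfolding eventually_ae_filter by blast
  thus ?thesis
    using that[of N] by (auto simp: negligible_iff_null_sets)
qed

text \<open>Bounds and memberships that hold for almost every time extend to all times, by continuity and
  through closed conditions.\<close>

lemma closure_diff_negligible:
  fixes N :: "real set"
  assumes "negligible N" "0 < T" "t \<in> {0..T}"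
  shows "t \<in> closure ({0<..<T} - N)"
proof (rule ccontr)
  assume "t \<notin> closure ({0<..<T} - N)"
  moreover define V where "V = - closure ({0<..<T} - N)"
  ultimately have V: "open V" "t \<in> V" by auto
  have "t \<in> closure {0<..<T}" using assms by simp
  hence "V \<inter> {0<..<T} \<noteq> {}"
    using V open_Int_closure_eq_empty[of V "{0<..<T}"] by auto
  moreover have "V \<inter> {0<..<T} \<subseteq> N"
    using closure_subset[of "{0<..<T} - N"] by (auto simp: V_def)
  hence "negligible (V \<inter> {0<..<T})" using assms(1) negligible_subset by blast
  ultimately show False
    using open_not_negligible[of "V \<inter> {0<..<T}"] open_Int[OF V(1) open_greaterThanLessThan] by blast
qed

lemma zero_derivative_const_atLeast:
  fixes f :: "real \<Rightarrow> real"
  assumes "\<And>t. 0 \<le> t \<Longrightarrow> (f has_real_derivative 0) (at t within {0..})" "0 \<le> t"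
  shows "f t = f 0"
proof -
  have "\<exists>c. \<forall>x\<in>{0..}. f x = c"
    by (rule has_field_derivative_zero_constant) (use assms(1) in auto)
  thus ?thesis using assms(2) by auto
qed

lemma at_within_atLeastAtMost_eq:
  "0 \<le> t \<Longrightarrow> t < T \<Longrightarrow> at t within {0..T} = at (t::real) within {0..}"
  by (rule at_within_nhd[of _ "{..<T}"]) auto

text \<open>Here \<open>p\<close>, \<open>n\<close>, \<open>x\<close> and \<open>b\<close> stand for $\|v'\|$, $\|v\|$, $(v',v)$ and $(Av,v)$, and the left-hand side is
  $F'+2\delta F$. Since $\delta b\ge 6\delta^2\alpha n^2$, it is at most
  $-(\alpha-\frac52\delta)p^2 + 3\delta^2pn - \frac32\delta^2\alpha n^2$, which
  $3\delta\le\alpha$ bounds by $-\frac\alpha6(p-3\delta n)^2$.\<close>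

lemma lyapunov_decay:
  fixes \<alpha> \<delta> lam p n x b :: real
  assumes "0 < \<delta>" "3 * \<delta> \<le> \<alpha>" "6 * \<delta> * \<alpha> \<le> lam" "lam * n\<^sup>2 \<le> b" "\<bar>x\<bar> \<le> p * n" "0 \<le> p" "0 \<le> n"
  shows "- \<alpha> * p\<^sup>2 + 3 / 2 * \<delta> * (p\<^sup>2 - b)
    + 2 * \<delta> * (1 / 2 * (p\<^sup>2 + b) + 3 / 2 * \<delta> * x + 3 / 4 * \<delta> * \<alpha> * n\<^sup>2) \<le> 0"
proof -
  have "6 * \<delta> * \<alpha> * n\<^sup>2 \<le> lam * n\<^sup>2" using assms by (intro mult_right_mono) auto
  hence "6 * \<delta> * \<alpha> * n\<^sup>2 \<le> b" using assms by linarith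
  hence 1: "\<delta> * (6 * \<delta> * \<alpha> * n\<^sup>2) \<le> \<delta> * b" using assms by (intro mult_left_mono) auto
  have "\<delta> * \<delta> * x \<le> \<delta> * \<delta> * (p * n)" using assms by (intro mult_left_mono) auto
  also have "(3 * \<delta>) * (\<delta> * p * n) \<le> \<alpha> * (\<delta> * p * n)"
    using assms by (intro mult_right_mono) auto
  hence "\<delta> * \<delta> * (p * n) \<le> \<alpha> * (\<delta> * p * n) / 3" by simp
  finally have 2: "\<delta> * \<delta> * x \<le> \<alpha> * (\<delta> * p * n) / 3" .
  have "0 \<le> \<alpha> * (p - 3 * \<delta> * n)\<^sup>2" using assms by simp
  hence 3: "6 * (\<alpha> * (\<delta> * p * n)) \<le> \<alpha> * p\<^sup>2 + 9 * (\<delta> * \<delta> * \<alpha> * n\<^sup>2)"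
    by (simp add: power2_eq_square algebra_simps)
  have "(3 * \<delta>) * p\<^sup>2 \<le> \<alpha> * p\<^sup>2" using assms by (intro mult_right_mono) auto
  hence 4: "\<delta> * p\<^sup>2 \<le> \<alpha> * p\<^sup>2 / 3" by simp
  have "- \<alpha> * p\<^sup>2 + 3 / 2 * \<delta> * (p\<^sup>2 - b)
      + 2 * \<delta> * (1 / 2 * (p\<^sup>2 + b) + 3 / 2 * \<delta> * x + 3 / 4 * \<delta> * \<alpha> * n\<^sup>2)
    = - (\<alpha> * p\<^sup>2) + 5 / 2 * (\<delta> * p\<^sup>2) - 1 / 2 * (\<delta> * b) + 3 * (\<delta> * \<delta> * x) + 3 / 2 * (\<delta> * \<delta> * \<alpha> * n\<^sup>2)"
    by (simp add: field_simps)
  moreover have "\<delta> * (6 * \<delta> * \<alpha> * n\<^sup>2) = 6 * (\<delta> * \<delta> * \<alpha> * n\<^sup>2)" by simp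
  ultimately show ?thesis using 1 2 3 4 by linarith
qed

text \<open>The cross term is absorbed by
  $2\delta pn\le\frac\delta\alpha p^2+\delta\alpha n^2$, with $\frac\delta\alpha\le\frac13$ and
  $6\delta\alpha n^2\le b$.\<close>

lemma lyapunov_equivalent:
  fixes \<alpha> \<delta> lam p n x b :: real
  assumes "0 < \<delta>" "3 * \<delta> \<le> \<alpha>" "6 * \<delta> * \<alpha> \<le> lam" "lam * n\<^sup>2 \<le> b" "\<bar>x\<bar> \<le> p * n" "0 \<le> p" "0 \<le> n"
  defines "F \<equiv> 1 / 2 * (p\<^sup>2 + b) + 3 / 2 * \<delta> * x + 3 / 4 * \<delta> * \<alpha> * n\<^sup>2"
  shows "1 / 4 * (p\<^sup>2 + b) \<le> F" "F \<le> 3 / 4 * (p\<^sup>2 + b)"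
proof -
  have \<alpha>: "0 < \<alpha>" using assms by linarith
  have "6 * \<delta> * \<alpha> * n\<^sup>2 \<le> lam * n\<^sup>2" using assms by (intro mult_right_mono) auto
  hence b: "6 * (\<delta> * \<alpha> * n\<^sup>2) \<le> b" using assms by linarith
  have "0 \<le> \<delta> / \<alpha> * (p - \<alpha> * n)\<^sup>2" using assms \<alpha> by simp
  also have "\<dots> = \<delta> / \<alpha> * p\<^sup>2 + \<delta> * \<alpha> * n\<^sup>2 - 2 * (\<delta> * (p * n))"
    using \<alpha> by (simp add: power2_eq_square field_simps)
  finally have y: "2 * (\<delta> * (p * n)) \<le> \<delta> / \<alpha> * p\<^sup>2 + \<delta> * \<alpha> * n\<^sup>2" by simp
  have "\<delta> / \<alpha> * p\<^sup>2 \<le> 1 / 3 * p\<^sup>2" using assms \<alpha> by (intro mult_right_mono) (auto simp: field_simps)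
  with y have y: "2 * (\<delta> * (p * n)) \<le> 1 / 3 * p\<^sup>2 + \<delta> * \<alpha> * n\<^sup>2" by linarith
  have x: "\<bar>\<delta> * x\<bar> \<le> \<delta> * (p * n)" using assms by (simp add: abs_mult)
  have nn: "0 \<le> \<delta> * \<alpha> * n\<^sup>2" "0 \<le> p\<^sup>2" using assms \<alpha> by simp_all
  show "1 / 4 * (p\<^sup>2 + b) \<le> F" "F \<le> 3 / 4 * (p\<^sup>2 + b)"
    unfolding F_def using b x y nn by argo+
qed

lemma nonincreasing_on_atLeast:
  fixes f :: "real \<Rightarrow> real"
  assumes "\<And>t. 0 \<le> t \<Longrightarrow> (f has_real_derivative f' t) (at t within {0..})"
    "\<And>t. 0 \<le> t \<Longrightarrow> f' t \<le> 0" "0 \<le> t"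
  shows "f t \<le> f 0"
proof (cases "t = 0")
  case False
  show ?thesis
  proof (rule DERIV_nonpos_imp_decreasing_open[of 0 t f])
    fix x assume x: "0 < x" "x < t"
    have "at x within {0..} = at x"
      by (rule at_within_interior) (use x in auto)
    with assms(1)[of x] assms(2)[of x] x
    show "\<exists>y. (f has_real_derivative y) (at x) \<and> y \<le> 0" by auto
  next
    have "continuous_on {0..} f"
      by (rule DERIV_continuous_on[of _ _ f']) (use assms(1) in auto)
    thus "continuous_on {0..t} f" by (rule continuous_on_subset) auto
  qed (use assms(3) False in auto)
qed simp

text \<open>The abstract setting, with \<open>B\<close> the square root of \<open>A\<close>. The subspace \<open>H\<close> is presented as an orthogonal
  complement: this makes it closed, and a time integral of an \<open>H\<close>-valued function is in \<open>H\<close> because the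
  scalar products with the vectors of \<open>G\<close> vanish.\<close>

locale damped_wave =
  fixes H D DB :: "'h::{real_inner,banach} set" and A B :: "'h \<Rightarrow> 'h"
    and \<alpha> lam :: real and u u' u'' :: "real \<Rightarrow> 'h" and G :: "'h set"
  assumes H: "H = {y. \<forall>g\<in>G. inner y g = 0}"
    and selfadjoint: "selfadjoint_op H D A"
    and sqrt: "is_sqrt_op H D A DB B"
    and coercive: "v \<in> D \<Longrightarrow> lam * (norm v)\<^sup>2 \<le> inner (A v) v"
    and cont: "continuous_on {0..} u" "continuous_on {0..} u'"
    and Linfty: "0 < T \<Longrightarrow> Linfty T D A u" "0 < T \<Longrightarrow> Linfty T DB B u'"
    and weak: "0 < T \<Longrightarrow> has_weak_time_deriv T u u'" "0 < T \<Longrightarrow> has_weak_time_deriv T u' u''"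
    and eq: "AE t in lebesgue_on {0<..}. u'' t + \<alpha> *\<^sub>R u' t + A (u t) = 0"
begin

lemmas D = selfadjoint_opD[OF selfadjoint]

lemma selfadjoint_B: "selfadjoint_op H DB B"
  using sqrt by (simp add: is_sqrt_op_def)

lemmas DB = selfadjoint_opD[OF selfadjoint_B]

lemma sqrtD: "D \<subseteq> DB" "v \<in> D \<Longrightarrow> B v \<in> DB" "v \<in> D \<Longrightarrow> A v = B (B v)"
  using sqrt unfolding is_sqrt_op_def by auto

lemma A_diff: "v \<in> D \<Longrightarrow> w \<in> D \<Longrightarrow> A (v - w) = A v - A w"
  using D(5)[of v "(-1) *\<^sub>R w"] D(6)[of w "-1"] subspace_scale[OF D(1), of w "-1"] by simp

lemma B_diff: "v \<in> DB \<Longrightarrow> w \<in> DB \<Longrightarrow> B (v - w) = B v - B w"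
  using DB(5)[of v "(-1) *\<^sub>R w"] DB(6)[of w "-1"] subspace_scale[OF DB(1), of w "-1"] by simp

lemma inner_A_eq_norm_B: "v \<in> D \<Longrightarrow> inner (A v) v = (norm (B v))\<^sup>2"
  using sqrtD DB(7)[of "B v" v] by (auto simp: power2_norm_eq_inner)

lemma subspace_H: "subspace H"
  by (auto simp: H subspace_def inner_add_left)

lemma closed_H: "closed H"
proof -
  have "H = (\<Inter>g\<in>G. {y. inner y g = 0})" by (auto simp: H)
  moreover have "closed \<dots>" by (intro closed_INT ballI closed_Collect_eq continuous_intros)
  ultimately show ?thesis by simp
qed

text \<open>The inequality extends from \<open>D\<close> to its closure, which contains \<open>x\<close> itself.\<close>

lemma norm_le_of_dense:
  assumes "0 \<le> L" "x \<in> H" "\<And>w. w \<in> D \<Longrightarrow> \<bar>inner x w\<bar> \<le> L * norm w"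
  shows "norm x \<le> L"
proof (cases "x = 0")
  case False
  have "\<bar>inner x w\<bar> - L * norm w \<le> 0" if "w \<in> closure D" for w
    by (rule continuous_le_on_closure[OF _ that]) (use assms(3) in \<open>auto intro!: continuous_intros\<close>)
  from this[of x] have "norm x * norm x \<le> L * norm x"
    using D(3) assms(2) by (auto simp: power2_norm_eq_inner[symmetric] power2_eq_square)
  thus ?thesis using False by simp
qed (use assms in simp)

lemma eq_0_of_orthogonal_D:
  assumes "x \<in> H" "\<And>w. w \<in> D \<Longrightarrow> inner x w = 0"
  shows "x = 0"
  using norm_le_of_dense[of 0 x] assms by simp

lemma eq_0_of_orthogonal_DB:
  assumes "x \<in> H" "\<And>w. w \<in> DB \<Longrightarrow> inner x w = 0"
  shows "x = 0"
  using eq_0_of_orthogonal_D[of x] assms sqrtD(1) by blast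

lemma good_times:
  assumes "0 < T"
  obtains C N where "negligible N" "\<And>t. t \<in> {0<..<T} \<Longrightarrow> t \<notin> N \<Longrightarrow>
     u t \<in> D \<and> norm (A (u t)) \<le> C \<and> u' t \<in> DB \<and> u'' t + \<alpha> *\<^sub>R u' t + A (u t) = 0"
proof -
  obtain C where C: "AE t in lebesgue_on {0<..<T}. u t \<in> D \<and> norm (u t) + norm (A (u t)) \<le> C"
    using Linfty(1)[OF assms] by (auto simp: Linfty_def)
  obtain C' where C': "AE t in lebesgue_on {0<..<T}. u' t \<in> DB \<and> norm (u' t) + norm (B (u' t)) \<le> C'"
    using Linfty(2)[OF assms] by (auto simp: Linfty_def)
  obtain N1 where N1: "negligible N1" "\<And>t. t \<in> {0<..<T} \<Longrightarrow> t \<notin> N1 \<Longrightarrow> u t \<in> D \<and> norm (u t) + norm (A (u t)) \<le> C"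
    by (rule AE_lebesgue_on_negligible[OF C]) auto
  obtain N2 where N2: "negligible N2" "\<And>t. t \<in> {0<..<T} \<Longrightarrow> t \<notin> N2 \<Longrightarrow> u' t \<in> DB \<and> norm (u' t) + norm (B (u' t)) \<le> C'"
    by (rule AE_lebesgue_on_negligible[OF C']) auto
  obtain N3 where N3: "negligible N3" "\<And>t. t \<in> {0<..} \<Longrightarrow> t \<notin> N3 \<Longrightarrow> u'' t + \<alpha> *\<^sub>R u' t + A (u t) = 0"
    by (rule AE_lebesgue_on_negligible[OF eq]) auto
  show ?thesis
  proof (rule that[of "N1 \<union> N2 \<union> N3" C])
    show "negligible (N1 \<union> N2 \<union> N3)" using N1 N2 N3 by (intro negligible_Un)
    fix t assume t: "t \<in> {0<..<T}" "t \<notin> N1 \<union> N2 \<union> N3"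
    have "u t \<in> D" "norm (u t) + norm (A (u t)) \<le> C" using N1(2)[of t] t by auto
    moreover from this(2) have "norm (A (u t)) \<le> C" using norm_ge_zero[of "u t"] by linarith
    moreover have "u' t \<in> DB" using N2(2)[of t] t by auto
    moreover have "u'' t + \<alpha> *\<^sub>R u' t + A (u t) = 0" using N3(2)[of t] t by auto
    ultimately show "u t \<in> D \<and> norm (A (u t)) \<le> C \<and> u' t \<in> DB \<and> u'' t + \<alpha> *\<^sub>R u' t + A (u t) = 0"
      by blast
  qed
qed

lemma cont_T: "continuous_on {0..T} u" "continuous_on {0..T} u'"
  using cont by (auto elim: continuous_on_subset)

lemma weak_inner:
  assumes "has_weak_time_deriv T f g" "\<phi> \<in> test_functions {0<..<T}"
  shows "\<exists>I. ((\<lambda>t. deriv \<phi> t * inner (f t) w) has_integral I) {0..T} \<and>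
     ((\<lambda>t. \<phi> t * inner (g t) w) has_integral - I) {0..T}"
proof -
  obtain I where I: "((\<lambda>t. deriv \<phi> t *\<^sub>R f t) has_integral I) {0..T}" "((\<lambda>t. \<phi> t *\<^sub>R g t) has_integral - I) {0..T}"
    using assms unfolding has_weak_time_deriv_def by blast
  from has_integral_linear[OF I(1) bounded_linear_inner_left[of w]]
    has_integral_linear[OF I(2) bounded_linear_inner_left[of w]]
  show ?thesis by (intro exI[of _ "inner I w"]) (simp add: o_def)
qed

lemma inner_u_derivative:
  assumes t: "0 \<le> t"
  shows "((\<lambda>t. inner (u t) w) has_real_derivative inner (u' t) w) (at t within {0..})"
proof -
  have "((\<lambda>t. inner (u t) w) has_real_derivative inner (u' t) w) (at t within {0..t+1})"
    using t by (intro has_derivative_of_weak_deriv weak_inner[OF weak(1)] continuous_intros cont_T) auto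
  thus ?thesis using t by (simp add: at_within_atLeastAtMost_eq)
qed

text \<open>Pairing with \<open>w\<close> in the domain moves \<open>A\<close> to \<open>w\<close>, so that the right-hand side becomes a continuous
  function of time and du Bois-Reymond applies.\<close>

lemma inner_u'_derivative:
  assumes w: "w \<in> D" and t: "0 \<le> t"
  shows "((\<lambda>t. inner (u' t) w) has_real_derivative (- (\<alpha> * inner (u' t) w + inner (u t) (A w)))) (at t within {0..})"
proof -
  let ?T = "t + 1"
  have T: "0 < ?T" using t by simp
  obtain C N where N: "negligible N" "\<And>t. t \<in> {0<..<?T} \<Longrightarrow> t \<notin> N \<Longrightarrow>
     u t \<in> D \<and> norm (A (u t)) \<le> C \<and> u' t \<in> DB \<and> u'' t + \<alpha> *\<^sub>R u' t + A (u t) = 0"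
    using good_times[OF T] by metis
  have q: "inner (u'' s) w = - (\<alpha> * inner (u' s) w + inner (u s) (A w))" if "s \<in> {0<..<?T}" "s \<notin> N" for s
  proof -
    have "inner (u'' s + \<alpha> *\<^sub>R u' s + A (u s)) w = 0" "u s \<in> D" using N(2)[OF that] by auto
    thus ?thesis using D(7)[of "u s" w] w by (simp add: inner_add_left)
  qed
  have "((\<lambda>t. inner (u' t) w) has_real_derivative (- (\<alpha> * inner (u' t) w + inner (u t) (A w)))) (at t within {0..?T})"
  proof (rule has_derivative_of_weak_deriv)
    fix \<phi> assume "\<phi> \<in> test_functions {0<..<?T}"
    from weak_inner[OF weak(2)[OF T] this] obtain I where
      I: "((\<lambda>t. deriv \<phi> t * inner (u' t) w) has_integral I) {0..?T}"
         "((\<lambda>t. \<phi> t * inner (u'' t) w) has_integral - I) {0..?T}" by blast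
    have "((\<lambda>t. \<phi> t * (- (\<alpha> * inner (u' t) w + inner (u t) (A w)))) has_integral - I) {0..?T}"
    proof (rule has_integral_spike[OF _ _ I(2)])
      show "negligible (N \<union> {0, ?T})" using negligible_Un[OF N(1) negligible_finite[of "{0, ?T}"]] by simp
      fix s assume "s \<in> {0..?T} - (N \<union> {0, ?T})"
      thus "\<phi> s * (- (\<alpha> * inner (u' s) w + inner (u s) (A w))) = \<phi> s * inner (u'' s) w"
        using q[of s] by auto
    qed
    with I(1) show "\<exists>I. ((\<lambda>t. deriv \<phi> t * inner (u' t) w) has_integral I) {0..?T} \<and>
      ((\<lambda>t. \<phi> t * (- (\<alpha> * inner (u' t) w + inner (u t) (A w)))) has_integral - I) {0..?T}" by blast
  qed (use t in \<open>auto intro!: continuous_intros cont_T\<close>)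
  thus ?thesis using t by (simp add: at_within_atLeastAtMost_eq)
qed

text \<open>Each scalar function $(u,w)$ is continuously differentiable, hence \<open>u\<close> coincides with the integral of \<open>u'\<close>,
  which is differentiable in norm.\<close>

lemma u_derivative:
  assumes t: "0 \<le> t"
  shows "(u has_vector_derivative u' t) (at t within {0..})"
proof -
  define U where "U t = u 0 + integral {0..t} u'" for t
  have U: "(U has_vector_derivative u' t) (at t within {0..})" if t: "0 \<le> t" for t
  proof -
    have "(U has_vector_derivative u' t) (at t within {0..t+1})"
      unfolding U_def using t integral_has_vector_derivative[OF cont_T(2), of t "t+1"]
      by (auto intro!: derivative_eq_intros)
    thus ?thesis using t by (simp add: at_within_atLeastAtMost_eq)
  qed
  have "u t = U t" if t: "0 \<le> t" for t
  proof -
    have "inner (u t) w - inner (U t) w = inner (u 0) w - inner (U 0) w" for w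
    proof (rule zero_derivative_const_atLeast[OF _ t])
      fix s :: real assume s: "0 \<le> s"
      show "((\<lambda>t. inner (u t) w - inner (U t) w) has_real_derivative 0) (at s within {0..})"
        using DERIV_diff[OF inner_u_derivative[OF s, of w] has_real_derivative_inner_left[OF U[OF s], of w]] by simp
    qed
    hence "inner (u t - U t) (u t - U t) = 0" by (simp add: U_def inner_diff_left)
    thus ?thesis by simp
  qed
  with has_vector_derivative_transform[of t "{0..}" u U "u' t"] U[OF t] t show ?thesis by auto
qed

lemma closed_dense_times:
  fixes T :: real
  assumes "continuous_on {0..T} f" "closed S" "negligible N" "0 < T" "t \<in> {0..T}"
    "\<And>t. t \<in> {0<..<T} \<Longrightarrow> t \<notin> N \<Longrightarrow> f t \<in> S"
  shows "f t \<in> S"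
proof -
  have "{0<..<T} - N \<subseteq> {0..T}" by auto
  hence "closure ({0<..<T} - N) \<subseteq> {0..T}" by (rule closure_minimal) (rule closed_atLeastAtMost)
  hence "f ` closure ({0<..<T} - N) \<subseteq> S"
    using assms by (intro image_closure_subset) (auto intro: continuous_on_subset)
  thus ?thesis using closure_diff_negligible[OF assms(3-5)] by auto
qed

lemma u_in_H:
  assumes t: "0 \<le> t"
  shows "u t \<in> H" "u' t \<in> H"
proof -
  have T: "0 < t + 1" using t by simp
  obtain C N where N: "negligible N" "\<And>s. s \<in> {0<..<t + 1} \<Longrightarrow> s \<notin> N \<Longrightarrow>
     u s \<in> D \<and> norm (A (u s)) \<le> C \<and> u' s \<in> DB \<and> u'' s + \<alpha> *\<^sub>R u' s + A (u s) = 0"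
    using good_times[OF T] by metis
  show "u t \<in> H"
    by (rule closed_dense_times[OF cont_T(1) closed_H N(1) T]) (use N D(2) t in auto)
  show "u' t \<in> H"
    by (rule closed_dense_times[OF cont_T(2) closed_H N(1) T]) (use N DB(2) t in auto)
qed

text \<open>In the derivative of $(u',w)$ the term $(u,Aw)=(Au,w)$ is at most a constant times $\|w\|$ at almost
  every time, and at all times by continuity.\<close>

lemma u'_Lipschitz:
  assumes T: "0 < T"
  obtains K where "\<And>s t. s \<in> {0..T} \<Longrightarrow> t \<in> {0..T} \<Longrightarrow> norm (u' s - u' t) \<le> K * \<bar>s - t\<bar>"
proof -
  obtain C N where N: "negligible N" "\<And>s. s \<in> {0<..<T} \<Longrightarrow> s \<notin> N \<Longrightarrow>
     u s \<in> D \<and> norm (A (u s)) \<le> C \<and> u' s \<in> DB \<and> u'' s + \<alpha> *\<^sub>R u' s + A (u s) = 0"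
    using good_times[OF T] by metis
  have "bounded (u' ` {0..T})"
    by (intro compact_imp_bounded compact_continuous_image cont_T) auto
  then obtain C' where "\<forall>x\<in>u' ` {0..T}. norm x \<le> C'" unfolding bounded_iff by blast
  hence C': "\<And>t. t \<in> {0..T} \<Longrightarrow> norm (u' t) \<le> C'" by blast
  define K where "K = \<bar>\<alpha>\<bar> * C' + C"
  have K: "\<bar>\<alpha> * inner (u' t) w + inner (u t) (A w)\<bar> \<le> K * norm w" if w: "w \<in> D" and t: "t \<in> {0..T}" for t w
  proof -
    have "\<alpha> * inner (u' t) w + inner (u t) (A w) \<in> {- (K * norm w)..K * norm w}"
    proof (rule closed_dense_times[OF _ closed_atLeastAtMost N(1) T t])
      fix s assume s: "s \<in> {0<..<T}" "s \<notin> N"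
      have "\<bar>inner (u s) (A w)\<bar> = \<bar>inner (A (u s)) w\<bar>" using D(7)[of "u s" w] N(2)[OF s] w by auto
      also have "\<dots> \<le> norm (A (u s)) * norm w" by (rule Cauchy_Schwarz_ineq2)
      also have "\<dots> \<le> C * norm w" using N(2)[OF s] by (intro mult_right_mono) auto
      finally have 1: "\<bar>inner (u s) (A w)\<bar> \<le> C * norm w" .
      have "\<bar>inner (u' s) w\<bar> \<le> norm (u' s) * norm w" by (rule Cauchy_Schwarz_ineq2)
      also have "\<dots> \<le> C' * norm w" using C'[of s] s by (intro mult_right_mono) auto
      finally have "\<bar>\<alpha>\<bar> * \<bar>inner (u' s) w\<bar> \<le> \<bar>\<alpha>\<bar> * (C' * norm w)" by (intro mult_left_mono) auto
      with 1 have "\<bar>\<alpha> * inner (u' s) w\<bar> + \<bar>inner (u s) (A w)\<bar> \<le> K * norm w"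
        by (simp add: K_def abs_mult distrib_right)
      thus "\<alpha> * inner (u' s) w + inner (u s) (A w) \<in> {- (K * norm w)..K * norm w}"
        by (simp only: atLeastAtMost_iff) arith
    qed (intro continuous_intros cont_T)
    thus ?thesis by (simp add: abs_le_iff)
  qed
  have "norm (u' s - u' t) \<le> \<bar>K\<bar> * \<bar>s - t\<bar>" if s: "s \<in> {0..T}" and t: "t \<in> {0..T}" for s t
  proof (rule norm_le_of_dense)
    show "u' s - u' t \<in> H" using s t u_in_H(2) by (intro subspace_diff subspace_H) auto
    fix w assume w: "w \<in> D"
    have "norm (inner (u' s) w - inner (u' t) w) \<le> (K * norm w) * norm (s - t)"
    proof (rule field_differentiable_bound[of "{0..T}"])
      fix z assume z: "z \<in> {0..T}"
      show "((\<lambda>t. inner (u' t) w) has_field_derivative - (\<alpha> * inner (u' z) w + inner (u z) (A w))) (at z within {0..T})"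
        by (rule has_field_derivative_subset[OF inner_u'_derivative[OF w]]) (use z in auto)
      show "norm (- (\<alpha> * inner (u' z) w + inner (u z) (A w))) \<le> K * norm w"
        using K[OF w z] by simp
    qed (use s t in auto)
    also have "\<dots> \<le> (\<bar>K\<bar> * norm w) * norm (s - t)" by (intro mult_right_mono) auto
    finally show "\<bar>inner (u' s - u' t) w\<bar> \<le> \<bar>K\<bar> * \<bar>s - t\<bar> * norm w"
      by (simp add: inner_diff_left mult_ac)
  qed auto
  thus ?thesis by (rule that)
qed

text \<open>The identity $\|Bx\|^2=(Ax,x)$ makes the images a Cauchy sequence, and a self-adjoint operator is
  closed.\<close>

lemma B_tendsto:
  assumes x: "\<And>n. x n \<in> D" "\<And>n. norm (A (x n)) \<le> C" "x \<longlonglongrightarrow> y"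
  shows "(\<lambda>n. B (x n)) \<longlonglongrightarrow> B y"
proof -
  have xDB: "x n \<in> DB" for n using x sqrtD by blast
  have est: "(dist (B (x m)) (B (x n)))\<^sup>2 \<le> 2 * C * dist (x m) (x n)" for m n
  proof -
    have d: "x m - x n \<in> D" using x D(1) by (intro subspace_diff)
    have "(dist (B (x m)) (B (x n)))\<^sup>2 = inner (A (x m - x n)) (x m - x n)"
      using inner_A_eq_norm_B[OF d] B_diff xDB by (simp add: dist_norm)
    also have "\<dots> \<le> norm (A (x m - x n)) * norm (x m - x n)" by (rule norm_cauchy_schwarz)
    also have "norm (A (x m - x n)) \<le> C + C"
      unfolding A_diff[OF x(1) x(1)] by (rule order_trans[OF norm_triangle_ineq4 add_mono[OF x(2) x(2)]])
    hence "norm (A (x m - x n)) * norm (x m - x n) \<le> (C + C) * norm (x m - x n)"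
      by (intro mult_right_mono) auto
    finally show ?thesis by (simp add: dist_norm)
  qed
  have C: "0 \<le> C" using order_trans[OF norm_ge_zero x(2)[of 0]] .
  have "Cauchy (\<lambda>n. B (x n))"
  proof (rule metric_CauchyI)
    fix e :: real assume e: "0 < e"
    have "Cauchy x" using x(3) by (intro LIMSEQ_imp_Cauchy)
    then obtain M where M: "\<And>m n. m \<ge> M \<Longrightarrow> n \<ge> M \<Longrightarrow> dist (x m) (x n) < e\<^sup>2 / (2 * C + 1)"
      using e C unfolding Cauchy_def by (metis add_nonneg_pos divide_pos_pos mult_nonneg_nonneg zero_le_numeral zero_less_one zero_less_power)
    show "\<exists>M. \<forall>m\<ge>M. \<forall>n\<ge>M. dist (B (x m)) (B (x n)) < e"
    proof (intro exI allI impI)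
      fix m n assume mn: "M \<le> m" "M \<le> n"
      have "2 * C * dist (x m) (x n) \<le> (2 * C + 1) * dist (x m) (x n)" by (intro mult_right_mono) auto
      also have "\<dots> < (2 * C + 1) * (e\<^sup>2 / (2 * C + 1))" using M[OF mn] C by (intro mult_strict_left_mono) auto
      also have "\<dots> = e\<^sup>2" using C by simp
      finally have "(dist (B (x m)) (B (x n)))\<^sup>2 < e\<^sup>2" using est[of m n] by linarith
      thus "dist (B (x m)) (B (x n)) < e" by (rule power2_less_imp_less) (use e in simp)
    qed
  qed
  then obtain z where z: "(\<lambda>n. B (x n)) \<longlonglongrightarrow> z" by (auto simp: Cauchy_convergent_iff convergent_def)
  have yH: "y \<in> H" using closed_sequentially[OF closed_H _ x(3)] xDB DB(2) by blast
  have zH: "z \<in> H" using closed_sequentially[OF closed_H _ z] xDB DB(4) by blast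
  have yz: "inner (B v) y = inner v z" if v: "v \<in> DB" for v
  proof (rule LIMSEQ_unique)
    show "(\<lambda>n. inner (B v) (x n)) \<longlonglongrightarrow> inner (B v) y" by (intro tendsto_intros x)
    show "(\<lambda>n. inner (B v) (x n)) \<longlonglongrightarrow> inner v z"
      using tendsto_inner[OF tendsto_const z, of v] DB(7)[OF v xDB] by simp
  qed
  have yDB: "y \<in> DB" by (rule DB(8)[OF yH zH yz])
  have "B y - z = 0"
  proof (rule eq_0_of_orthogonal_DB)
    show "B y - z \<in> H" by (intro subspace_diff subspace_H DB(4) yDB zH)
    fix w assume "w \<in> DB"
    thus "inner (B y - z) w = 0" using yz[of w] DB(7)[OF yDB, of w] by (simp add: inner_diff_left inner_diff_right inner_commute)
  qed
  with z show ?thesis by simp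
qed

text \<open>The derivative of $(Av,v)$ is $2(Av,v')$ even when $v'$ is not in the domain of the square root: by symmetry
  $(Av(s),v(s))-(Av(t),v(t)) = (Av(s)+Av(t),v(s)-v(t))$.\<close>

lemma classical_decay:
  fixes v v' v'' :: "real \<Rightarrow> 'h"
  assumes \<delta>: "0 < \<delta>" "3 * \<delta> \<le> \<alpha>" "6 * \<delta> * \<alpha> \<le> lam"
    and v: "\<And>t. 0 \<le> t \<Longrightarrow> (v has_vector_derivative v' t) (at t within {0..})"
    and v': "\<And>t. 0 \<le> t \<Longrightarrow> (v' has_vector_derivative v'' t) (at t within {0..})"
    and v'': "continuous_on {0..} v''"
    and vD: "\<And>t. 0 \<le> t \<Longrightarrow> v t \<in> D"
    and ode: "\<And>t. 0 \<le> t \<Longrightarrow> v'' t + \<alpha> *\<^sub>R v' t + A (v t) = 0"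
    and t: "0 \<le> t"
  shows "(norm (v' t))\<^sup>2 + inner (A (v t)) (v t) \<le> 3 * exp (- 2 * \<delta> * t) * ((norm (v' 0))\<^sup>2 + inner (A (v 0)) (v 0))"
proof -
  have Av: "A (v t) = - (v'' t + \<alpha> *\<^sub>R v' t)" if "0 \<le> t" for t
    using ode[OF that] unfolding eq_neg_iff_add_eq_0 by (simp only: add.commute)
  have cv': "continuous_on {0..} v'"
    by (auto simp: continuous_on_eq_continuous_within intro: has_vector_derivative_continuous[OF v'])
  have cAv: "continuous_on {0..} (\<lambda>t. A (v t))"
  proof (rule continuous_on_eq)
    show "continuous_on {0..} (\<lambda>t. - (v'' t + \<alpha> *\<^sub>R v' t))" by (intro continuous_intros cv' v'')
  qed (use Av in auto)
  have e: "((\<lambda>t. inner (A (v t)) (v t)) has_real_derivative 2 * inner (A (v t)) (v' t)) (at t within {0..})"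
    if t: "0 \<le> t" for t
    unfolding has_field_derivative_iff
  proof (rule Lim_transform_within[OF _ zero_less_one])
    have "((\<lambda>s. A (v s)) \<longlongrightarrow> A (v t)) (at t within {0..})"
      using cAv t by (simp add: continuous_on)
    hence "((\<lambda>s. inner (A (v s) + A (v t)) ((1 / (s - t)) *\<^sub>R (v s - v t))) \<longlongrightarrow>
        inner (A (v t) + A (v t)) (v' t)) (at t within {0..})"
      by (intro tendsto_intros has_vector_derivative_quotient v t)
    thus "((\<lambda>s. inner (A (v s) + A (v t)) ((1 / (s - t)) *\<^sub>R (v s - v t))) \<longlongrightarrow>
        2 * inner (A (v t)) (v' t)) (at t within {0..})"
      by (simp add: inner_add_left)
    fix s :: real assume "s \<in> {0..}"
    hence "inner (A (v s)) (v t) = inner (A (v t)) (v s)"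
      using D(7)[OF vD vD, of s t] t by (simp add: inner_commute)
    thus "inner (A (v s) + A (v t)) ((1 / (s - t)) *\<^sub>R (v s - v t)) =
      (inner (A (v s)) (v s) - inner (A (v t)) (v t)) / (s - t)"
      by (simp add: inner_add_left inner_diff_right)
  qed
  define F where "F t = 1 / 2 * ((norm (v' t))\<^sup>2 + inner (A (v t)) (v t)) + 3 / 2 * \<delta> * inner (v' t) (v t)
     + 3 / 4 * \<delta> * \<alpha> * (norm (v t))\<^sup>2" for t
  define F' where "F' t = - \<alpha> * (norm (v' t))\<^sup>2 + 3 / 2 * \<delta> * ((norm (v' t))\<^sup>2 - inner (A (v t)) (v t))" for t
  have F: "(F has_real_derivative F' t) (at t within {0..})" if t: "0 \<le> t" for t
  proof -
    have v''t: "v'' t = - \<alpha> *\<^sub>R v' t - A (v t)"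
      using ode[OF t] by (simp add: algebra_simps eq_neg_iff_add_eq_0)
    have "(F has_real_derivative (1 / 2 * (inner (v' t) (v'' t) + inner (v'' t) (v' t) + 2 * inner (A (v t)) (v' t))
      + 3 / 2 * \<delta> * (inner (v' t) (v' t) + inner (v'' t) (v t))
      + 3 / 4 * \<delta> * \<alpha> * (inner (v t) (v' t) + inner (v' t) (v t)))) (at t within {0..})"
      unfolding F_def power2_norm_eq_inner
      by (intro DERIV_add DERIV_cmult e t has_real_derivative_inner v v')
    also have "(1 / 2 * (inner (v' t) (v'' t) + inner (v'' t) (v' t) + 2 * inner (A (v t)) (v' t))
      + 3 / 2 * \<delta> * (inner (v' t) (v' t) + inner (v'' t) (v t))
      + 3 / 4 * \<delta> * \<alpha> * (inner (v t) (v' t) + inner (v' t) (v t))) = F' t"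
      unfolding F'_def v''t power2_norm_eq_inner
      by (simp add: inner_diff_left inner_diff_right inner_commute[of "v' t" "A (v t)"] inner_commute[of "v' t" "v t"] algebra_simps)
    finally show ?thesis .
  qed
  have cs: "\<bar>inner (v' t) (v t)\<bar> \<le> norm (v' t) * norm (v t)" for t by (rule Cauchy_Schwarz_ineq2)
  have decay: "F' t + 2 * \<delta> * F t \<le> 0" if "0 \<le> t" for t
    using lyapunov_decay[OF \<delta> coercive[OF vD[OF that]] cs[of t]] unfolding F_def F'_def by simp
  have equiv: "1 / 4 * ((norm (v' t))\<^sup>2 + inner (A (v t)) (v t)) \<le> F t"
    "F t \<le> 3 / 4 * ((norm (v' t))\<^sup>2 + inner (A (v t)) (v t))" if "0 \<le> t" for t
    using lyapunov_equivalent[OF \<delta> coercive[OF vD[OF that]] cs[of t]] unfolding F_def by simp_all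
  have "exp (2 * \<delta> * t) * F t \<le> exp (2 * \<delta> * 0) * F 0"
  proof (rule nonincreasing_on_atLeast[OF _ _ t])
    fix s :: real assume s: "0 \<le> s"
    show "((\<lambda>t. exp (2 * \<delta> * t) * F t) has_real_derivative exp (2 * \<delta> * s) * (F' s + 2 * \<delta> * F s)) (at s within {0..})"
      by (rule derivative_eq_intros F s refl | simp add: algebra_simps)+
    show "exp (2 * \<delta> * s) * (F' s + 2 * \<delta> * F s) \<le> 0"
      using decay[OF s] by (simp add: mult_le_0_iff)
  qed
  hence "exp (- 2 * \<delta> * t) * (exp (2 * \<delta> * t) * F t) \<le> exp (- 2 * \<delta> * t) * F 0"
    by (intro mult_left_mono) auto
  hence "F t \<le> exp (- 2 * \<delta> * t) * F 0" by (simp add: mult.assoc[symmetric] exp_add[symmetric])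
  also have "\<dots> \<le> exp (- 2 * \<delta> * t) * (3 / 4 * ((norm (v' 0))\<^sup>2 + inner (A (v 0)) (v 0)))"
    by (intro mult_left_mono equiv) auto
  finally show ?thesis using equiv(1)[OF t] by (simp add: algebra_simps)
qed

definition primitive :: "real \<Rightarrow> 'h" where "primitive t = integral {0..t} u"

lemma primitive_derivative:
  assumes t: "0 \<le> t"
  shows "(primitive has_vector_derivative u t) (at t within {0..})"
proof -
  have "(primitive has_vector_derivative u t) (at t within {0..t+1})"
    unfolding primitive_def using t integral_has_vector_derivative[OF cont_T(1), of t "t+1"] by simp
  thus ?thesis using t by (simp add: at_within_atLeastAtMost_eq)
qed

lemma primitive_in_H:
  assumes "0 \<le> t"
  shows "primitive t \<in> H"
  unfolding H
proof (clarify)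
  fix g assume g: "g \<in> G"
  have "inner (primitive t) g = inner (primitive 0) g"
  proof (rule zero_derivative_const_atLeast[OF _ assms])
    fix s :: real assume s: "0 \<le> s"
    have "inner (u s) g = 0" using u_in_H(1)[OF s] g by (simp add: H)
    thus "((\<lambda>t. inner (primitive t) g) has_real_derivative 0) (at s within {0..})"
      using has_real_derivative_inner_left[OF primitive_derivative[OF s], of g] by simp
  qed
  thus "inner (primitive t) g = 0" by (simp add: primitive_def)
qed

text \<open>The time derivative of $(u',w)+\alpha(u,w)+(\int_0^t u,Aw)$ vanishes.\<close>

lemma integrated_equation:
  assumes "w \<in> D" "0 \<le> s" "0 \<le> t"
  shows "inner (A w) (primitive s - primitive t) = - inner w ((u' s - u' t) + \<alpha> *\<^sub>R (u s - u t))"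
proof -
  define g where "g t = inner (u' t) w + \<alpha> * inner (u t) w + inner (primitive t) (A w)" for t
  have g: "g t = g 0" if t: "0 \<le> t" for t
  proof (rule zero_derivative_const_atLeast[OF _ t])
    fix s :: real assume s: "0 \<le> s"
    from DERIV_add[OF DERIV_add[OF inner_u'_derivative[OF assms(1) s] DERIV_cmult[OF inner_u_derivative[OF s], of \<alpha> w]]
        has_real_derivative_inner_left[OF primitive_derivative[OF s], of "A w"]]
    show "(g has_real_derivative 0) (at s within {0..})" unfolding g_def by simp
  qed
  have "g s = g t" using g assms by metis
  thus ?thesis
    by (simp add: g_def inner_diff_left inner_diff_right inner_add_right inner_commute[of w] inner_commute[of "A w"] algebra_simps)
qed

text \<open>The Steklov average $\frac1h\int_t^{t+h}u$ and its first two time derivatives, which are difference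
  quotients of \<open>u\<close> and \<open>u'\<close>.\<close>

definition avg :: "real \<Rightarrow> real \<Rightarrow> 'h" where "avg h t = (1 / h) *\<^sub>R (primitive (t + h) - primitive t)"
definition avg' :: "real \<Rightarrow> real \<Rightarrow> 'h" where "avg' h t = (1 / h) *\<^sub>R (u (t + h) - u t)"
definition avg'' :: "real \<Rightarrow> real \<Rightarrow> 'h" where "avg'' h t = (1 / h) *\<^sub>R (u' (t + h) - u' t)"

lemma has_vector_derivative_difference:
  assumes f: "\<And>t. 0 \<le> t \<Longrightarrow> (f has_vector_derivative f' t) (at t within {0..})"
    and "0 < h" "0 \<le> t"
  shows "((\<lambda>t. (1 / h) *\<^sub>R (f (t + h) - f t :: 'h)) has_vector_derivative (1 / h) *\<^sub>R (f' (t + h) - f' t)) (at t within {0..})"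
proof -
  have 1: "((\<lambda>t. t + h) has_vector_derivative 1) (at t within {0..})"
    by (auto intro!: derivative_eq_intros)
  have "(f has_vector_derivative f' (t + h)) (at (t + h) within (\<lambda>t. t + h) ` {0..})"
    by (rule has_vector_derivative_within_subset[OF f]) (use assms in auto)
  from vector_diff_chain_within[OF 1 this]
  have "((\<lambda>t. f (t + h)) has_vector_derivative f' (t + h)) (at t within {0..})" by (simp add: o_def)
  from has_vector_derivative_diff[OF this f[OF assms(3)]]
  show ?thesis by (rule bounded_linear.has_vector_derivative[OF bounded_linear_scaleR_right])
qed

lemma avg_derivative:
  assumes "0 < h" "0 \<le> t"
  shows "(avg h has_vector_derivative avg' h t) (at t within {0..})"
    "(avg' h has_vector_derivative avg'' h t) (at t within {0..})"
  using has_vector_derivative_difference[OF primitive_derivative assms] has_vector_derivative_difference[OF u_derivative assms]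
  by (simp_all add: avg_def[abs_def] avg'_def[abs_def] avg''_def)

lemma avg''_continuous:
  assumes "0 < h"
  shows "continuous_on {0..} (avg'' h)"
proof -
  have "continuous_on {0..} (\<lambda>t. u' (t + h))"
    by (rule continuous_on_compose2[OF cont(2)]) (use assms in \<open>auto intro!: continuous_intros\<close>)
  thus ?thesis unfolding avg''_def[abs_def] by (intro continuous_intros cont)
qed

text \<open>By the integrated equation, $(Aw,\cdot)$ at the average equals $(w,z)$ with
  $z=-(\mathrm{avg}''+\alpha\,\mathrm{avg}')$ in \<open>H\<close>, for all \<open>w\<close> in the domain; this is the condition for membership
  in the domain of the adjoint of \<open>A\<close>.\<close>

lemma avg_equation:
  assumes h: "0 < h" and t: "0 \<le> t"
  shows "avg h t \<in> D" "avg'' h t + \<alpha> *\<^sub>R avg' h t + A (avg h t) = 0"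
proof -
  let ?z = "- (avg'' h t + \<alpha> *\<^sub>R avg' h t)"
  have th: "0 \<le> t + h" using h t by simp
  have VH: "avg h t \<in> H" unfolding avg_def
    by (intro subspace_scale subspace_diff subspace_H primitive_in_H th t)
  have zH: "?z \<in> H" unfolding avg''_def avg'_def
    by (intro subspace_neg subspace_add subspace_scale subspace_diff subspace_H u_in_H th t)
  have w: "inner (A w) (avg h t) = inner w ?z" if "w \<in> D" for w
  proof -
    have "inner (A w) (avg h t) = (1 / h) * inner (A w) (primitive (t + h) - primitive t)" by (simp add: avg_def)
    also have "\<dots> = inner w ?z"
      unfolding integrated_equation[OF that th t] avg''_def avg'_def
      by (simp add: inner_add_right inner_diff_right algebra_simps diff_divide_distrib add_divide_distrib)
    finally show ?thesis .
  qed
  show VD: "avg h t \<in> D" by (rule D(8)[OF VH zH w])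
  have "A (avg h t) - ?z = 0"
  proof (rule eq_0_of_orthogonal_D)
    show "A (avg h t) - ?z \<in> H" by (intro subspace_diff subspace_H D(4) VD zH)
    fix x assume x: "x \<in> D"
    have "inner (A (avg h t)) x = inner (A x) (avg h t)"
      using D(7)[OF VD x] by (simp add: inner_commute)
    also have "\<dots> = inner ?z x" unfolding w[OF x] by (rule inner_commute)
    finally show "inner (A (avg h t) - ?z) x = 0" by (simp only: inner_diff_left diff_self)
  qed
  thus "avg'' h t + \<alpha> *\<^sub>R avg' h t + A (avg h t) = 0" by (simp add: algebra_simps)
qed

lemma quotient_sequence:
  fixes f :: "real \<Rightarrow> 'h"
  assumes "(f has_vector_derivative d) (at t within {0..})" "0 \<le> t"
  shows "(\<lambda>n. (1 / inverse (real (Suc n))) *\<^sub>R (f (t + inverse (real (Suc n))) - f t)) \<longlonglongrightarrow> d"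
proof -
  have "filterlim (\<lambda>n. t + inverse (real (Suc n))) (at t within {0..}) sequentially"
    unfolding filterlim_at
  proof
    show "(\<lambda>n. t + inverse (real (Suc n))) \<longlonglongrightarrow> t"
      using tendsto_add[OF tendsto_const LIMSEQ_inverse_real_of_nat, of t] by simp
    show "\<forall>\<^sub>F n in sequentially. t + inverse (real (Suc n)) \<in> {0..} \<and> t + inverse (real (Suc n)) \<noteq> t"
      using assms(2) by (intro always_eventually) auto
  qed
  from filterlim_compose[OF has_vector_derivative_quotient[OF assms(1)] this] show ?thesis by simp
qed

text \<open>\<open>A\<close> is bounded along the averages by their equation, because \<open>u'\<close> is Lipschitz continuous.\<close>

lemma avg_limits:
  fixes h :: "nat \<Rightarrow> real"
  assumes t: "0 \<le> t"
  defines "h \<equiv> \<lambda>n. inverse (real (Suc n))"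
  shows "(\<lambda>n. avg' (h n) t) \<longlonglongrightarrow> u' t" "(\<lambda>n. B (avg (h n) t)) \<longlonglongrightarrow> B (u t)"
proof -
  show avg': "(\<lambda>n. avg' (h n) t) \<longlonglongrightarrow> u' t"
    unfolding avg'_def h_def by (rule quotient_sequence[OF u_derivative[OF t] t])
  have avg: "(\<lambda>n. avg (h n) t) \<longlonglongrightarrow> u t"
    unfolding avg_def h_def by (rule quotient_sequence[OF primitive_derivative[OF t] t])
  have h: "0 < h n" "h n \<le> 1" for n by (simp_all add: h_def inverse_le_1_iff)
  obtain K where K: "\<And>s r. s \<in> {0..t + 1} \<Longrightarrow> r \<in> {0..t + 1} \<Longrightarrow> norm (u' s - u' r) \<le> K * \<bar>s - r\<bar>"
    using u'_Lipschitz[of "t + 1"] t by auto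
  have avg'': "norm (avg'' (h n) t) \<le> K" for n
  proof -
    have "norm (u' (t + h n) - u' t) \<le> K * \<bar>t + h n - t\<bar>" using t h[of n] by (intro K) auto
    thus ?thesis using h(1)[of n] unfolding avg''_def norm_scaleR by (simp add: field_simps)
  qed
  obtain K' where K': "\<And>n. norm (avg' (h n) t) \<le> K'"
    using avg' by (metis Bseq_def convergentI convergent_imp_Bseq)
  have "norm (A (avg (h n) t)) \<le> K + \<bar>\<alpha>\<bar> * K'" for n
  proof -
    have "A (avg (h n) t) = - (avg'' (h n) t + \<alpha> *\<^sub>R avg' (h n) t)"
      using avg_equation(2)[OF h(1) t] unfolding eq_neg_iff_add_eq_0 by (simp only: add.commute)
    hence "norm (A (avg (h n) t)) \<le> norm (avg'' (h n) t) + norm (\<alpha> *\<^sub>R avg' (h n) t)"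
      by (simp only: norm_minus_cancel norm_triangle_ineq)
    also have "\<dots> \<le> K + \<bar>\<alpha>\<bar> * K'" using avg''[of n] K'[of n] by (auto intro!: add_mono mult_left_mono)
    finally show ?thesis .
  qed
  thus "(\<lambda>n. B (avg (h n) t)) \<longlonglongrightarrow> B (u t)"
    using avg_equation(1)[OF h(1) t] avg by (intro B_tendsto)
qed

theorem energy_decay:
  assumes \<delta>: "0 < \<delta>" "3 * \<delta> \<le> \<alpha>" "6 * \<delta> * \<alpha> \<le> lam" and t: "0 \<le> t"
  shows "energy B u u' t \<le> 3 * exp (- 2 * \<delta> * t) * energy B u u' 0"
proof -
  define h where "h n = inverse (real (Suc n))" for n
  note lim = avg_limits[folded h_def]
  have "(norm (u' t))\<^sup>2 + (norm (B (u t)))\<^sup>2 \<le> 3 * exp (- 2 * \<delta> * t) * ((norm (u' 0))\<^sup>2 + (norm (B (u 0)))\<^sup>2)"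
  proof (rule LIMSEQ_le)
    show "(\<lambda>n. (norm (avg' (h n) t))\<^sup>2 + (norm (B (avg (h n) t)))\<^sup>2) \<longlonglongrightarrow> (norm (u' t))\<^sup>2 + (norm (B (u t)))\<^sup>2"
      by (intro tendsto_intros lim t)
    show "(\<lambda>n. 3 * exp (- 2 * \<delta> * t) * ((norm (avg' (h n) 0))\<^sup>2 + (norm (B (avg (h n) 0)))\<^sup>2))
       \<longlonglongrightarrow> 3 * exp (- 2 * \<delta> * t) * ((norm (u' 0))\<^sup>2 + (norm (B (u 0)))\<^sup>2)"
      by (intro tendsto_intros lim order_refl)
    have "(norm (avg' (h n) t))\<^sup>2 + (norm (B (avg (h n) t)))\<^sup>2 \<le>
        3 * exp (- 2 * \<delta> * t) * ((norm (avg' (h n) 0))\<^sup>2 + (norm (B (avg (h n) 0)))\<^sup>2)" for n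
    proof -
      have h: "0 < h n" by (simp add: h_def)
      show ?thesis
        using classical_decay[OF \<delta> avg_derivative[OF h] avg''_continuous[OF h] avg_equation[OF h] t]
        by (simp add: inner_A_eq_norm_B avg_equation(1)[OF h] t)
    qed
    thus "\<exists>N. \<forall>n\<ge>N. (norm (avg' (h n) t))\<^sup>2 + (norm (B (avg (h n) t)))\<^sup>2 \<le>
        3 * exp (- 2 * \<delta> * t) * ((norm (avg' (h n) 0))\<^sup>2 + (norm (B (avg (h n) 0)))\<^sup>2)" by blast
  qed
  thus ?thesis by (simp add: energy_def)
qed

end

section \<open>Decay of the energy\<close>

theorem theorem2p2:
  fixes \<Omega> :: "(real^'n) set"
    and M :: "real^'n \<Rightarrow> real^'n^'n" and a\<^sub>0 :: "real^'n \<Rightarrow> real"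
    and Dhalf :: "(real^'n) L2 set" and Ahalf :: "(real^'n) L2 \<Rightarrow> (real^'n) L2"
    and \<alpha> lam\<^sub>1 \<delta> t :: real
    and u\<^sub>0 u\<^sub>1 :: "(real^'n) L2" and u u' :: "real \<Rightarrow> (real^'n) L2"
  assumes "convex_polytopal_domain \<Omega>" and "0 < \<alpha>" and "elliptic_coeffs \<Omega> M a\<^sub>0"
    and "selfadjoint_posdef_op (L2_on \<Omega>) (ell_dom \<Omega>) (ell_op \<Omega> M a\<^sub>0)"
    and "is_sqrt_op (L2_on \<Omega>) (ell_dom \<Omega>) (ell_op \<Omega> M a\<^sub>0) Dhalf Ahalf"
    and "principal_eigenvalue (ell_dom \<Omega>) (ell_op \<Omega> M a\<^sub>0) lam\<^sub>1"
    and "u\<^sub>0 \<in> ell_dom \<Omega>" and "u\<^sub>1 \<in> Dhalf"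
    and "strong_solution (L2_on \<Omega>) (ell_dom \<Omega>) (ell_op \<Omega> M a\<^sub>0) Dhalf Ahalf \<alpha> u\<^sub>0 u\<^sub>1 u u'"
    and "0 < \<delta>" and "\<delta> \<le> 1 / 3 * min \<alpha> (lam\<^sub>1 / (2 * \<alpha>))"
    and "0 \<le> t"
  shows "energy Ahalf u u' t \<le> 3 * exp (- 2 * \<delta> * t) * energy Ahalf u u' 0"
proof -
  let ?A = "ell_op \<Omega> M a\<^sub>0"
  have sa: "selfadjoint_op (L2_on \<Omega>) (ell_dom \<Omega>) ?A"
    using assms(4) by (simp add: selfadjoint_posdef_op_def)
  note D = selfadjoint_opD[OF sa]
  obtain P where P: "polytope P" "\<Omega> = interior P" using assms(1) by (auto simp: convex_polytopal_domain_def)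
  have \<Omega>: "open \<Omega>" "bounded \<Omega>"
    using P polytope_imp_bounded[OF P(1)] interior_subset[of P] by (auto intro: bounded_subset)
  have dom: "ell_dom \<Omega> \<subseteq> closure (abs_L2 ` test_functions \<Omega>)"
  proof
    fix f assume "f \<in> ell_dom \<Omega>"
    hence f: "f \<in> H10 \<Omega>" by (simp add: ell_dom_def)
    show "f \<in> closure (abs_L2 ` test_functions \<Omega>)"
      unfolding closure_approachable
    proof (intro allI impI)
      fix e :: real assume "0 < e"
      then obtain \<phi> where \<phi>: "\<phi> \<in> test_functions \<Omega>" "H1_norm \<Omega> (f - abs_L2 \<phi>) < e"
        using f by (auto simp: H10_def)
      have "norm (f - abs_L2 \<phi>) \<le> H1_norm \<Omega> (f - abs_L2 \<phi>)"
        unfolding H1_norm_def by (rule real_le_rsqrt) (simp add: sum_nonneg)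
      hence "dist (abs_L2 \<phi>) f < e"
        using \<phi>(2) unfolding dist_norm norm_minus_commute[of "abs_L2 \<phi>"] by linarith
      thus "\<exists>y\<in>abs_L2 ` test_functions \<Omega>. dist y f < e" using \<phi>(1) by blast
    qed
  qed
  interpret dense_test_functions \<Omega>
  proof
    show "L2_on \<Omega> \<subseteq> closure (abs_L2 ` test_functions \<Omega>)"
      using D(3) closure_minimal[OF dom closed_closure] by blast
  qed (rule \<Omega>)
  obtain c where c: "0 < c" "\<And>v. v \<in> ell_dom \<Omega> \<Longrightarrow>
    c * (\<Sum>b\<in>Basis. (norm (weak_deriv \<Omega> b v))\<^sup>2) \<le> inner (?A v) v"
    using ell_op_coercive[OF dense_test_functions_axioms \<Omega>(2) assms(3)] by blast
  have coercive: "lam\<^sub>1 * (norm v)\<^sup>2 \<le> inner (?A v) v" if v: "v \<in> ell_dom \<Omega>" for v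
  proof (rule rayleigh_quotient_ge_principal_eigenvalue[OF sa subspace_L2_on[OF \<Omega>(1)] closed_L2_on[OF \<Omega>(1)] _ _ assms(6) v])
    show "0 \<le> inner (?A v) v" if "v \<in> ell_dom \<Omega>" for v
      using order_trans[OF _ c(2)[OF that]] c(1) by (simp add: sum_nonneg)
    fix \<eta> :: real assume \<eta>: "0 < \<eta>"
    obtain K :: "(real^'n) set" and k where K: "finite K"
      and le: "\<And>v. v \<in> H10 \<Omega> \<Longrightarrow> (norm v)\<^sup>2 \<le> \<eta> * c * (\<Sum>b\<in>Basis. (norm (weak_deriv \<Omega> b v))\<^sup>2) + (\<Sum>i\<in>K. (inner v (k i))\<^sup>2)"
      using friedrichs_H10[OF \<Omega>(2), of "\<eta> * c"] \<eta> c(1) by auto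
    have "(norm v)\<^sup>2 \<le> \<eta> * inner (?A v) v + (\<Sum>i\<in>K. (inner v (k i))\<^sup>2)" if v: "v \<in> ell_dom \<Omega>" for v
    proof -
      have "\<eta> * (c * (\<Sum>b\<in>Basis. (norm (weak_deriv \<Omega> b v))\<^sup>2)) \<le> \<eta> * inner (?A v) v"
        using c(2)[OF v] \<eta> by (intro mult_left_mono) auto
      with le[of v] v show ?thesis by (simp add: ell_dom_def mult.assoc)
    qed
    with K show "\<exists>(K :: (real^'n) set) c. finite K \<and>
      (\<forall>v\<in>ell_dom \<Omega>. (norm v)\<^sup>2 \<le> \<eta> * inner (?A v) v + (\<Sum>k\<in>K. (inner v (c k))\<^sup>2))" by blast
  qed
  obtain u'' where sol: "continuous_on {0..} u" "continuous_on {0..} u'"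
    "\<And>T. 0 < T \<Longrightarrow> Linfty T (ell_dom \<Omega>) ?A u \<and> Linfty T Dhalf Ahalf u' \<and> has_weak_time_deriv T u u' \<and> has_weak_time_deriv T u' u''"
    "AE t in lebesgue_on {0<..}. u'' t + \<alpha> *\<^sub>R u' t + ?A (u t) = 0"
    using assms(9) unfolding strong_solution_def by blast
  interpret damped_wave "L2_on \<Omega>" "ell_dom \<Omega>" Dhalf ?A Ahalf \<alpha> lam\<^sub>1 u u' u''
    "range (\<lambda>g. abs_L2 (\<lambda>x. indicator (- \<Omega>) x * rep_L2 g x))"
  proof
    show "L2_on \<Omega> = {y. \<forall>g\<in>range (\<lambda>g. abs_L2 (\<lambda>x. indicator (- \<Omega>) x * rep_L2 g x)). inner y g = 0}"
      using L2_on_iff_orthogonal[OF \<Omega>(1)] by auto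
  qed (use sa assms(5) coercive sol in \<open>auto\<close>)
  have "3 * \<delta> \<le> \<alpha>" "3 * \<delta> \<le> lam\<^sub>1 / (2 * \<alpha>)" using assms(11) by auto
  moreover from this(2) have "6 * \<delta> * \<alpha> \<le> lam\<^sub>1" using assms(2) by (simp add: field_simps)
  ultimately show ?thesis by (intro energy_decay assms(10,12))
qed

end
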